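(* Let $k\ge8$, $T>0$, and let $\mathcal M_T\subset\Upsilon^k$ be a generic set (defined in the context). For generic initial data $(u_0,v_0)\in\mathcal M_T$ (with initial measure of zero singular part) the corresponding global conservative solution $(u,v)$ of the two-component Novikov system is Hölder continuous on $[-T,T]\times\mathbb R$ with exponent $3/5$: there is $C>0$ such that for all $t_1,t_2\in[-T,T]$ and $x_1,x_2\in\mathbb R$, $$|u(t_1,x_1)-u(t_2,x_2)|,\ |v(t_1,x_1)-v(t_2,x_2)|\le C\big(|t_1-t_2|^{3/5}+|x_1-x_2|^{3/5}\big).$$ Moreover, for the scalar Novikov equation (the case $u=v$, with $(u_0,u_0)\in\mathcal M_T$), the generic global conservative solution is Hölder continuous with exponent $7/9$: there is $C>0$ such that for all $t_1,t_2\in[-T,T]$ and $x_1,x_2\in\mathbb R$, $$|u(t_1,x_1)-u(t_2,x_2)|\le C\big(|t_1-t_2|^{7/9}+|x_1-x_2|^{7/9}\big).$$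
   Context: **System.** The two-component Novikov system is $u_t+uvu_x+\partial_xP_1+P_2=0$, $v_t+uvv_x+\partial_xS_1+S_2=0$, with $P_1=(1-\partial_x^2)^{-1}(u^2v+uu_xv_x+\frac12vu_x^2)$, $P_2=\frac12(1-\partial_x^2)^{-1}(u_x^2v_x)$, $S_1=(1-\partial_x^2)^{-1}(uv^2+vu_xv_x+\frac12uv_x^2)$, $S_2=\frac12(1-\partial_x^2)^{-1}(u_xv_x^2)$. For $u=v$ it is the scalar Novikov equation $m_t+(u^2m)_x+uu_xm=0$, $m=u-u_{xx}$. **Data spaces.** $\Sigma=\{(f,g):f,g\in H^1(\mathbb R),\ \int f_x^2g_x^2\,dx<\infty\}$, $d_\Sigma((f_1,g_1),(f_2,g_2))^2=\|f_1-f_2\|_{H^1}^2+\|g_1-g_2\|_{H^1}^2+\|f_{1x}g_{1x}-f_{2x}g_{2x}\|_{L^2}^2$. $\Upsilon^k=(C^k(\mathbb R))^2\cap\Sigma$ with $d_{\Upsilon^k}=d_\Sigma+\|f_1-f_2\|_{C^k}+\|g_1-g_2\|_{C^k}$. Convergence in $\Upsilon^{k-1}\cap C^k_{\mathrm{loc}}(\mathbb R)$ means convergence in $d_{\Upsilon^{k-1}}$ and in $C^k(-R,R)$ for every $R>0$. **ODE system.** For $(U,V,W,Z,q)(t,\xi)$: $$U_t=-\partial_xP_1-P_2,\qquad V_t=-\partial_xS_1-S_2,$$ $$W_t=2U^2V\cos^2\tfrac W2-V\sin^2\tfrac W2-2(P_1+\partial_xP_2)\cos^2\tfrac W2,$$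 $$Z_t=2UV^2\cos^2\tfrac Z2-U\sin^2\tfrac Z2-2(S_1+\partial_xS_2)\cos^2\tfrac Z2,$$ $$q_t=q\big(U^2V+\tfrac12V-P_1-\partial_xP_2\big)\sin W+q\big(UV^2+\tfrac12U-S_1-\partial_xS_2\big)\sin Z,$$ where, at $(t,\xi)$, $P_1=\frac12\int_{\mathbb R}\mathcal E(t,\xi,\eta)p_1(t,\eta)d\eta$, $P_2=\frac18\int_{\mathbb R}\mathcal E p_2\,d\eta$, $\partial_xP_1=\frac12(\int_\xi^\infty-\int_{-\infty}^\xi)\mathcal E p_1\,d\eta$, $\partial_xP_2=\frac18(\int_\xi^\infty-\int_{-\infty}^\xi)\mathcal Ep_2\,d\eta$, and $S_1,S_2,\partial_xS_1,\partial_xS_2$ are given by the same formulas with $s_1,s_2$ in place of $p_1,p_2$; here $\mathcal E(t,\xi,\eta)=\exp\big(-\big|\int_\eta^\xi(q\cos^2\frac W2\cos^2\frac Z2)(t,s)ds\big|\big)$, $p_1=q(U^2V\cos^2\frac W2\cos^2\frac Z2+\frac14U\sin W\sin Z+\frac12V\sin^2\frac W2\cos^2\frac Z2)$, $s_1=q(UV^2\cos^2\frac W2\cos^2\frac Z2+\frac12U\cos^2\frac W2\sin^2\frac Z2+\frac14V\sin W\sin Z)$, $p_2=q\sin^2\frac W2\sin Z$, $s_2=q\sin W\sin^2\frac Z2$. The values of $W$ and $Z$ are understood modulo $2\pi$, with representatives in $(-\pi,\pi]$. **Global conservative solution (zero singular part: $d\mu_0=((\partial_xu_0)^2+(\partial_xv_0)^2+(\partial_xu_0)^2(\partial_xv_0)^2)dx$).**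 Define $y_0$ by $\int_0^{y_0(\xi)}(1+(\partial_xu_0)^2)(1+(\partial_xv_0)^2)dx=\xi$, and let $(U,V,W,Z,q)$ be the unique global solution of the ODE system with data $U_0=u_0\circ y_0$, $V_0=v_0\circ y_0$, $W_0=2\arctan((\partial_xu_0)\circ y_0)$, $Z_0=2\arctan((\partial_xv_0)\circ y_0)$, $q_0=1$. Put $y(t,\xi)=y_0(\xi)+\int_0^t(UV)(\tau,\xi)d\tau$. Then $u(t,x)=U(t,\xi)$, $v(t,x)=V(t,\xi)$ whenever $x=y(t,\xi)$, and $\mu_{(t)}([a,b])=\int_{\{\xi:y(t,\xi)\in[a,b]\}}\big(\cos^2\frac W2\sin^2\frac Z2+\sin^2\frac W2\cos^2\frac Z2+\sin^2\frac W2\sin^2\frac Z2\big)q\,(t,\xi)\,d\xi$. **Generic set.** $\mathcal M_T\subset\Upsilon^k$ is a set, open in $\Upsilon^k$ and dense in $\Upsilon^{k-1}\cap C^k_{\mathrm{loc}}(\mathbb R)$, such that for every $(u_0,v_0)\in\mathcal M_T$ the global conservative solution $(u(t),v(t),\mu_{(t)})$ of the two-component Novikov system with initial data $(u_0,v_0)$ and initial measure $d\mu_0=((\partial_xu_0)^2+(\partial_xv_0)^2+(\partial_xu_0)^2(\partial_xv_0)^2)dx$, together with the ODE solution $(U,V,W,Z,q)$ and the characteristic $y$ from which it is constructed, has the following properties. With $\Gamma^W=\{(t,\xi)\in[-T,T]\times\mathbb R:W=\pi\}$, $\Gamma^Z=\{(t,\xi)\in[-T,T]\times\mathbb R:Z=\pi\}$: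 $(W_t,W_\xi)\ne(0,0)$ and $(W_\xi,W_{\xi\xi})\ne(0,0)$ on $\Gamma^W$; $(Z_t,Z_\xi)\ne(0,0)$ and $(Z_\xi,Z_{\xi\xi})\neq(0,0)$ on $\Gamma^Z$; the images of $\Gamma^W$, $\Gamma^Z$ under $(t,\xi)\mapsto(t,y(t,\xi))$ are finite (possibly empty) unions of piecewise $C^{k-1}$ curves $\mathbf C_i^W$, respectively $\mathbf C_j^Z$, which within each family are pairwise disjoint, bounded, without self-intersections, and closed or with endpoints on $\{\pm T\}\times\mathbb R$; $u,v$ are $C^k$ in $[-T,T]\times\mathbb R$ off all these curves; $u$ is $C^1$ off $\bigcup\mathbf C_i^W$ and $v$ is $C^1$ off $\bigcup\mathbf C_j^Z$; and $d\mu_{(t)}=(u_x^2+v_x^2+u_x^2v_x^2)dx$ for all $t\in[-T,T]$. (Such a set exists for each $T>0$, $k\ge5$.) *)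

theory Defs
  imports "HOL-Analysis.Analysis" "HOL-Library.Real_Mod"
begin

text \<open>
  \<open>Ck_on m S f\<close>: \<open>f\<close> is of class \<open>C\<^sup>m\<close> on \<open>S\<close>, with derivatives taken within \<open>S\<close> (one-sided at
  boundary points). It is only used for sets on which such derivatives are unique: the line,
  nondegenerate intervals, and relatively open subsets of a strip \<open>[-T,T] \<times> \<real>\<close>.
\<close>

primrec Ck_on :: "nat \<Rightarrow> 'a::euclidean_space set \<Rightarrow> ('a \<Rightarrow> 'b::real_normed_vector) \<Rightarrow> bool" where
  "Ck_on 0 S f \<longleftrightarrow> continuous_on S f"
| "Ck_on (Suc m) S f \<longleftrightarrow>
     (\<exists>D. (\<forall>x\<in>S. (f has_derivative (\<lambda>h. \<Sum>b\<in>Basis. (h \<bullet> b) *\<^sub>R D b x)) (at x within S)) \<and>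
          (\<forall>b\<in>Basis. Ck_on m S (D b)))"


section \<open>Data spaces\<close>

definition square_integrable :: "(real \<Rightarrow> real) \<Rightarrow> bool" where
  "square_integrable f \<longleftrightarrow> f \<in> borel_measurable borel \<and> integrable lborel (\<lambda>x. (f x)\<^sup>2)"

definition L2_norm :: "(real \<Rightarrow> real) \<Rightarrow> real" where
  "L2_norm f = sqrt (LINT x|lborel. (f x)\<^sup>2)"

text \<open>
  Weak derivatives in \<open>L\<^sup>2\<close>, tested against compactly supported \<open>C\<^sup>1\<close> functions.
\<close>

definition weak_L2_derivative :: "(real \<Rightarrow> real) \<Rightarrow> (real \<Rightarrow> real) \<Rightarrow> bool" where
  "weak_L2_derivative f g \<longleftrightarrow> square_integrable g \<and>
     (\<forall>\<phi>. Ck_on 1 UNIV \<phi> \<longrightarrow> bounded {x. \<phi> x \<noteq> 0} \<longrightarrow>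
        (LINT x|lborel. f x * deriv \<phi> x) = - (LINT x|lborel. g x * \<phi> x))"

definition H1 :: "(real \<Rightarrow> real) set" where
  "H1 = {f. square_integrable f \<and> (\<exists>g. weak_L2_derivative f g)}"

definition wderiv :: "(real \<Rightarrow> real) \<Rightarrow> real \<Rightarrow> real" where
  "wderiv f = (SOME g. weak_L2_derivative f g)"

definition H1_norm :: "(real \<Rightarrow> real) \<Rightarrow> real" where
  "H1_norm f = sqrt ((L2_norm f)\<^sup>2 + (L2_norm (wderiv f))\<^sup>2)"

definition Sigma_space :: "((real \<Rightarrow> real) \<times> (real \<Rightarrow> real)) set" where
  "Sigma_space = {(f, g). f \<in> H1 \<and> g \<in> H1 \<and>
     integrable lborel (\<lambda>x. (wderiv f x)\<^sup>2 * (wderiv g x)\<^sup>2)}"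

fun dist_Sigma :: "(real \<Rightarrow> real) \<times> (real \<Rightarrow> real) \<Rightarrow> (real \<Rightarrow> real) \<times> (real \<Rightarrow> real) \<Rightarrow> real" where
  "dist_Sigma (f1, g1) (f2, g2) =
     sqrt ((H1_norm (\<lambda>x. f1 x - f2 x))\<^sup>2 + (H1_norm (\<lambda>x. g1 x - g2 x))\<^sup>2
         + (L2_norm (\<lambda>x. wderiv f1 x * wderiv g1 x - wderiv f2 x * wderiv g2 x))\<^sup>2)"

text \<open>
  \<open>C\<^sup>k(\<real>)\<close> is the normed space: the derivatives up to order \<open>k\<close> are bounded on the whole line.
\<close>

definition Ck_space :: "nat \<Rightarrow> (real \<Rightarrow> real) set" where
  "Ck_space k = {f. Ck_on k UNIV f \<and> (\<forall>i\<le>k. bounded (range ((deriv ^^ i) f)))}"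

definition Ck_norm :: "nat \<Rightarrow> real set \<Rightarrow> (real \<Rightarrow> real) \<Rightarrow> real" where
  "Ck_norm k A f = (\<Sum>i\<le>k. SUP x\<in>A. \<bar>(deriv ^^ i) f x\<bar>)"

definition Upsilon :: "nat \<Rightarrow> ((real \<Rightarrow> real) \<times> (real \<Rightarrow> real)) set" where
  "Upsilon k = (Ck_space k \<times> Ck_space k) \<inter> Sigma_space"

fun dist_Upsilon ::
  "nat \<Rightarrow> (real \<Rightarrow> real) \<times> (real \<Rightarrow> real) \<Rightarrow> (real \<Rightarrow> real) \<times> (real \<Rightarrow> real) \<Rightarrow> real" where
  "dist_Upsilon k (f1, g1) (f2, g2) = dist_Sigma (f1, g1) (f2, g2)
     + Ck_norm k UNIV (\<lambda>x. f1 x - f2 x) + Ck_norm k UNIV (\<lambda>x. g1 x - g2 x)"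

definition open_in_Upsilon :: "nat \<Rightarrow> ((real \<Rightarrow> real) \<times> (real \<Rightarrow> real)) set \<Rightarrow> bool" where
  "open_in_Upsilon k M \<longleftrightarrow> M \<subseteq> Upsilon k \<and>
     (\<forall>p\<in>M. \<exists>e>0. \<forall>p'\<in>Upsilon k. dist_Upsilon k p' p < e \<longrightarrow> p' \<in> M)"

text \<open>
  Density of a subset of \<open>\<Upsilon>\<^sup>k\<close> for the topology of \<open>\<Upsilon>\<^sup>k\<^sup>-\<^sup>1 \<inter> C\<^sup>k\<^sub>l\<^sub>o\<^sub>c\<close>. The points to be approximated
  range over \<open>\<Upsilon>\<^sup>k\<close>: a member of \<open>\<Upsilon>\<^sup>k\<^sup>-\<^sup>1 \<inter> C\<^sup>k\<^sub>l\<^sub>o\<^sub>c\<close> whose derivative of order \<open>k - 1\<close> is not uniformly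
  continuous is not a limit of any sequence in \<open>\<Upsilon>\<^sup>k\<close>.
\<close>

definition dense_weak_Upsilon :: "nat \<Rightarrow> ((real \<Rightarrow> real) \<times> (real \<Rightarrow> real)) set \<Rightarrow> bool" where
  "dense_weak_Upsilon k M \<longleftrightarrow>
     (\<forall>(f, g)\<in>Upsilon k. \<exists>F G. (\<forall>n::nat. (F n, G n) \<in> M) \<and>
        (\<lambda>n. dist_Upsilon (k - 1) (F n, G n) (f, g)) \<longlonglongrightarrow> 0 \<and>
        (\<forall>R>0. (\<lambda>n. Ck_norm k {-R<..<R} (\<lambda>x. F n x - f x)) \<longlonglongrightarrow> 0 \<and>
               (\<lambda>n. Ck_norm k {-R<..<R} (\<lambda>x. G n x - g x)) \<longlonglongrightarrow> 0))"


section \<open>The system of ordinary differential equations\<close>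

text \<open>
  In this group of definitions \<open>U, V, W, Z, q\<close> are functions of \<open>\<xi>\<close> alone (the state at a fixed time).
\<close>

definition kerE ::
  "(real \<Rightarrow> real) \<Rightarrow> (real \<Rightarrow> real) \<Rightarrow> (real \<Rightarrow> real) \<Rightarrow> real \<Rightarrow> real \<Rightarrow> real" where
  "kerE W Z q \<xi> \<eta> =
     exp (- \<bar>LBINT s=ereal \<eta>..ereal \<xi>. q s * (cos (W s / 2))\<^sup>2 * (cos (Z s / 2))\<^sup>2\<bar>)"

definition int_E ::
  "(real \<Rightarrow> real) \<Rightarrow> (real \<Rightarrow> real) \<Rightarrow> (real \<Rightarrow> real) \<Rightarrow> (real \<Rightarrow> real) \<Rightarrow> real \<Rightarrow> real" where
  "int_E W Z q p \<xi> = (LINT \<eta>|lborel. kerE W Z q \<xi> \<eta> * p \<eta>)"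

definition int_dE ::
  "(real \<Rightarrow> real) \<Rightarrow> (real \<Rightarrow> real) \<Rightarrow> (real \<Rightarrow> real) \<Rightarrow> (real \<Rightarrow> real) \<Rightarrow> real \<Rightarrow> real" where
  "int_dE W Z q p \<xi> = (LINT \<eta>:{\<xi>..}|lborel. kerE W Z q \<xi> \<eta> * p \<eta>)
                    - (LINT \<eta>:{..\<xi>}|lborel. kerE W Z q \<xi> \<eta> * p \<eta>)"

type_synonym on_state =
  "(real \<Rightarrow> real) \<Rightarrow> (real \<Rightarrow> real) \<Rightarrow> (real \<Rightarrow> real) \<Rightarrow> (real \<Rightarrow> real) \<Rightarrow> (real \<Rightarrow> real) \<Rightarrow> real \<Rightarrow> real"

definition dens_p1 :: on_state where
  "dens_p1 U V W Z q \<eta> = q \<eta> *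
     ((U \<eta>)\<^sup>2 * V \<eta> * (cos (W \<eta> / 2))\<^sup>2 * (cos (Z \<eta> / 2))\<^sup>2
      + 1/4 * U \<eta> * sin (W \<eta>) * sin (Z \<eta>)
      + 1/2 * V \<eta> * (sin (W \<eta> / 2))\<^sup>2 * (cos (Z \<eta> / 2))\<^sup>2)"

definition dens_s1 :: on_state where
  "dens_s1 U V W Z q \<eta> = q \<eta> *
     (U \<eta> * (V \<eta>)\<^sup>2 * (cos (W \<eta> / 2))\<^sup>2 * (cos (Z \<eta> / 2))\<^sup>2
      + 1/2 * U \<eta> * (cos (W \<eta> / 2))\<^sup>2 * (sin (Z \<eta> / 2))\<^sup>2
      + 1/4 * V \<eta> * sin (W \<eta>) * sin (Z \<eta>))"

definition dens_p2 :: on_state where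
  "dens_p2 U V W Z q \<eta> = q \<eta> * (sin (W \<eta> / 2))\<^sup>2 * sin (Z \<eta>)"

definition dens_s2 :: on_state where
  "dens_s2 U V W Z q \<eta> = q \<eta> * sin (W \<eta>) * (sin (Z \<eta> / 2))\<^sup>2"

definition P1 :: on_state where
  "P1 U V W Z q \<xi> = 1/2 * int_E W Z q (dens_p1 U V W Z q) \<xi>"

definition P2 :: on_state where
  "P2 U V W Z q \<xi> = 1/8 * int_E W Z q (dens_p2 U V W Z q) \<xi>"

definition dP1 :: on_state where
  "dP1 U V W Z q \<xi> = 1/2 * int_dE W Z q (dens_p1 U V W Z q) \<xi>"

definition dP2 :: on_state where
  "dP2 U V W Z q \<xi> = 1/8 * int_dE W Z q (dens_p2 U V W Z q) \<xi>"

definition S1 :: on_state where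
  "S1 U V W Z q \<xi> = 1/2 * int_E W Z q (dens_s1 U V W Z q) \<xi>"

definition S2 :: on_state where
  "S2 U V W Z q \<xi> = 1/8 * int_E W Z q (dens_s2 U V W Z q) \<xi>"

definition dS1 :: on_state where
  "dS1 U V W Z q \<xi> = 1/2 * int_dE W Z q (dens_s1 U V W Z q) \<xi>"

definition dS2 :: on_state where
  "dS2 U V W Z q \<xi> = 1/8 * int_dE W Z q (dens_s2 U V W Z q) \<xi>"

text \<open>
  From here on \<open>U, V, W, Z, q\<close> are functions of \<open>t\<close> and \<open>\<xi>\<close>. The angles \<open>W, Z\<close> are represented by their
  continuous-in-time real lifts (the right-hand sides are \<open>2\<pi>\<close>-periodic in them); the condition
  \<open>W = \<pi>\<close> modulo \<open>2\<pi>\<close> is expressed by a congruence below.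
\<close>

type_synonym spacetime = "real \<Rightarrow> real \<Rightarrow> real"

definition ode_system :: "spacetime \<Rightarrow> spacetime \<Rightarrow> spacetime \<Rightarrow> spacetime \<Rightarrow> spacetime \<Rightarrow> bool" where
  "ode_system U V W Z q \<longleftrightarrow> (\<forall>t \<xi>.
     (let P1' = P1 (U t) (V t) (W t) (Z t) (q t) \<xi>;   P2' = P2 (U t) (V t) (W t) (Z t) (q t) \<xi>;
          dP1' = dP1 (U t) (V t) (W t) (Z t) (q t) \<xi>; dP2' = dP2 (U t) (V t) (W t) (Z t) (q t) \<xi>;
          S1' = S1 (U t) (V t) (W t) (Z t) (q t) \<xi>;   S2' = S2 (U t) (V t) (W t) (Z t) (q t) \<xi>;
          dS1' = dS1 (U t) (V t) (W t) (Z t) (q t) \<xi>; dS2' = dS2 (U t) (V t) (W t) (Z t) (q t) \<xi>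
      in
       ((\<lambda>\<tau>. U \<tau> \<xi>) has_real_derivative (- dP1' - P2')) (at t) \<and>
       ((\<lambda>\<tau>. V \<tau> \<xi>) has_real_derivative (- dS1' - S2')) (at t) \<and>
       ((\<lambda>\<tau>. W \<tau> \<xi>) has_real_derivative
          (2 * (U t \<xi>)\<^sup>2 * V t \<xi> * (cos (W t \<xi> / 2))\<^sup>2 - V t \<xi> * (sin (W t \<xi> / 2))\<^sup>2
             - 2 * (P1' + dP2') * (cos (W t \<xi> / 2))\<^sup>2)) (at t) \<and>
       ((\<lambda>\<tau>. Z \<tau> \<xi>) has_real_derivative
          (2 * U t \<xi> * (V t \<xi>)\<^sup>2 * (cos (Z t \<xi> / 2))\<^sup>2 - U t \<xi> * (sin (Z t \<xi> / 2))\<^sup>2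
             - 2 * (S1' + dS2') * (cos (Z t \<xi> / 2))\<^sup>2)) (at t) \<and>
       ((\<lambda>\<tau>. q \<tau> \<xi>) has_real_derivative
          (q t \<xi> * ((U t \<xi>)\<^sup>2 * V t \<xi> + 1/2 * V t \<xi> - P1' - dP2') * sin (W t \<xi>)
             + q t \<xi> * (U t \<xi> * (V t \<xi>)\<^sup>2 + 1/2 * U t \<xi> - S1' - dS2') * sin (Z t \<xi>))) (at t)))"

text \<open>
  The well-posedness class of the system: locally uniformly in time, \<open>U, V, W, Z\<close> are bounded in
  \<open>L\<^sup>2 \<inter> L\<^sup>\<infinity>\<close>, and \<open>q\<close> is bounded and bounded away from zero. In this class all the integrals above
  converge absolutely (\<open>kerE\<close> decays exponentially in \<open>\<bar>\<xi> - \<eta>\<bar>\<close>), and solutions are unique.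
\<close>

definition solution_class :: "spacetime \<Rightarrow> spacetime \<Rightarrow> spacetime \<Rightarrow> spacetime \<Rightarrow> spacetime \<Rightarrow> bool" where
  "solution_class U V W Z q \<longleftrightarrow> (\<forall>T>0. \<exists>B>0. \<forall>t\<in>{-T..T}.
     (\<forall>F\<in>{U, V, W, Z}. square_integrable (F t) \<and> L2_norm (F t) \<le> B \<and> (\<forall>\<xi>. \<bar>F t \<xi>\<bar> \<le> B)) \<and>
     q t \<in> borel_measurable borel \<and> (\<forall>\<xi>. 1 / B \<le> q t \<xi> \<and> q t \<xi> \<le> B))"


section \<open>Global conservative solutions\<close>

text \<open>
  Everything in this section is for initial data whose initial measure has zero singular part; the
  data are at least \<open>C\<^sup>1\<close>, so that \<open>deriv\<close> is their derivative and \<open>y_init\<close> is well defined (the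
  integrand is at least \<open>1\<close>).
\<close>

definition y_init :: "(real \<Rightarrow> real) \<Rightarrow> (real \<Rightarrow> real) \<Rightarrow> real \<Rightarrow> real" where
  "y_init u0 v0 \<xi> =
     (THE z. (LBINT x=ereal 0..ereal z. (1 + (deriv u0 x)\<^sup>2) * (1 + (deriv v0 x)\<^sup>2)) = \<xi>)"

definition ode_solution ::
  "(real \<Rightarrow> real) \<Rightarrow> (real \<Rightarrow> real) \<Rightarrow> spacetime \<Rightarrow> spacetime \<Rightarrow> spacetime \<Rightarrow> spacetime \<Rightarrow> spacetime \<Rightarrow> bool" where
  "ode_solution u0 v0 U V W Z q \<longleftrightarrow>
     ode_system U V W Z q \<and> solution_class U V W Z q \<and>
     (\<forall>\<xi>. U 0 \<xi> = u0 (y_init u0 v0 \<xi>) \<and> V 0 \<xi> = v0 (y_init u0 v0 \<xi>) \<and>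
          W 0 \<xi> = 2 * arctan (deriv u0 (y_init u0 v0 \<xi>)) \<and>
          Z 0 \<xi> = 2 * arctan (deriv v0 (y_init u0 v0 \<xi>)) \<and>
          q 0 \<xi> = 1)"

definition conservative_construction ::
  "(real \<Rightarrow> real) \<Rightarrow> (real \<Rightarrow> real) \<Rightarrow> spacetime \<Rightarrow> spacetime \<Rightarrow> spacetime \<Rightarrow> spacetime \<Rightarrow> spacetime \<Rightarrow> spacetime \<Rightarrow>
   spacetime \<Rightarrow> spacetime \<Rightarrow> (real \<Rightarrow> real measure) \<Rightarrow> bool" where
  "conservative_construction u0 v0 U V W Z q y u v \<mu> \<longleftrightarrow>
     ode_solution u0 v0 U V W Z q \<and>
     (\<forall>t \<xi>. y t \<xi> = y_init u0 v0 \<xi> + (LBINT \<tau>=ereal 0..ereal t. U \<tau> \<xi> * V \<tau> \<xi>)) \<and>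
     (\<forall>t \<xi>. u t (y t \<xi>) = U t \<xi> \<and> v t (y t \<xi>) = V t \<xi>) \<and>
     (\<forall>t. sets (\<mu> t) = sets borel \<and>
        (\<forall>a b. emeasure (\<mu> t) {a..b} =
           (\<integral>\<^sup>+\<xi>\<in>{\<xi>. y t \<xi> \<in> {a..b}}.
              ennreal (((cos (W t \<xi> / 2))\<^sup>2 * (sin (Z t \<xi> / 2))\<^sup>2
                        + (sin (W t \<xi> / 2))\<^sup>2 * (cos (Z t \<xi> / 2))\<^sup>2
                        + (sin (W t \<xi> / 2))\<^sup>2 * (sin (Z t \<xi> / 2))\<^sup>2) * q t \<xi>) \<partial>lborel)))"

definition global_conservative_solution ::
  "(real \<Rightarrow> real) \<Rightarrow> (real \<Rightarrow> real) \<Rightarrow> spacetime \<Rightarrow> spacetime \<Rightarrow> (real \<Rightarrow> real measure) \<Rightarrow> bool" where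
  "global_conservative_solution u0 v0 u v \<mu> \<longleftrightarrow>
     (\<exists>U V W Z q y. conservative_construction u0 v0 U V W Z q y u v \<mu>)"


section \<open>Generic sets\<close>

text \<open>
  Curves in the \<open>(t, x)\<close> plane, parametrised over \<open>[0,1]\<close>. No regularity of the parametrisation
  (nonvanishing velocity) is imposed: the images of the level curves of \<open>W\<close> and \<open>Z\<close> may have cusps.
\<close>

definition piecewise_Ck_curve :: "nat \<Rightarrow> (real \<Rightarrow> real \<times> real) \<Rightarrow> bool" where
  "piecewise_Ck_curve m c \<longleftrightarrow> path c \<and>
     (\<exists>S. finite S \<and> {0, 1} \<subseteq> S \<and> S \<subseteq> {0..1} \<and>
        (\<forall>a\<in>S. \<forall>b\<in>S. a < b \<and> {a<..<b} \<inter> S = {} \<longrightarrow> Ck_on m {a..b} c))"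

definition singular_curve_family :: "nat \<Rightarrow> real \<Rightarrow> (real \<Rightarrow> real \<times> real) set \<Rightarrow> bool" where
  "singular_curve_family m T \<C> \<longleftrightarrow> finite \<C> \<and>
     (\<forall>c\<in>\<C>. piecewise_Ck_curve m c \<and> simple_path c \<and> bounded (path_image c) \<and>
        (pathfinish c = pathstart c \<or> {fst (pathstart c), fst (pathfinish c)} \<subseteq> {-T, T})) \<and>
     (\<forall>c\<in>\<C>. \<forall>c'\<in>\<C>. c \<noteq> c' \<longrightarrow> path_image c \<inter> path_image c' = {})"

definition level_pi :: "real \<Rightarrow> spacetime \<Rightarrow> (real \<times> real) set" where
  "level_pi T W = {(t, \<xi>). t \<in> {-T..T} \<and> [W t \<xi> = pi] (rmod (2 * pi))}"

definition nondegenerate_level :: "real \<Rightarrow> spacetime \<Rightarrow> bool" where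
  "nondegenerate_level T W \<longleftrightarrow> (\<forall>(t, \<xi>)\<in>level_pi T W.
     (deriv (\<lambda>\<tau>. W \<tau> \<xi>) t, deriv (W t) \<xi>) \<noteq> (0, 0) \<and>
     (deriv (W t) \<xi>, deriv (deriv (W t)) \<xi>) \<noteq> (0, 0))"

definition generic_properties ::
  "nat \<Rightarrow> real \<Rightarrow> spacetime \<Rightarrow> spacetime \<Rightarrow> spacetime \<Rightarrow> spacetime \<Rightarrow> spacetime \<Rightarrow> (real \<Rightarrow> real measure) \<Rightarrow> bool" where
  "generic_properties k T W Z y u v \<mu> \<longleftrightarrow>
     nondegenerate_level T W \<and> nondegenerate_level T Z \<and>
     (\<exists>\<C>W \<C>Z.
        singular_curve_family (k - 1) T \<C>W \<and> singular_curve_family (k - 1) T \<C>Z \<and>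
        (\<lambda>(t, \<xi>). (t, y t \<xi>)) ` level_pi T W = (\<Union>c\<in>\<C>W. path_image c) \<and>
        (\<lambda>(t, \<xi>). (t, y t \<xi>)) ` level_pi T Z = (\<Union>c\<in>\<C>Z. path_image c) \<and>
        Ck_on k ({-T..T} \<times> UNIV - (\<Union>c\<in>\<C>W \<union> \<C>Z. path_image c)) (\<lambda>(t, x). u t x) \<and>
        Ck_on k ({-T..T} \<times> UNIV - (\<Union>c\<in>\<C>W \<union> \<C>Z. path_image c)) (\<lambda>(t, x). v t x) \<and>
        Ck_on 1 ({-T..T} \<times> UNIV - (\<Union>c\<in>\<C>W. path_image c)) (\<lambda>(t, x). u t x) \<and>
        Ck_on 1 ({-T..T} \<times> UNIV - (\<Union>c\<in>\<C>Z. path_image c)) (\<lambda>(t, x). v t x)) \<and>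
     (\<forall>t\<in>{-T..T}. \<mu> t = density lborel (\<lambda>x. ennreal
        ((deriv (u t) x)\<^sup>2 + (deriv (v t) x)\<^sup>2 + (deriv (u t) x)\<^sup>2 * (deriv (v t) x)\<^sup>2)))"

definition generic_set :: "nat \<Rightarrow> real \<Rightarrow> ((real \<Rightarrow> real) \<times> (real \<Rightarrow> real)) set \<Rightarrow> bool" where
  "generic_set k T M \<longleftrightarrow> open_in_Upsilon k M \<and> dense_weak_Upsilon k M \<and>
     (\<forall>u0 v0 U V W Z q y u v \<mu>. (u0, v0) \<in> M \<longrightarrow>
        conservative_construction u0 v0 U V W Z q y u v \<mu> \<longrightarrow> generic_properties k T W Z y u v \<mu>)"

end

theory Submission
  imports Defs
begin

text \<open>
  Along characteristics \<open>y\<^sub>\<xi> = q cos\<^sup>2(W/2) cos\<^sup>2(Z/2)\<close> and \<open>U\<^sub>\<xi> = q/2 sin W cos\<^sup>2(Z/2)\<close>, so with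
  \<open>\<phi> = cos(W/2)\<close>, \<open>\<psi> = cos(Z/2)\<close> one has \<open>\<bar>U\<^sub>\<xi>\<bar> \<le> q \<bar>\<phi>\<bar> \<psi>\<^sup>2\<close> and \<open>y\<^sub>\<xi> = q \<phi>\<^sup>2 \<psi>\<^sup>2\<close>. The right-hand sides of the
  equations gain one derivative in \<open>\<xi>\<close>, hence \<open>W\<close> is \<open>C\<^sup>2\<close> in \<open>\<xi>\<close>, jointly continuously in time, and it
  decays as \<open>\<bar>\<xi>\<bar> \<rightarrow> \<infinity>\<close> uniformly in \<open>t\<close>. As \<open>(W\<^sub>\<xi>, W\<^sub>\<xi>\<^sub>\<xi>) \<noteq> 0\<close> where \<open>W = \<pi>\<close>, compactness shows that
  \<open>{\<bar>\<phi>\<bar> < \<epsilon>}\<close> has measure \<open>O(\<epsilon>\<^sup>1\<^sup>/\<^sup>2)\<close>. Splitting \<open>\<integral> \<bar>U\<^sub>\<xi>\<bar>\<close> at this set gives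
  \<open>\<bar>\<Delta>U\<bar> \<le> C (\<epsilon>\<^sup>3\<^sup>/\<^sup>2 + \<Delta>y/\<epsilon>)\<close>, which is \<open>O((\<Delta>y)\<^sup>3\<^sup>/\<^sup>5)\<close> for the best \<open>\<epsilon>\<close>. If \<open>u = v\<close> then
  \<open>U\<^sub>\<xi> = V\<^sub>\<xi>\<close> forces \<open>\<bar>\<phi>\<bar> = \<bar>\<psi>\<bar>\<close> where \<open>y\<^sub>\<xi> \<noteq> 0\<close>, so \<open>\<bar>U\<^sub>\<xi>\<bar> \<le> q \<bar>\<phi>\<bar>\<^sup>3\<close>, \<open>y\<^sub>\<xi> = q \<phi>\<^sup>4\<close>, and
  \<open>\<bar>\<Delta>U\<bar> \<le> C (\<epsilon>\<^sup>7\<^sup>/\<^sup>2 + \<Delta>y/\<epsilon>)\<close> yields \<open>7/9\<close>. In \<open>t\<close> both \<open>U\<close> and \<open>y\<close> are Lipschitz.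
\<close>

text \<open>The obstacle is regularity in \<open>\<xi>\<close>: \<open>solution_class\<close> gives
  states that are only bounded and measurable in \<open>\<xi>\<close>, and the equations hold
  separately for every \<open>\<xi>\<close>, whereas nondegeneracy speaks about two
  \<open>\<xi>\<close>-derivatives of \<open>W\<close>. What breaks the circle is that the nonlocal
  terms are Lipschitz in \<open>\<xi>\<close> for any bounded measurable density. Gronwall's
  inequality transfers this to \<open>U, V, W, Z, q\<close>; the densities are then continuous,
  which makes the nonlocal terms \<open>C^1\<close>, hence \<open>W, Z, q\<close> as well, and
  repeating the argument gives \<open>W\<close> its second derivative. The formulas for
  \<open>y_\<xi>\<close> and \<open>U_\<xi>\<close> are not part of the definition of a solution
  either. They hold at time 0, and the explicit expressions evolve in \<open>t\<close> exactly as
  the derivatives of \<open>y\<close> and \<open>U\<close> must, so they persist. Both exponents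
  come from balancing \<open>\<epsilon>^(n + 1/2)\<close> against \<open>A / \<epsilon>\<close>:
  \<open>n\<close> is 1 or 3, the power of \<open>cos (W/2)\<close> that bounds
  \<open>U_\<xi>\<close> on the bad set, and the 1/2 reflects zeros of multiplicity at most two. The
  result is \<open>A^((2n + 1)/(2n + 3))\<close>.\<close>

text \<open>The primitive vanishing at \<open>0\<close>, written over a fixed interval so that theorems on parametric
  integrals apply to it jointly in \<open>x\<close> and the parameter.\<close>

definition prim :: "(real \<Rightarrow> real) \<Rightarrow> real \<Rightarrow> real" where
  "prim f x = x * integral {0..1} (\<lambda>s. f (x * s))"

lemma prim_eq_diff:
  assumes "\<And>x. (F has_real_derivative f x) (at x)"
  shows "prim f x = F x - F 0"
proof -
  have "((\<lambda>s. x * f (x * s)) has_integral F (x * 1) - F (x * 0)) {0..1}"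
  proof (rule fundamental_theorem_of_calculus)
    fix s :: real
    have "((\<lambda>s. F (x * s)) has_real_derivative f (x * s) * x) (at s)"
      by (rule DERIV_chain2[OF assms]) (auto intro!: derivative_eq_intros)
    then show "((\<lambda>s. F (x * s)) has_vector_derivative x * f (x * s)) (at s within {0..1})"
      by (auto intro: has_field_derivative_at_within
          simp: mult.commute simp flip: has_real_derivative_iff_has_vector_derivative)
  qed simp
  then show ?thesis
    by (auto simp: prim_def dest!: integral_unique)
qed

lemma ex_antiderivative:
  assumes "continuous_on UNIV (f :: real \<Rightarrow> real)"
  obtains F where "\<And>x. (F has_real_derivative f x) (at x)"
proof -
  have "\<exists>F. \<forall>x::real. -\<infinity> < ereal x \<longrightarrow> ereal x < \<infinity> \<longrightarrow> (F has_vector_derivative f x) (at x)"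
    by (rule einterval_antiderivative) (use assms in \<open>auto simp: continuous_on_eq_continuous_at\<close>)
  then show ?thesis using that
    by (auto simp: has_real_derivative_iff_has_vector_derivative)
qed

lemma prim_has_derivative:
  assumes "continuous_on UNIV f"
  shows "(prim f has_real_derivative f x) (at x)"
proof -
  obtain F where F: "\<And>x. (F has_real_derivative f x) (at x)"
    using ex_antiderivative[OF assms] by blast
  have "prim f = (\<lambda>x. F x - F 0)"
    using prim_eq_diff[OF F] by auto
  then show ?thesis
    by (auto intro!: derivative_eq_intros F)
qed

lemma prim_0 [simp]: "prim f 0 = 0"
  by (simp add: prim_def)

lemma LBINT_eq_diff:
  fixes a b :: real
  assumes "\<And>x. (F has_real_derivative f x) (at x)" "continuous_on UNIV f"
  shows "(LBINT s=ereal a..ereal b. f s) = F b - F a"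
  by (rule interval_integral_FTC_finite)
    (auto intro!: has_field_derivative_at_within assms continuous_on_subset[OF assms(2)]
        simp flip: has_real_derivative_iff_has_vector_derivative)

lemma LBINT_eq_prim:
  assumes "continuous_on UNIV f"
  shows "(LBINT s=ereal 0..ereal x. f s) = prim f x"
  using LBINT_eq_diff[OF prim_has_derivative[OF assms] assms, of 0 x] by simp

lemma continuous_on_prim:
  fixes f :: "'a::topological_space \<Rightarrow> real \<Rightarrow> real"
  assumes "continuous_on UNIV (\<lambda>z. f (fst z) (snd z))"
  shows "continuous_on UNIV (\<lambda>z. prim (f (fst z)) (snd z))"
proof -
  have c: "continuous_on S (\<lambda>x. f (a x) (b x))"
    if "continuous_on S a" "continuous_on S b" for S a and b :: "('a \<times> real) \<times> real \<Rightarrow> real"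
    using continuous_on_compose2[OF assms continuous_on_Pair[OF that]] by simp
  have "continuous_on UNIV (\<lambda>z. integral (cbox 0 1) (\<lambda>s. f (fst z) (snd z * s)))"
    by (rule integral_continuous_on_param) (auto simp: case_prod_beta intro!: c continuous_intros)
  then show ?thesis
    unfolding prim_def by (auto intro!: continuous_intros simp: box_real)
qed

lemma eq_prim:
  assumes "\<And>x. (F has_real_derivative f x) (at x)"
  shows "F x = F 0 + prim f x"
  using prim_eq_diff[OF assms] by simp

lemma abs_diff_le_of_derivative_bound:
  fixes f :: "real \<Rightarrow> real"
  assumes "\<And>x. x \<in> {a..b} \<Longrightarrow> (f has_real_derivative f' x) (at x)" "\<And>x. x \<in> {a..b} \<Longrightarrow> \<bar>f' x\<bar> \<le> C"
    and "x \<in> {a..b}" "y \<in> {a..b}"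
  shows "\<bar>f x - f y\<bar> \<le> C * \<bar>x - y\<bar>"
  using field_differentiable_bound[of "{a..b}" f f' C x y] assms
  by (auto intro: DERIV_subset)

subsection \<open>Joint continuity\<close>

definition jc :: "(real \<Rightarrow> real \<Rightarrow> real) \<Rightarrow> bool" where
  "jc f \<longleftrightarrow> continuous_on UNIV (\<lambda>z. f (fst z) (snd z))"

lemma jc_compose:
  assumes "jc f" "continuous_on S a" "continuous_on S b"
  shows "continuous_on S (\<lambda>x. f (a x) (b x))"
  using continuous_on_compose2[OF assms(1)[unfolded jc_def] continuous_on_Pair[OF assms(2,3)]] by simp

lemma jc_const: "jc (\<lambda>t x. c)"
  and jc_add: "jc f \<Longrightarrow> jc g \<Longrightarrow> jc (\<lambda>t x. f t x + g t x)"
  and jc_diff: "jc f \<Longrightarrow> jc g \<Longrightarrow> jc (\<lambda>t x. f t x - g t x)"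
  and jc_minus: "jc f \<Longrightarrow> jc (\<lambda>t x. - f t x)"
  and jc_mult: "jc f \<Longrightarrow> jc g \<Longrightarrow> jc (\<lambda>t x. f t x * g t x)"
  and jc_power: "jc f \<Longrightarrow> jc (\<lambda>t x. f t x ^ n)"
  and jc_divide: "jc f \<Longrightarrow> c \<noteq> 0 \<Longrightarrow> jc (\<lambda>t x. f t x / c)"
  and jc_sin: "jc f \<Longrightarrow> jc (\<lambda>t x. sin (f t x))"
  and jc_cos: "jc f \<Longrightarrow> jc (\<lambda>t x. cos (f t x))"
  and jc_exp: "jc f \<Longrightarrow> jc (\<lambda>t x. exp (f t x))"
  unfolding jc_def by (auto intro!: continuous_intros)

lemmas jc_intros = jc_const jc_add jc_diff jc_minus jc_mult jc_power jc_divide jc_sin jc_cos jc_exp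

lemma jc_space: "continuous_on UNIV f \<Longrightarrow> jc (\<lambda>t x. f x)"
  unfolding jc_def by (rule continuous_on_compose2[of UNIV f]) (auto intro: continuous_intros)

lemma jc_prim_time:
  assumes "jc f"
  shows "jc (\<lambda>t x. prim (\<lambda>\<tau>. f \<tau> x) t)"
proof -
  have "continuous_on UNIV (\<lambda>z. prim (\<lambda>\<tau>. f \<tau> (fst z)) (snd z))"
    by (rule continuous_on_prim[of "\<lambda>x \<tau>. f \<tau> x"]) (intro jc_compose[OF assms] continuous_intros)
  then have "jc (\<lambda>x t. prim (\<lambda>\<tau>. f \<tau> x) t)"
    by (simp add: jc_def)
  from jc_compose[OF this continuous_on_snd[OF continuous_on_id] continuous_on_fst[OF continuous_on_id], of UNIV]
  show ?thesis by (simp add: jc_def)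
qed

lemma jc_prim_space:
  assumes "jc f"
  shows "jc (\<lambda>t. prim (f t))"
  unfolding jc_def by (rule continuous_on_prim[of f]) (use assms in \<open>simp add: jc_def\<close>)

lemma jc_time: "jc f \<Longrightarrow> continuous_on UNIV (\<lambda>t. f t x)"
  using jc_compose[of f UNIV "\<lambda>t. t" "\<lambda>_. x"] by (auto intro: continuous_intros)

lemma jc_at: "jc f \<Longrightarrow> continuous_on UNIV (f t)"
  using jc_compose[of f UNIV "\<lambda>_. t" "\<lambda>x. x"] by (auto intro: continuous_intros)

text \<open>Differentiability concerns the space variable only, but continuity is joint:
  differentiation under time integrals and the compactness argument in \<open>(t, x)\<close> both
  rely on it.\<close>

definition C1x :: "(real \<Rightarrow> real \<Rightarrow> real) \<Rightarrow> (real \<Rightarrow> real \<Rightarrow> real) \<Rightarrow> bool" where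
  "C1x f f' \<longleftrightarrow> jc f \<and> jc f' \<and> (\<forall>t x. (f t has_real_derivative f' t x) (at x))"

lemma C1xD:
  assumes "C1x f f'"
  shows "jc f" "jc f'" "(f t has_real_derivative f' t x) (at x)"
  using assms by (auto simp: C1x_def)

lemma C1x_unique:
  assumes "C1x f f'" "C1x f g'"
  shows "f' t x = g' t x"
  using DERIV_unique C1xD(3)[OF assms(1)] C1xD(3)[OF assms(2)] by blast

lemma C1x_const: "C1x (\<lambda>t x. c) (\<lambda>t x. 0)"
  and C1x_add: "C1x f f' \<Longrightarrow> C1x g g' \<Longrightarrow> C1x (\<lambda>t x. f t x + g t x) (\<lambda>t x. f' t x + g' t x)"
  and C1x_diff: "C1x f f' \<Longrightarrow> C1x g g' \<Longrightarrow> C1x (\<lambda>t x. f t x - g t x) (\<lambda>t x. f' t x - g' t x)"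
  and C1x_minus: "C1x f f' \<Longrightarrow> C1x (\<lambda>t x. - f t x) (\<lambda>t x. - f' t x)"
  and C1x_mult: "C1x f f' \<Longrightarrow> C1x g g' \<Longrightarrow>
        C1x (\<lambda>t x. f t x * g t x) (\<lambda>t x. f' t x * g t x + f t x * g' t x)"
  and C1x_power: "C1x f f' \<Longrightarrow> C1x (\<lambda>t x. f t x ^ n) (\<lambda>t x. of_nat n * f t x ^ (n - 1) * f' t x)"
  and C1x_divide: "C1x f f' \<Longrightarrow> c \<noteq> 0 \<Longrightarrow> C1x (\<lambda>t x. f t x / c) (\<lambda>t x. f' t x / c)"
  and C1x_sin: "C1x f f' \<Longrightarrow> C1x (\<lambda>t x. sin (f t x)) (\<lambda>t x. cos (f t x) * f' t x)"
  and C1x_cos: "C1x f f' \<Longrightarrow> C1x (\<lambda>t x. cos (f t x)) (\<lambda>t x. - sin (f t x) * f' t x)"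
  and C1x_exp: "C1x f f' \<Longrightarrow> C1x (\<lambda>t x. exp (f t x)) (\<lambda>t x. exp (f t x) * f' t x)"
  unfolding C1x_def by (auto intro!: jc_intros derivative_eq_intros simp: algebra_simps)

lemmas C1x_intros = C1x_const C1x_add C1x_diff C1x_minus C1x_mult C1x_power C1x_divide
  C1x_sin C1x_cos C1x_exp

lemma C1x_space:
  assumes "\<And>x. (f has_real_derivative f' x) (at x)" "continuous_on UNIV f'"
  shows "C1x (\<lambda>t. f) (\<lambda>t. f')"
  using assms DERIV_continuous_on[of UNIV f f'] by (auto simp: C1x_def intro!: jc_space)

lemma C1x_prim_time:
  assumes "C1x f f'"
  shows "C1x (\<lambda>t x. prim (\<lambda>\<tau>. f \<tau> x) t) (\<lambda>t x. prim (\<lambda>\<tau>. f' \<tau> x) t)"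
proof -
  note jc = C1xD(1,2)[OF assms]
  have "((\<lambda>x. integral (cbox 0 1) (\<lambda>s. f (t * s) x)) has_real_derivative
      integral (cbox 0 1) (\<lambda>s. f' (t * s) x)) (at x within UNIV)" for t x
    by (rule leibniz_rule_field_derivative)
      (auto simp: case_prod_beta intro!: C1xD(3)[OF assms] continuous_intros
        jc_compose[OF jc(1)] jc_compose[OF jc(2)] integrable_continuous_real)
  then have "((\<lambda>x. prim (\<lambda>\<tau>. f \<tau> x) t) has_real_derivative prim (\<lambda>\<tau>. f' \<tau> x) t) (at x)" for t x
    unfolding prim_def by (auto intro!: derivative_eq_intros simp: box_real)
  then show ?thesis
    using jc by (auto simp: C1x_def intro!: jc_prim_time)
qed

text \<open>Hadamard's lemma. The integral factor also makes sense at \<open>y = x\<close>, where it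
  is \<open>f' x\<close>, and it is continuous in \<open>y\<close> when \<open>f'\<close> is; in
  this form difference quotients extend to the diagonal.\<close>

lemma difference_quotient:
  fixes f :: "real \<Rightarrow> real"
  assumes "\<And>x. (f has_real_derivative f' x) (at x)"
  shows "f y - f x = (y - x) * integral {0..1} (\<lambda>s. f' (x + (y - x) * s))"
proof -
  have "((\<lambda>s. (y - x) * f' (x + (y - x) * s)) has_integral f (x + (y - x) * 1) - f (x + (y - x) * 0)) {0..1}"
  proof (rule fundamental_theorem_of_calculus)
    fix s :: real
    have "((\<lambda>s. f (x + (y - x) * s)) has_real_derivative f' (x + (y - x) * s) * (y - x)) (at s)"
      by (rule DERIV_chain2[OF assms]) (auto intro!: derivative_eq_intros)
    then show "((\<lambda>s. f (x + (y - x) * s)) has_vector_derivative (y - x) * f' (x + (y - x) * s)) (at s within {0..1})"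
      by (auto intro: has_field_derivative_at_within
          simp: mult.commute simp flip: has_real_derivative_iff_has_vector_derivative)
  qed simp
  then show ?thesis
    by (auto dest!: integral_unique)
qed

lemma jc_difference_quotient:
  assumes "jc f'"
  shows "jc (\<lambda>t y. integral {0..1} (\<lambda>s. f' t (x + (y - x) * s)))"
proof -
  have "continuous_on UNIV (\<lambda>z. integral (cbox 0 1) (\<lambda>s. f' (fst z) (x + (snd z - x) * s)))"
    by (rule integral_continuous_on_param)
      (auto simp: case_prod_beta intro!: jc_compose[OF assms] continuous_intros)
  then show ?thesis
    by (simp add: jc_def box_real)
qed

text \<open>By Hadamard's lemma the difference quotient of \<open>W\<close> in \<open>x\<close> solves a linear equation in \<open>t\<close> whose
  coefficients, hence also its solution, extend continuously to the diagonal.\<close>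

lemma C1x_ode:
  assumes c: "C1x c c'" and d: "C1x d d'" and W: "jc W"
    and ode: "\<And>t x. ((\<lambda>\<tau>. W \<tau> x) has_real_derivative c t x + d t x * cos (W t x)) (at t)"
    and init: "\<And>x. (W 0 has_real_derivative w0 x) (at x)" and w0: "continuous_on UNIV w0"
  shows "C1x W (\<lambda>t x. exp (- prim (\<lambda>\<tau>. d \<tau> x * sin (W \<tau> x)) t) *
    (w0 x + prim (\<lambda>\<tau>. exp (prim (\<lambda>\<tau>. d \<tau> x * sin (W \<tau> x)) \<tau>) * (c' \<tau> x + d' \<tau> x * cos (W \<tau> x))) t))"
    (is "C1x W ?W1")
proof -
  note jcs = C1xD(1,2)[OF c] C1xD(1,2)[OF d] W
  have jW1: "jc ?W1"
    by (intro jc_intros jc_space w0 jc_prim_time jcs)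
  have "(W t has_real_derivative ?W1 t x) (at x)" for t x
  proof -
    \<comment> \<open>\<open>S\<close>, \<open>qc\<close>, \<open>qd\<close>, \<open>qw\<close> are
      the Hadamard factors of the cosine (up to sign), of \<open>c\<close>, of \<open>d\<close> and
      of the initial value; \<open>K\<close> is the exponent of the integrating factor.\<close>
    define S where "S = (\<lambda>\<tau> y. integral {0..1} (\<lambda>s. sin (W \<tau> x + (W \<tau> y - W \<tau> x) * s)))"
    define qc where "qc = (\<lambda>\<tau> y. integral {0..1} (\<lambda>s. c' \<tau> (x + (y - x) * s)))"
    define qd where "qd = (\<lambda>\<tau> y. integral {0..1} (\<lambda>s. d' \<tau> (x + (y - x) * s)))"
    define qw where "qw = (\<lambda>y. integral {0..1} (\<lambda>s. w0 (x + (y - x) * s)))"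
    define K where "K = (\<lambda>\<tau> y. prim (\<lambda>\<tau>. d \<tau> x * S \<tau> y) \<tau>)"
    define B where "B = (\<lambda>\<tau> y. exp (K \<tau> y) * (qc \<tau> y + qd \<tau> y * cos (W \<tau> y)))"
    define D where "D = (\<lambda>y. exp (- K t y) * (qw y + prim (\<lambda>\<tau>. B \<tau> y) t))"
    have jS: "jc S"
    proof -
      have "continuous_on UNIV (\<lambda>z. integral (cbox 0 1) (\<lambda>s. sin (W (fst z) x + (W (fst z) (snd z) - W (fst z) x) * s)))"
        by (rule integral_continuous_on_param)
          (auto simp: case_prod_beta intro!: jc_compose[OF W] continuous_intros)
      then show ?thesis by (simp add: jc_def box_real S_def)
    qed
    have jq: "jc qc" "jc qd"
      unfolding qc_def qd_def by (intro jc_difference_quotient jcs)+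
    have jdx: "jc (\<lambda>\<tau> y. d \<tau> x)"
      unfolding jc_def by (intro jc_compose[OF jcs(3)] continuous_intros)
    have jK: "jc K"
      unfolding K_def by (intro jc_prim_time jc_intros jS jdx)
    have jB: "jc B"
      unfolding B_def by (intro jc_intros jK jq W)
    have cqw: "continuous_on UNIV qw"
      using jc_at[OF jc_difference_quotient[OF jc_space[OF w0]]] unfolding qw_def .
    have "jc (\<lambda>\<tau> y. prim (\<lambda>\<tau>. B \<tau> y) \<tau>)"
      by (intro jc_prim_time jB)
    then have cD: "continuous_on UNIV D"
      unfolding D_def by (intro continuous_intros jc_compose[OF jK] cqw) (rule jc_at)
    have key: "W t y - W t x = (y - x) * D y" for y
    proof -
      \<comment> \<open>Variation of constants: after multiplication by \<open>exp K\<close>, the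
        difference of the equations at \<open>y\<close> and \<open>x\<close> has right-hand side
        \<open>(y - x) * B\<close>, so \<open>F\<close> is constant in time.\<close>
      define F where "F = (\<lambda>\<tau>. exp (K \<tau> y) * (W \<tau> y - W \<tau> x) - (y - x) * prim (\<lambda>\<tau>. B \<tau> y) \<tau>)"
      have Sid: "cos (W \<tau> y) - cos (W \<tau> x) = - (W \<tau> y - W \<tau> x) * S \<tau> y" for \<tau>
        using difference_quotient[of cos "\<lambda>x. - sin x" "W \<tau> y" "W \<tau> x"]
        by (simp add: DERIV_cos S_def algebra_simps)
      have cid: "c \<tau> y - c \<tau> x = (y - x) * qc \<tau> y" "d \<tau> y - d \<tau> x = (y - x) * qd \<tau> y" for \<tau>
        using difference_quotient[of "c \<tau>" "c' \<tau>" y x] difference_quotient[of "d \<tau>" "d' \<tau>" y x]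
        by (simp_all add: qc_def qd_def C1xD(3)[OF c] C1xD(3)[OF d])
      have "(F has_real_derivative 0) (at \<tau>)" for \<tau>
      proof -
        have "((\<lambda>\<tau>. K \<tau> y) has_real_derivative d \<tau> x * S \<tau> y) (at \<tau>)"
          unfolding K_def by (rule prim_has_derivative) (intro continuous_intros jc_time[OF jS] jc_time[OF jcs(3)])
        moreover have "(prim (\<lambda>\<tau>. B \<tau> y) has_real_derivative B \<tau> y) (at \<tau>)"
          by (rule prim_has_derivative) (rule jc_time[OF jB])
        moreover have "((\<lambda>\<tau>. W \<tau> y - W \<tau> x) has_real_derivative
            (c \<tau> y + d \<tau> y * cos (W \<tau> y)) - (c \<tau> x + d \<tau> x * cos (W \<tau> x))) (at \<tau>)"
          by (intro DERIV_diff ode)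
        ultimately have "(F has_real_derivative
            exp (K \<tau> y) * (d \<tau> x * S \<tau> y) * (W \<tau> y - W \<tau> x) +
            ((c \<tau> y + d \<tau> y * cos (W \<tau> y)) - (c \<tau> x + d \<tau> x * cos (W \<tau> x))) * exp (K \<tau> y)
            - (y - x) * B \<tau> y) (at \<tau>)"
          unfolding F_def by (intro DERIV_diff DERIV_mult DERIV_cmult DERIV_fun_exp ode)
        moreover have "(c \<tau> y + d \<tau> y * cos (W \<tau> y)) - (c \<tau> x + d \<tau> x * cos (W \<tau> x))
            = (c \<tau> y - c \<tau> x) + (d \<tau> y - d \<tau> x) * cos (W \<tau> y) + d \<tau> x * (cos (W \<tau> y) - cos (W \<tau> x))"
          by (simp add: algebra_simps)
        ultimately show ?thesis
          unfolding B_def by (simp add: Sid cid algebra_simps)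
      qed
      then have "F t = F 0"
        using DERIV_isconst_all by blast
      moreover have "F 0 = (y - x) * qw y"
        using difference_quotient[OF init, of y x] by (simp add: F_def K_def qw_def)
      ultimately have "exp (K t y) * (W t y - W t x) = (y - x) * (qw y + prim (\<lambda>\<tau>. B \<tau> y) t)"
        by (simp add: F_def algebra_simps)
      then show ?thesis
        by (simp add: D_def exp_minus field_simps)
    qed
    \<comment> \<open>Off the diagonal \<open>D\<close> is the difference quotient, by
      \<open>key\<close>; its continuity at \<open>x\<close> supplies the derivative.\<close>
    have "(D \<longlongrightarrow> D x) (at x)"
      using cD by (simp add: continuous_on_eq_continuous_at continuous_at)
    then have "((\<lambda>y. (W t y - W t x) / (y - x)) \<longlongrightarrow> D x) (at x)"
      by (rule Lim_transform_eventually) (auto simp: key eventually_at intro!: exI[of _ 1])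
    moreover have "D x = ?W1 t x"
      by (simp add: D_def B_def K_def S_def qc_def qd_def qw_def)
    ultimately show ?thesis
      by (simp add: has_field_derivative_iff)
  qed
  with jW1 W show ?thesis
    by (simp add: C1x_def)
qed

subsection \<open>The exponential kernel\<close>

text \<open>In the coordinate \<open>Y\<close> this is twice the Green function of
  \<open>1 - d^2/dY^2\<close>.\<close>

definition EY :: "(real \<Rightarrow> real) \<Rightarrow> real \<Rightarrow> real \<Rightarrow> real" where
  "EY Y \<xi> \<eta> = exp (- \<bar>Y \<xi> - Y \<eta>\<bar>)"

text \<open>The kernel integral is split at \<open>\<xi>\<close> because each half obeys a
  first-order equation in \<open>\<xi>\<close>; \<open>int_E\<close> is the sum of the halves and
  \<open>int_dE\<close> is \<open>KR - KL\<close>.\<close>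

definition KL :: "(real \<Rightarrow> real) \<Rightarrow> (real \<Rightarrow> real) \<Rightarrow> real \<Rightarrow> real" where
  "KL Y p \<xi> = (LINT \<eta>:{..\<xi>}|lborel. EY Y \<xi> \<eta> * p \<eta>)"

definition KR :: "(real \<Rightarrow> real) \<Rightarrow> (real \<Rightarrow> real) \<Rightarrow> real \<Rightarrow> real" where
  "KR Y p \<xi> = (LINT \<eta>:{\<xi>..}|lborel. EY Y \<xi> \<eta> * p \<eta>)"

definition laplace_mass :: "real \<Rightarrow> real" where
  "laplace_mass B = (LINT \<eta>|lborel. exp (- \<bar>\<eta>\<bar> / B))"

lemma set_integrable_exp_atLeast:
  assumes "B > 0"
  shows "set_integrable lborel {0..} (\<lambda>x::real. exp (- x / B))"
proof -
  have i: "(\<lambda>x::real. exp (- (1 / B) * x)) integrable_on {0..}"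
    by (rule integrable_on_exp_minus_to_infinity) (use assms in simp)
  have "(\<lambda>x::real. exp (- (1 / B) * x)) absolutely_integrable_on {0..}"
    by (rule nonnegative_absolutely_integrable_1[OF i]) simp
  then have "integrable lebesgue (\<lambda>x::real. indicator {0..} x *\<^sub>R exp (- (1 / B) * x))"
    by (simp add: set_integrable_def)
  then have "integrable lborel (\<lambda>x::real. indicator {0..} x *\<^sub>R exp (- (1 / B) * x))"
    by (subst (asm) integrable_completion) auto
  then show ?thesis
    by (simp add: set_integrable_def)
qed

lemma integrable_laplace_0:
  assumes "B > 0"
  shows "integrable lborel (\<lambda>x::real. exp (- \<bar>x\<bar> / B))"
proof -
  have 1: "integrable lborel (\<lambda>x::real. indicator {0..} x *\<^sub>R exp (- x / B))"
    using set_integrable_exp_atLeast[OF assms] by (simp add: set_integrable_def)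
  have 2: "integrable lborel (\<lambda>x::real. indicator {0..} (0 + -1 * x) *\<^sub>R exp (- (0 + -1 * x) / B))"
    by (rule lborel_integrable_real_affine[OF 1]) simp
  show ?thesis
    by (rule Bochner_Integration.integrable_bound[OF Bochner_Integration.integrable_add[OF 1 2]])
      (auto simp: indicator_def)
qed

lemma integrable_laplace:
  assumes "B > 0"
  shows "integrable lborel (\<lambda>\<eta>::real. exp (- \<bar>\<xi> - \<eta>\<bar> / B))"
  using lborel_integrable_real_affine[OF integrable_laplace_0[OF assms], of "-1" \<xi>] by simp

lemma integral_laplace:
  "(LINT \<eta>|lborel. exp (- \<bar>\<xi> - \<eta>\<bar> / B)) = laplace_mass B"
  using lborel_integral_real_affine[of "-1" "\<lambda>\<eta>. exp (- \<bar>\<eta>\<bar> / B)" \<xi>]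
  by (simp add: laplace_mass_def)

text \<open>\<open>Y\<close> is a primitive of a density that may vanish, so it can be constant on
  stretches, of total loss at most \<open>M\<close>. The assumption \<open>low\<close> still forces
  linear growth in the large, which gives the kernel exponential decay at the price of a factor
  \<open>exp (M / B)\<close>.\<close>

locale kernel =
  fixes Y :: "real \<Rightarrow> real" and B M :: real
  assumes B: "B > 0"
    and mono: "a \<le> b \<Longrightarrow> Y a \<le> Y b"
    and lip: "a \<le> b \<Longrightarrow> Y b - Y a \<le> B * (b - a)"
    and low: "a \<le> b \<Longrightarrow> (b - a - M) / B \<le> Y b - Y a"
begin

definition mass :: real where "mass = exp (M / B) * laplace_mass B"

lemma Y_measurable [measurable]: "Y \<in> borel_measurable borel"
  by (rule borel_measurable_mono) (auto simp: mono_def mono)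

lemma EY_measurable [measurable]: "(\<lambda>\<eta>. EY Y \<xi> \<eta>) \<in> borel_measurable borel"
  unfolding EY_def by measurable

lemma EY_le: "EY Y \<xi> \<eta> \<le> exp (M / B) * exp (- \<bar>\<xi> - \<eta>\<bar> / B)"
proof -
  have "(\<bar>\<xi> - \<eta>\<bar> - M) / B \<le> \<bar>Y \<xi> - Y \<eta>\<bar>"
    using low[of \<xi> \<eta>] low[of \<eta> \<xi>] by (cases "\<xi> \<le> \<eta>") auto
  then show ?thesis
    by (simp add: EY_def exp_add[symmetric] diff_divide_distrib)
qed

lemma EY_mult_le:
  assumes "\<bar>p \<eta>\<bar> \<le> K"
  shows "\<bar>EY Y \<xi> \<eta> * p \<eta>\<bar> \<le> K * (exp (M / B) * exp (- \<bar>\<xi> - \<eta>\<bar> / B))"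
  using mult_mono[OF EY_le[of \<xi> \<eta>] assms] by (simp add: abs_mult EY_def mult.commute)

context
  fixes p :: "real \<Rightarrow> real" and K :: real
  assumes p [measurable]: "p \<in> borel_measurable borel" and K: "\<And>\<eta>. \<bar>p \<eta>\<bar> \<le> K"
begin

lemma integrable_majorant:
  "integrable lborel (\<lambda>\<eta>. K * (exp (M / B) * exp (- \<bar>\<xi> - \<eta>\<bar> / B)))"
  by (intro integrable_mult_right integrable_laplace B)

lemma EY_integrable: "integrable lborel (\<lambda>\<eta>. EY Y \<xi> \<eta> * p \<eta>)"
  by (rule Bochner_Integration.integrable_bound[OF integrable_majorant[of \<xi>]])
    (auto intro!: order_trans[OF EY_mult_le[of p, OF K]])

lemma EY_set_integrable: "A \<in> sets borel \<Longrightarrow> set_integrable lborel A (\<lambda>\<eta>. EY Y \<xi> \<eta> * p \<eta>)"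
  unfolding set_integrable_def by (intro integrable_mult_indicator EY_integrable) auto

lemma abs_set_integral_le:
  assumes A: "A \<in> sets borel"
  shows "\<bar>LINT \<eta>:A|lborel. EY Y \<xi> \<eta> * p \<eta>\<bar> \<le> K * mass"
proof -
  have "norm (LINT \<eta>|lborel. indicator A \<eta> *\<^sub>R (EY Y \<xi> \<eta> * p \<eta>)) \<le>
      (LINT \<eta>|lborel. K * (exp (M / B) * exp (- \<bar>\<xi> - \<eta>\<bar> / B)))"
  proof (rule Bochner_Integration.integral_norm_bound_integral[OF _ integrable_majorant])
    show "integrable lborel (\<lambda>\<eta>. indicator A \<eta> *\<^sub>R (EY Y \<xi> \<eta> * p \<eta>))"
      using EY_set_integrable[OF A] by (simp add: set_integrable_def)
    show "norm (indicator A \<eta> *\<^sub>R (EY Y \<xi> \<eta> * p \<eta>)) \<le> K * (exp (M / B) * exp (- \<bar>\<xi> - \<eta>\<bar> / B))" for \<eta>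
      using EY_mult_le[of p \<eta> K \<xi>, OF K] by (auto simp: indicator_def intro: order_trans[OF abs_ge_zero])
  qed
  also have "\<dots> = K * mass"
    using integral_laplace[of \<xi> B] by (simp add: mass_def)
  finally show ?thesis
    by (simp add: set_lebesgue_integral_def)
qed

lemma abs_KL_le: "\<bar>KL Y p \<xi>\<bar> \<le> K * mass" and abs_KR_le: "\<bar>KR Y p \<xi>\<bar> \<le> K * mass"
  unfolding KL_def KR_def by (rule abs_set_integral_le; simp)+

lemma KL_plus_KR: "KL Y p \<xi> + KR Y p \<xi> = (LINT \<eta>|lborel. EY Y \<xi> \<eta> * p \<eta>)"
proof -
  have "KR Y p \<xi> = (LINT \<eta>:{\<xi><..}|lborel. EY Y \<xi> \<eta> * p \<eta>)"
    unfolding KR_def by (rule set_integral_discrete_difference[where X="{\<xi>}"]) auto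
  moreover have "(LINT \<eta>:{..\<xi>} \<union> {\<xi><..}|lborel. EY Y \<xi> \<eta> * p \<eta>) =
     (LINT \<eta>:{..\<xi>}|lborel. EY Y \<xi> \<eta> * p \<eta>) + (LINT \<eta>:{\<xi><..}|lborel. EY Y \<xi> \<eta> * p \<eta>)"
    by (rule set_integral_Un) (auto intro: EY_set_integrable)
  moreover have "{..\<xi>} \<union> {\<xi><..} = UNIV"
    by auto
  ultimately show ?thesis
    by (simp add: KL_def set_lebesgue_integral_def)
qed

text \<open>For \<open>\<eta> \<le> a \<le> b\<close> monotonicity of \<open>Y\<close> makes the
  kernel multiplicative: passing from \<open>a\<close> to \<open>b\<close> costs the factor
  \<open>exp (- (Y b - Y a))\<close>, independent of \<open>\<eta>\<close>. Only the piece over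
  \<open>{a<..b}\<close> is new.\<close>

lemma KL_step:
  assumes "a \<le> b"
  shows "KL Y p b = exp (- (Y b - Y a)) * KL Y p a + (LINT \<eta>:{a<..b}|lborel. EY Y b \<eta> * p \<eta>)"
proof -
  have "{..b} = {..a} \<union> {a<..b}"
    using assms by auto
  then have "KL Y p b = (LINT \<eta>:{..a}|lborel. EY Y b \<eta> * p \<eta>) + (LINT \<eta>:{a<..b}|lborel. EY Y b \<eta> * p \<eta>)"
    unfolding KL_def by (simp only:) (rule set_integral_Un; auto intro: EY_set_integrable)
  also have "(LINT \<eta>:{..a}|lborel. EY Y b \<eta> * p \<eta>) =
      (LINT \<eta>:{..a}|lborel. exp (- (Y b - Y a)) * (EY Y a \<eta> * p \<eta>))"
  proof (rule set_lebesgue_integral_cong)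
    show "\<forall>\<eta>. \<eta> \<in> {..a} \<longrightarrow> EY Y b \<eta> * p \<eta> = exp (- (Y b - Y a)) * (EY Y a \<eta> * p \<eta>)"
      using mono[OF assms] mono[of _ a]
      by (auto simp: EY_def abs_if not_less simp flip: exp_add) (smt (verit))+
  qed simp
  also have "\<dots> = exp (- (Y b - Y a)) * KL Y p a"
    by (simp add: KL_def)
  finally show ?thesis .
qed

text \<open>By \<open>KL_step\<close> the old part shrinks by at most the fraction
  \<open>Y b - Y a \<le> B * (b - a)\<close>, and the new part is at most
  \<open>K * (b - a)\<close>. No continuity of \<open>p\<close> enters, which is what starts the
  regularity argument.\<close>

lemma abs_KL_diff_le_aux:
  assumes "a \<le> b"
  shows "\<bar>KL Y p b - KL Y p a\<bar> \<le> (B * (K * mass) + K) * (b - a)"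
proof -
  have K0: "K \<ge> 0"
    using K[of 0] by simp
  have EY1: "EY Y b \<eta> \<le> 1" for \<eta>
    by (simp add: EY_def)
  have "\<bar>LINT \<eta>:{a<..b}|lborel. EY Y b \<eta> * p \<eta>\<bar> \<le> (LINT \<eta>:{a<..b}|lborel. K)"
  proof -
    have "norm (LINT \<eta>|lborel. indicator {a<..b} \<eta> *\<^sub>R (EY Y b \<eta> * p \<eta>)) \<le>
        (LINT \<eta>|lborel. indicator {a<..b} \<eta> *\<^sub>R K)"
    proof (rule Bochner_Integration.integral_norm_bound_integral)
      show "integrable lborel (\<lambda>\<eta>. indicator {a<..b} \<eta> *\<^sub>R (EY Y b \<eta> * p \<eta>))"
        using EY_set_integrable[of "{a<..b}" b] by (simp add: set_integrable_def)
      show "integrable lborel (\<lambda>\<eta>. indicator {a<..b} \<eta> *\<^sub>R K)"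
        by (intro integrable_scaleR_left) (use assms in \<open>auto intro!: integrable_real_indicator\<close>)
      show "norm (indicator {a<..b} \<eta> *\<^sub>R (EY Y b \<eta> * p \<eta>)) \<le> indicator {a<..b} \<eta> *\<^sub>R K" for \<eta>
        using mult_mono[OF EY1[of \<eta>] K[of \<eta>]] by (auto simp: indicator_def abs_mult EY_def)
    qed
    then show ?thesis by (simp add: set_lebesgue_integral_def)
  qed
  also have "\<dots> = K * (b - a)"
    using assms by (simp add: set_lebesgue_integral_def)
  finally have 1: "\<bar>LINT \<eta>:{a<..b}|lborel. EY Y b \<eta> * p \<eta>\<bar> \<le> K * (b - a)" .
  have "0 \<le> 1 - exp (- (Y b - Y a))"
    using mono[OF assms] by simp
  moreover have "1 - exp (- (Y b - Y a)) \<le> B * (b - a)"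
    using lip[OF assms] exp_ge_add_one_self[of "- (Y b - Y a)"] by linarith
  ultimately have 2: "\<bar>(exp (- (Y b - Y a)) - 1) * KL Y p a\<bar> \<le> (B * (b - a)) * (K * mass)"
    unfolding abs_mult using assms B by (intro mult_mono abs_KL_le) auto
  have "KL Y p b - KL Y p a = (exp (- (Y b - Y a)) - 1) * KL Y p a + (LINT \<eta>:{a<..b}|lborel. EY Y b \<eta> * p \<eta>)"
    using KL_step[OF assms] by (simp add: algebra_simps)
  then have "\<bar>KL Y p b - KL Y p a\<bar> \<le> (B * (b - a)) * (K * mass) + K * (b - a)"
    using 1 2 by linarith
  then show ?thesis
    by (simp add: algebra_simps)
qed

lemma abs_KL_diff_le: "\<bar>KL Y p b - KL Y p a\<bar> \<le> (B * (K * mass) + K) * \<bar>b - a\<bar>"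
  using abs_KL_diff_le_aux[of a b] abs_KL_diff_le_aux[of b a]
  by (cases "a \<le> b") (auto simp: abs_minus_commute)

lemma KL_has_derivative:
  assumes g: "\<And>x. (Y has_real_derivative g x) (at x)" and cp: "continuous_on UNIV p"
  shows "(KL Y p has_real_derivative p x - g x * KL Y p x) (at x)"
proof -
  \<comment> \<open>A base point strictly left of \<open>x\<close>: near \<open>x\<close>,
    \<open>KL_step\<close> writes \<open>KL\<close> as \<open>exp (- Y b)\<close> times a constant
    plus a primitive, and this can be differentiated.\<close>
  define a where "a = x - 1"
  have cY: "continuous_on UNIV Y"
    using DERIV_continuous_on g by blast
  have cf: "continuous_on UNIV (\<lambda>\<eta>. exp (Y \<eta>) * p \<eta>)"
    by (intro continuous_intros cY cp)
  obtain F where F: "\<And>x. (F has_real_derivative exp (Y x) * p x) (at x)"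
    using ex_antiderivative[OF cf] by blast
  have eq: "KL Y p b = exp (- Y b) * (exp (Y a) * KL Y p a + (F b - F a))" if "a \<le> b" for b
  proof -
    have "(LINT \<eta>:{a<..b}|lborel. EY Y b \<eta> * p \<eta>) = (LINT \<eta>:{a<..b}|lborel. exp (- Y b) * (exp (Y \<eta>) * p \<eta>))"
      by (rule set_lebesgue_integral_cong)
        (auto simp: EY_def abs_of_nonneg mono exp_diff exp_minus field_simps)
    also have "\<dots> = exp (- Y b) * (LBINT \<eta>=ereal a..ereal b. exp (Y \<eta>) * p \<eta>)"
      using that by (simp add: interval_integral_Ioc)
    also have "(LBINT \<eta>=ereal a..ereal b. exp (Y \<eta>) * p \<eta>) = F b - F a"
      by (rule LBINT_eq_diff[OF F cf])
    finally show ?thesis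
      using KL_step[OF that] by (simp add: exp_diff exp_minus field_simps)
  qed
  have "((\<lambda>b. exp (- Y b) * (exp (Y a) * KL Y p a + (F b - F a))) has_real_derivative
      - g x * exp (- Y x) * (exp (Y a) * KL Y p a + (F x - F a)) + exp (- Y x) * (exp (Y x) * p x)) (at x)"
    by (auto intro!: derivative_eq_intros g F)
  moreover have "- g x * exp (- Y x) * (exp (Y a) * KL Y p a + (F x - F a)) + exp (- Y x) * (exp (Y x) * p x)
      = p x - g x * KL Y p x"
  proof -
    have "KL Y p x = exp (- Y x) * (exp (Y a) * KL Y p a + (F x - F a))"
      by (rule eq) (simp add: a_def)
    moreover have "exp (- Y x) * (exp (Y x) * p x) = p x"
      by (simp add: exp_minus)
    ultimately show ?thesis
      by (simp only: mult.assoc mult_minus_left)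
  qed
  ultimately have "((\<lambda>b. exp (- Y b) * (exp (Y a) * KL Y p a + (F b - F a))) has_real_derivative
     (p x - g x * KL Y p x)) (at x)"
    by simp
  then show ?thesis
    by (rule has_field_derivative_transform_within_open[where S="{a<..}"]) (auto simp: a_def intro!: eq[symmetric, unfolded a_def])
qed

end

end

text \<open>The reflection of the line exchanges the two half-lines; \<open>Y\<close> is also
  negated so that it stays increasing. All facts on \<open>KR\<close> are drawn from those on
  \<open>KL\<close> in this way.\<close>

lemma KR_eq_reflected_KL: "KR Y p \<xi> = KL (\<lambda>x. - Y (- x)) (\<lambda>x. p (- x)) (- \<xi>)"
proof -
  have "KR Y p \<xi> = (LINT \<eta>|lborel. indicator {\<xi>..} (0 + -1 * \<eta>) *\<^sub>R (EY Y \<xi> (0 + -1 * \<eta>) * p (0 + -1 * \<eta>)))"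
    unfolding KR_def set_lebesgue_integral_def by (subst lborel_integral_real_affine[of "-1" _ 0]) auto
  also have "\<dots> = KL (\<lambda>x. - Y (- x)) (\<lambda>x. p (- x)) (- \<xi>)"
    unfolding KL_def set_lebesgue_integral_def
    by (rule Bochner_Integration.integral_cong) (auto simp: indicator_def EY_def abs_minus_commute)
  finally show ?thesis .
qed

context kernel
begin

lemma reflected: "kernel (\<lambda>x. - Y (- x)) B M"
proof
  fix a b :: real
  assume "a \<le> b"
  then show "- Y (- a) \<le> - Y (- b)" "- Y (- b) - - Y (- a) \<le> B * (b - a)"
    "(b - a - M) / B \<le> - Y (- b) - - Y (- a)"
    using mono[of "- b" "- a"] lip[of "- b" "- a"] low[of "- b" "- a"] by simp_all
qed (rule B)

lemma abs_KR_diff_le: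
  assumes "p \<in> borel_measurable borel" "\<And>\<eta>. \<bar>p \<eta>\<bar> \<le> K"
  shows "\<bar>KR Y p b - KR Y p a\<bar> \<le> (B * (K * mass) + K) * \<bar>b - a\<bar>"
  using kernel.abs_KL_diff_le[OF reflected, of "\<lambda>x. p (- x)" K "- b" "- a"] assms
  by (simp add: KR_eq_reflected_KL abs_minus_commute)

lemma KR_has_derivative:
  assumes p: "p \<in> borel_measurable borel" "\<And>\<eta>. \<bar>p \<eta>\<bar> \<le> K"
    and g: "\<And>x. (Y has_real_derivative g x) (at x)" and cp: "continuous_on UNIV p"
  shows "(KR Y p has_real_derivative g x * KR Y p x - p x) (at x)"
proof -
  have g': "((\<lambda>x. - Y (- x)) has_real_derivative g (- x)) (at x)" for x
    using DERIV_minus[OF DERIV_chain2[OF g DERIV_minus[OF DERIV_ident]]] by simp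
  have "(KL (\<lambda>x. - Y (- x)) (\<lambda>x. p (- x)) has_real_derivative
      p (- (- x)) - g (- (- x)) * KL (\<lambda>x. - Y (- x)) (\<lambda>x. p (- x)) (- x)) (at (- x))"
    by (rule kernel.KL_has_derivative[OF reflected, where K=K, OF _ _ g'])
      (use p in \<open>auto intro!: continuous_on_compose2[OF cp] continuous_intros\<close>)
  from DERIV_chain2[OF this DERIV_minus[OF DERIV_ident]] show ?thesis
    by (simp add: KR_eq_reflected_KL[abs_def])
qed

end

subsection \<open>Bounds that are uniform in space and locally uniform in time\<close>

text \<open>This is the shape of the bounds in \<open>solution_class\<close>. Uniformity in space is
  essential because the nonlocal integrals run over the whole line.\<close>

definition lbd :: "(real \<Rightarrow> real \<Rightarrow> real) \<Rightarrow> bool" where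
  "lbd f \<longleftrightarrow> (\<forall>T>0. \<exists>C. \<forall>t\<in>{-T..T}. \<forall>x. \<bar>f t x\<bar> \<le> C)"

definition llip :: "(real \<Rightarrow> real \<Rightarrow> real) \<Rightarrow> bool" where
  "llip f \<longleftrightarrow> (\<forall>T>0. \<exists>C. \<forall>t\<in>{-T..T}. \<forall>x y. \<bar>f t x - f t y\<bar> \<le> C * \<bar>x - y\<bar>)"

lemma lbd_pos:
  assumes "lbd f" "T > 0"
  shows "\<exists>C>0. \<forall>t\<in>{-T..T}. \<forall>x. \<bar>f t x\<bar> \<le> C"
proof -
  obtain C where C: "\<forall>t\<in>{-T..T}. \<forall>x. \<bar>f t x\<bar> \<le> C"
    using assms unfolding lbd_def by blast
  have "\<bar>f t x\<bar> \<le> \<bar>C\<bar> + 1" if "t \<in> {-T..T}" for t x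
    using C[rule_format, OF that, of x] by linarith
  then show ?thesis
    by (intro exI[of _ "\<bar>C\<bar> + 1"]) auto
qed

lemma llip_pos:
  assumes "llip f" "T > 0"
  shows "\<exists>C>0. \<forall>t\<in>{-T..T}. \<forall>x y. \<bar>f t x - f t y\<bar> \<le> C * \<bar>x - y\<bar>"
proof -
  obtain C where C: "\<forall>t\<in>{-T..T}. \<forall>x y. \<bar>f t x - f t y\<bar> \<le> C * \<bar>x - y\<bar>"
    using assms unfolding llip_def by blast
  have "\<bar>f t x - f t y\<bar> \<le> (\<bar>C\<bar> + 1) * \<bar>x - y\<bar>" if "t \<in> {-T..T}" for t x y
    using C[rule_format, OF that, of x y] mult_right_mono[of C "\<bar>C\<bar> + 1" "\<bar>x - y\<bar>"] by linarith
  then show ?thesis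
    by (intro exI[of _ "\<bar>C\<bar> + 1"]) auto
qed

lemma lbdI: "(\<And>T. T > 0 \<Longrightarrow> \<exists>C. \<forall>t\<in>{-T..T}. \<forall>x. \<bar>f t x\<bar> \<le> C) \<Longrightarrow> lbd f"
  by (simp add: lbd_def)

lemma llipI:
  "(\<And>T. T > 0 \<Longrightarrow> \<exists>C. \<forall>t\<in>{-T..T}. \<forall>x y. \<bar>f t x - f t y\<bar> \<le> C * \<bar>x - y\<bar>) \<Longrightarrow> llip f"
  by (simp add: llip_def)

lemma lbd_const: "lbd (\<lambda>t x. c)"
  by (auto simp: lbd_def)

lemma lbd_sin: "lbd (\<lambda>t x. sin (f t x))" and lbd_cos: "lbd (\<lambda>t x. cos (f t x))"
  by (auto simp: lbd_def intro!: exI[of _ 1])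

lemma lbd_minus: "lbd f \<Longrightarrow> lbd (\<lambda>t x. - f t x)"
  by (auto simp: lbd_def)

lemma lbd_add:
  assumes "lbd f" "lbd g"
  shows "lbd (\<lambda>t x. f t x + g t x)"
proof (rule lbdI)
  fix T :: real assume T: "T > 0"
  obtain C D where "\<And>t x. t \<in> {-T..T} \<Longrightarrow> \<bar>f t x\<bar> \<le> C" "\<And>t x. t \<in> {-T..T} \<Longrightarrow> \<bar>g t x\<bar> \<le> D"
    using lbd_pos[OF assms(1) T] lbd_pos[OF assms(2) T] by metis
  then show "\<exists>C. \<forall>t\<in>{-T..T}. \<forall>x. \<bar>f t x + g t x\<bar> \<le> C"
    by (intro exI[of _ "C + D"] ballI allI order_trans[OF abs_triangle_ineq] add_mono) auto
qed

lemma lbd_diff: "lbd f \<Longrightarrow> lbd g \<Longrightarrow> lbd (\<lambda>t x. f t x - g t x)"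
  using lbd_add[OF _ lbd_minus] by fastforce

lemma lbd_mult:
  assumes "lbd f" "lbd g"
  shows "lbd (\<lambda>t x. f t x * g t x)"
proof (rule lbdI)
  fix T :: real assume T: "T > 0"
  obtain C where C: "C > 0" "\<And>t x. t \<in> {-T..T} \<Longrightarrow> \<bar>f t x\<bar> \<le> C"
    using lbd_pos[OF assms(1) T] by blast
  obtain D where D: "D > 0" "\<And>t x. t \<in> {-T..T} \<Longrightarrow> \<bar>g t x\<bar> \<le> D"
    using lbd_pos[OF assms(2) T] by blast
  show "\<exists>C. \<forall>t\<in>{-T..T}. \<forall>x. \<bar>f t x * g t x\<bar> \<le> C"
    unfolding abs_mult using C D by (intro exI[of _ "C * D"] ballI allI mult_mono) auto
qed

lemma lbd_power: "lbd f \<Longrightarrow> lbd (\<lambda>t x. f t x ^ n)"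
  by (induction n) (auto intro: lbd_mult lbd_const)

lemma lbd_divide: "lbd f \<Longrightarrow> lbd (\<lambda>t x. f t x / c)"
  unfolding divide_inverse by (intro lbd_mult lbd_const)

lemmas lbd_intros = lbd_const lbd_sin lbd_cos lbd_minus lbd_add lbd_diff lbd_mult lbd_power lbd_divide

lemma llip_const: "llip (\<lambda>t x. c)"
  by (auto simp: llip_def intro!: exI[of _ 0])

lemma llip_minus:
  assumes "llip f"
  shows "llip (\<lambda>t x. - f t x)"
  using assms unfolding llip_def by (simp add: abs_minus_commute)

lemma llip_add:
  assumes "llip f" "llip g"
  shows "llip (\<lambda>t x. f t x + g t x)"
proof (rule llipI)
  fix T :: real assume T: "T > 0"
  obtain C where C: "C > 0" "\<And>t x y. t \<in> {-T..T} \<Longrightarrow> \<bar>f t x - f t y\<bar> \<le> C * \<bar>x - y\<bar>"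
    using llip_pos[OF assms(1) T] by blast
  obtain D where D: "D > 0" "\<And>t x y. t \<in> {-T..T} \<Longrightarrow> \<bar>g t x - g t y\<bar> \<le> D * \<bar>x - y\<bar>"
    using llip_pos[OF assms(2) T] by blast
  have "\<bar>(f t x + g t x) - (f t y + g t y)\<bar> \<le> (C + D) * \<bar>x - y\<bar>" if "t \<in> {-T..T}" for t x y
    using C(2)[OF that, of x y] D(2)[OF that, of x y] unfolding distrib_right by linarith
  then show "\<exists>C. \<forall>t\<in>{-T..T}. \<forall>x y. \<bar>(f t x + g t x) - (f t y + g t y)\<bar> \<le> C * \<bar>x - y\<bar>"
    by blast
qed

lemma llip_diff: "llip f \<Longrightarrow> llip g \<Longrightarrow> llip (\<lambda>t x. f t x - g t x)"
  using llip_add[OF _ llip_minus] by fastforce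

lemma llip_mult:
  assumes "llip f" "llip g" "lbd f" "lbd g"
  shows "llip (\<lambda>t x. f t x * g t x)"
proof (rule llipI)
  fix T :: real assume T: "T > 0"
  obtain C where C: "C > 0" "\<And>t x y. t \<in> {-T..T} \<Longrightarrow> \<bar>f t x - f t y\<bar> \<le> C * \<bar>x - y\<bar>"
    using llip_pos[OF assms(1) T] by blast
  obtain D where D: "D > 0" "\<And>t x y. t \<in> {-T..T} \<Longrightarrow> \<bar>g t x - g t y\<bar> \<le> D * \<bar>x - y\<bar>"
    using llip_pos[OF assms(2) T] by blast
  obtain F where F: "F > 0" "\<And>t x. t \<in> {-T..T} \<Longrightarrow> \<bar>f t x\<bar> \<le> F"
    using lbd_pos[OF assms(3) T] by blast
  obtain G where G: "G > 0" "\<And>t x. t \<in> {-T..T} \<Longrightarrow> \<bar>g t x\<bar> \<le> G"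
    using lbd_pos[OF assms(4) T] by blast
  have "\<bar>f t x * g t x - f t y * g t y\<bar> \<le> (C * G + F * D) * \<bar>x - y\<bar>" if "t \<in> {-T..T}" for t x y
  proof -
    have "f t x * g t x - f t y * g t y = (f t x - f t y) * g t x + f t y * (g t x - g t y)"
      by (simp add: algebra_simps)
    also have "\<bar>\<dots>\<bar> \<le> \<bar>f t x - f t y\<bar> * \<bar>g t x\<bar> + \<bar>f t y\<bar> * \<bar>g t x - g t y\<bar>"
      by (metis abs_mult abs_triangle_ineq)
    also have "\<dots> \<le> (C * \<bar>x - y\<bar>) * G + F * (D * \<bar>x - y\<bar>)"
      using C D F G that by (intro add_mono mult_mono) auto
    finally show ?thesis by (simp add: algebra_simps)
  qed
  then show "\<exists>C. \<forall>t\<in>{-T..T}. \<forall>x y. \<bar>f t x * g t x - f t y * g t y\<bar> \<le> C * \<bar>x - y\<bar>"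
    by blast
qed

lemma llip_power: "llip f \<Longrightarrow> lbd f \<Longrightarrow> llip (\<lambda>t x. f t x ^ n)"
  by (induction n) (auto intro: llip_mult llip_const lbd_power)

lemma llip_divide:
  assumes "llip f"
  shows "llip (\<lambda>t x. f t x / c)"
proof (rule llipI)
  fix T :: real assume T: "T > 0"
  obtain C where C: "C > 0" "\<And>t x y. t \<in> {-T..T} \<Longrightarrow> \<bar>f t x - f t y\<bar> \<le> C * \<bar>x - y\<bar>"
    using llip_pos[OF assms(1) T] by blast
  show "\<exists>C. \<forall>t\<in>{-T..T}. \<forall>x y. \<bar>f t x / c - f t y / c\<bar> \<le> C * \<bar>x - y\<bar>"
    using C(2) by (intro exI[of _ "C / \<bar>c\<bar>"]) (auto simp: diff_divide_distrib[symmetric] intro!: divide_right_mono)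
qed

lemma abs_sin_diff_le: "\<bar>sin x - sin y\<bar> \<le> \<bar>x - y\<bar>" for x y :: real
  using abs_diff_le_of_derivative_bound[of "min x y" "max x y" sin cos 1 x y] by (auto simp: DERIV_sin)

lemma abs_cos_diff_le: "\<bar>cos x - cos y\<bar> \<le> \<bar>x - y\<bar>" for x y :: real
  using abs_diff_le_of_derivative_bound[of "min x y" "max x y" cos "\<lambda>x. - sin x" 1 x y]
  by (auto simp: DERIV_cos)

lemma llip_sin: "llip f \<Longrightarrow> llip (\<lambda>t x. sin (f t x))"
  and llip_cos: "llip f \<Longrightarrow> llip (\<lambda>t x. cos (f t x))"
  unfolding llip_def by (meson abs_sin_diff_le abs_cos_diff_le order_trans)+

lemmas llip_intros = llip_const llip_minus llip_add llip_diff llip_mult llip_power llip_divide llip_sin llip_cos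

section \<open>Gronwall estimates and Lipschitz bounds\<close>

lemma exp_growth:
  fixes \<psi> :: "real \<Rightarrow> real"
  assumes der: "\<And>t. t \<in> {-T..T} \<Longrightarrow> (\<psi> has_real_derivative \<psi>' t) (at t)"
    and bound: "\<And>t. t \<in> {-T..T} \<Longrightarrow> \<bar>\<psi>' t\<bar> \<le> L * \<psi> t" and t: "t \<in> {-T..T}"
  shows "\<psi> t \<le> exp (L * \<bar>t\<bar>) * \<psi> 0"
proof (cases "t \<ge> 0")
  case True
  \<comment> \<open>Bounding the absolute value of the derivative controls both directions of time:
    \<open>exp (- L t) * \<psi> t\<close> decreases forwards from 0, and in the other case
    \<open>exp (L t) * \<psi> t\<close> increases up to time 0.\<close>
  have "exp (- L * t) * \<psi> t \<le> exp (- L * 0) * \<psi> 0"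
  proof (rule DERIV_nonpos_imp_nonincreasing[OF True])
    fix s assume s: "0 \<le> s" "s \<le> t"
    then have sT: "s \<in> {-T..T}" using t by auto
    have "((\<lambda>s. exp (- L * s) * \<psi> s) has_real_derivative exp (- L * s) * (\<psi>' s - L * \<psi> s)) (at s)"
      by (auto intro!: derivative_eq_intros der[OF sT] simp: algebra_simps)
    moreover have "exp (- L * s) * (\<psi>' s - L * \<psi> s) \<le> 0"
      using bound[OF sT] by (intro mult_nonneg_nonpos) auto
    ultimately show "\<exists>y. ((\<lambda>s. exp (- L * s) * \<psi> s) has_real_derivative y) (at s) \<and> y \<le> 0"
      by blast
  qed
  then have "exp (L * t) * (exp (- L * t) * \<psi> t) \<le> exp (L * t) * \<psi> 0"
    by (intro mult_left_mono) auto
  moreover have "exp (L * t) * (exp (- L * t) * \<psi> t) = \<psi> t"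
    by (simp add: mult.assoc[symmetric] exp_add[symmetric])
  ultimately show ?thesis
    by (simp only: abs_of_nonneg[OF True])
next
  case False
  have "exp (L * t) * \<psi> t \<le> exp (L * 0) * \<psi> 0"
  proof (rule DERIV_nonneg_imp_nondecreasing[where a = t and b = 0 and f = "\<lambda>s. exp (L * s) * \<psi> s"])
    show "t \<le> 0" using False by simp
    fix s assume s: "t \<le> s" "s \<le> 0"
    then have sT: "s \<in> {-T..T}" using t by auto
    have "((\<lambda>s. exp (L * s) * \<psi> s) has_real_derivative exp (L * s) * (\<psi>' s + L * \<psi> s)) (at s)"
      by (auto intro!: derivative_eq_intros der[OF sT] simp: algebra_simps)
    moreover have "exp (L * s) * (\<psi>' s + L * \<psi> s) \<ge> 0"
      using bound[OF sT] by (intro mult_nonneg_nonneg) auto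
    ultimately show "\<exists>y. ((\<lambda>s. exp (L * s) * \<psi> s) has_real_derivative y) (at s) \<and> 0 \<le> y"
      by blast
  qed
  then have "exp (- L * t) * (exp (L * t) * \<psi> t) \<le> exp (- L * t) * \<psi> 0"
    by (intro mult_left_mono) auto
  moreover have "exp (- L * t) * (exp (L * t) * \<psi> t) = \<psi> t"
    by (simp add: mult.assoc[symmetric] exp_add[symmetric])
  moreover have "L * \<bar>t\<bar> = - L * t"
    using False by simp
  ultimately show ?thesis
    by (simp only:)
qed

text \<open>Gronwall's inequality, applied to the smooth function \<open>\<phi>\<^sup>2 + \<kappa>\<^sup>2\<close> instead of \<open>\<bar>\<phi>\<bar>\<close>.\<close>

lemma gronwall:
  fixes \<phi> :: "real \<Rightarrow> real"
  assumes der: "\<And>t. t \<in> {-T..T} \<Longrightarrow> (\<phi> has_real_derivative \<phi>' t) (at t)"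
    and bound: "\<And>t. t \<in> {-T..T} \<Longrightarrow> \<bar>\<phi>' t\<bar> \<le> L * (\<bar>\<phi> t\<bar> + \<kappa>)"
    and init: "\<bar>\<phi> 0\<bar> \<le> L0 * \<kappa>" and \<kappa>: "\<kappa> \<ge> 0" and L: "L \<ge> 0" and t: "t \<in> {-T..T}"
  shows "\<bar>\<phi> t\<bar> \<le> sqrt (exp (4 * L * T) * (L0\<^sup>2 + 1)) * \<kappa>"
proof -
  define \<psi> where "\<psi> t = (\<phi> t)\<^sup>2 + \<kappa>\<^sup>2" for t
  have "\<psi> t \<le> exp (4 * L * \<bar>t\<bar>) * \<psi> 0"
  proof (rule exp_growth[OF _ _ t])
    fix t assume t: "t \<in> {-T..T}"
    show "(\<psi> has_real_derivative 2 * \<phi> t * \<phi>' t) (at t)"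
      unfolding \<psi>_def by (auto intro!: derivative_eq_intros der[OF t])
    have "\<bar>2 * \<phi> t * \<phi>' t\<bar> \<le> 2 * \<bar>\<phi> t\<bar> * (L * (\<bar>\<phi> t\<bar> + \<kappa>))"
      unfolding abs_mult using bound[OF t] by (intro mult_mono) auto
    also have "\<dots> = L * (2 * \<bar>\<phi> t\<bar>\<^sup>2 + 2 * \<bar>\<phi> t\<bar> * \<kappa>)"
      by (simp add: power2_eq_square algebra_simps)
    also have "\<dots> \<le> L * (4 * \<psi> t)"
    proof (intro mult_left_mono L)
      have "2 * a\<^sup>2 + 2 * a * \<kappa> \<le> 4 * (a\<^sup>2 + \<kappa>\<^sup>2)" for a :: real
        using sum_squares_bound[of a \<kappa>] zero_le_power2[of a] zero_le_power2[of \<kappa>]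
        unfolding distrib_left by linarith
      from this[of "\<bar>\<phi> t\<bar>"] show "2 * \<bar>\<phi> t\<bar>\<^sup>2 + 2 * \<bar>\<phi> t\<bar> * \<kappa> \<le> 4 * \<psi> t"
        by (simp add: \<psi>_def)
    qed
    finally show "\<bar>2 * \<phi> t * \<phi>' t\<bar> \<le> 4 * L * \<psi> t" by simp
  qed
  also have "\<dots> \<le> exp (4 * L * T) * ((L0 * \<kappa>)\<^sup>2 + \<kappa>\<^sup>2)"
    unfolding \<psi>_def using t L init abs_le_square_iff[of "\<phi> 0" "L0 * \<kappa>"]
    by (intro mult_mono add_mono) (auto intro!: mult_left_mono)
  also have "\<dots> = exp (4 * L * T) * (L0\<^sup>2 + 1) * \<kappa>\<^sup>2"
    by (simp add: power_mult_distrib algebra_simps)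
  finally have "(\<phi> t)\<^sup>2 \<le> exp (4 * L * T) * (L0\<^sup>2 + 1) * \<kappa>\<^sup>2"
    unfolding \<psi>_def using zero_le_power2[of \<kappa>] by linarith
  then have "sqrt ((\<phi> t)\<^sup>2) \<le> sqrt (exp (4 * L * T) * (L0\<^sup>2 + 1) * \<kappa>\<^sup>2)"
    by (rule real_sqrt_le_mono)
  then show ?thesis
    using \<kappa> by (simp add: real_sqrt_mult)
qed

text \<open>\<open>gronwall\<close> for the difference of two trajectories with
  \<open>\<kappa> = \<bar>x - y\<bar>\<close>. Its bound is linear in \<open>\<kappa>\<close>, so
  the constant does not depend on the pair of points.\<close>

lemma llip_gronwall:
  assumes der: "\<And>t x. ((\<lambda>\<tau>. f \<tau> x) has_real_derivative F t x) (at t)"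
    and bound: "\<And>T. T > 0 \<Longrightarrow> \<exists>L\<ge>0. \<forall>t\<in>{-T..T}. \<forall>x y. \<bar>F t x - F t y\<bar> \<le> L * (\<bar>f t x - f t y\<bar> + \<bar>x - y\<bar>)"
    and init: "\<And>x y. \<bar>f 0 x - f 0 y\<bar> \<le> L0 * \<bar>x - y\<bar>"
  shows "llip f"
proof (rule llipI)
  fix T :: real assume T: "T > 0"
  obtain L where L: "L \<ge> 0" "\<And>t x y. t \<in> {-T..T} \<Longrightarrow> \<bar>F t x - F t y\<bar> \<le> L * (\<bar>f t x - f t y\<bar> + \<bar>x - y\<bar>)"
    using bound[OF T] by blast
  have "\<bar>f t x - f t y\<bar> \<le> sqrt (exp (4 * L * T) * (L0\<^sup>2 + 1)) * \<bar>x - y\<bar>" if "t \<in> {-T..T}" for t x y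
    by (rule gronwall[where \<phi> = "\<lambda>t. f t x - f t y" and \<phi>' = "\<lambda>t. F t x - F t y"])
      (use L init that in \<open>auto intro!: DERIV_diff der\<close>)
  then show "\<exists>C. \<forall>t\<in>{-T..T}. \<forall>x y. \<bar>f t x - f t y\<bar> \<le> C * \<bar>x - y\<bar>"
    by blast
qed

lemma lipschitz_in_time:
  assumes der: "\<And>t x. ((\<lambda>\<tau>. f \<tau> x) has_real_derivative F t x) (at t)" and "lbd F" "T > 0"
  obtains C where "C > 0" "\<And>s t x. s \<in> {-T..T} \<Longrightarrow> t \<in> {-T..T} \<Longrightarrow> \<bar>f s x - f t x\<bar> \<le> C * \<bar>s - t\<bar>"
proof -
  obtain C where C: "C > 0" "\<And>t x. t \<in> {-T..T} \<Longrightarrow> \<bar>F t x\<bar> \<le> C"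
    using lbd_pos[OF assms(2,3)] by blast
  show ?thesis
  proof (rule that[OF C(1)])
    fix s t x assume "s \<in> {-T..T}" "t \<in> {-T..T}"
    then show "\<bar>f s x - f t x\<bar> \<le> C * \<bar>s - t\<bar>"
      using der C by (intro abs_diff_le_of_derivative_bound[where f="\<lambda>\<tau>. f \<tau> x" and f'="\<lambda>t. F t x" and a="-T" and b=T]) auto
  qed
qed

text \<open>A Lipschitz constant in space that is uniform over nearby times upgrades separate
  continuity to joint continuity.\<close>

lemma jc_of_llip:
  assumes lip: "llip f" and cont: "\<And>x. continuous_on UNIV (\<lambda>t. f t x)"
  shows "jc f"
  unfolding jc_def continuous_on_iff
proof (intro ballI allI impI)
  fix z :: "real \<times> real" and e :: real assume e: "e > 0"
  obtain t x where z: "z = (t, x)" by (cases z)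
  define T where "T = \<bar>t\<bar> + 1"
  have "T > 0" by (simp add: T_def)
  from llip_pos[OF lip this] obtain C
    where C: "C > 0" "\<And>t x y. t \<in> {-T..T} \<Longrightarrow> \<bar>f t x - f t y\<bar> \<le> C * \<bar>x - y\<bar>"
    by blast
  obtain d where d: "d > 0" "\<And>s. \<bar>s - t\<bar> < d \<Longrightarrow> \<bar>f s x - f t x\<bar> < e / 2"
    using cont[of x] e unfolding continuous_on_iff dist_real_def by (metis UNIV_I half_gt_zero)
  define r where "r = min (min d 1) (e / (2 * C))"
  have "r > 0" using d C e by (simp add: r_def)
  moreover have "dist (f (fst z') (snd z')) (f (fst z) (snd z)) < e" if "dist z' z < r" for z'
  proof -
    obtain s y where z': "z' = (s, y)" by (cases z')
    have "\<bar>s - t\<bar> < r" "\<bar>y - x\<bar> < r"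
      using that dist_fst_le[of z' z] dist_snd_le[of z' z] by (auto simp: z z' dist_real_def)
    then have 1: "\<bar>f s x - f t x\<bar> < e / 2" and s: "s \<in> {-T..T}" and "\<bar>y - x\<bar> < e / (2 * C)"
      using d(2)[of s] by (auto simp: r_def T_def)
    then have "C * \<bar>y - x\<bar> < e / 2"
      using C(1) by (simp add: field_simps)
    then show ?thesis
      using C(2)[OF s, of y x] 1 unfolding z z' dist_real_def fst_conv snd_conv by linarith
  qed
  ultimately show "\<exists>d>0. \<forall>z'\<in>UNIV. dist z' z < d \<longrightarrow> dist (f (fst z') (snd z')) (f (fst z) (snd z)) < e"
    by blast
qed

subsection \<open>Families of kernels\<close>

definition kernel_family :: "(real \<Rightarrow> real \<Rightarrow> real) \<Rightarrow> bool" where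
  "kernel_family Y \<longleftrightarrow> (\<forall>T>0. \<exists>B M. \<forall>t\<in>{-T..T}. kernel (Y t) B M)"

lemma lbd_KL_KR:
  assumes Y: "kernel_family Y" and p: "\<And>t. p t \<in> borel_measurable borel" "lbd p"
  shows "lbd (\<lambda>t. KL (Y t) (p t))" "lbd (\<lambda>t. KR (Y t) (p t))"
    "llip (\<lambda>t. KL (Y t) (p t))" "llip (\<lambda>t. KR (Y t) (p t))"
proof -
  have *: "\<exists>C D. \<forall>t\<in>{-T..T}. (\<forall>x. \<bar>KL (Y t) (p t) x\<bar> \<le> C \<and> \<bar>KR (Y t) (p t) x\<bar> \<le> C) \<and>
     (\<forall>x y. \<bar>KL (Y t) (p t) x - KL (Y t) (p t) y\<bar> \<le> D * \<bar>x - y\<bar> \<and> \<bar>KR (Y t) (p t) x - KR (Y t) (p t) y\<bar> \<le> D * \<bar>x - y\<bar>)"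
    if T: "T > 0" for T
  proof -
    obtain K where K: "\<And>t x. t \<in> {-T..T} \<Longrightarrow> \<bar>p t x\<bar> \<le> K"
      using lbd_def p(2) T by metis
    obtain B M where BM: "\<And>t. t \<in> {-T..T} \<Longrightarrow> kernel (Y t) B M"
      using Y T unfolding kernel_family_def by blast
    define m where "m = exp (M / B) * laplace_mass B"
    have m: "kernel.mass B M = m" if "t \<in> {-T..T}" for t
      using kernel.mass_def[OF BM[OF that]] by (simp add: m_def)
    show ?thesis
    proof (rule exI[of _ "K * m"], rule exI[of _ "B * (K * m) + K"], intro ballI conjI allI)
      fix t x y assume t: "t \<in> {-T..T}"
      interpret kernel "Y t" B M by (rule BM[OF t])
      show "\<bar>KL (Y t) (p t) x\<bar> \<le> K * m" "\<bar>KR (Y t) (p t) x\<bar> \<le> K * m"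
        "\<bar>KL (Y t) (p t) x - KL (Y t) (p t) y\<bar> \<le> (B * (K * m) + K) * \<bar>x - y\<bar>"
        "\<bar>KR (Y t) (p t) x - KR (Y t) (p t) y\<bar> \<le> (B * (K * m) + K) * \<bar>x - y\<bar>"
        using abs_KL_le[OF p(1) K[OF t]] abs_KR_le[OF p(1) K[OF t]] abs_KL_diff_le[OF p(1) K[OF t]]
          abs_KR_diff_le[OF p(1) K[OF t]] m[OF t] by simp_all
    qed
  qed
  show "lbd (\<lambda>t. KL (Y t) (p t))" "lbd (\<lambda>t. KR (Y t) (p t))"
    "llip (\<lambda>t. KL (Y t) (p t))" "llip (\<lambda>t. KR (Y t) (p t))"
    unfolding lbd_def llip_def using * by meson+
qed

text \<open>Dominated convergence along a sequence of times. The sequence stays in a bounded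
  interval, on which \<open>B\<close>, \<open>M\<close> and \<open>K\<close> are fixed, so one
  exponential majorant serves all its members.\<close>

lemma continuous_kernel_integral:
  assumes Y: "kernel_family Y" and jY: "jc Y" and p: "jc p" "lbd p" and A: "A \<in> sets borel"
  shows "continuous_on UNIV (\<lambda>t. LINT \<eta>:A|lborel. EY (Y t) x \<eta> * p t \<eta>)"
  unfolding continuous_on_sequentially
proof (intro ballI allI impI, elim conjE)
  fix \<tau> :: "nat \<Rightarrow> real" and t assume lim: "\<tau> \<longlonglongrightarrow> t"
  obtain T where T: "T > 0" "\<And>n. \<bar>\<tau> n\<bar> \<le> T"
    using convergent_imp_Bseq[of \<tau>] lim unfolding Bseq_def convergent_def by auto
  obtain K where K: "K > 0" "\<And>t x. t \<in> {-T..T} \<Longrightarrow> \<bar>p t x\<bar> \<le> K"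
    using lbd_pos[OF p(2) T(1)] by blast
  obtain B M where BM: "\<And>t. t \<in> {-T..T} \<Longrightarrow> kernel (Y t) B M"
    using Y T(1) unfolding kernel_family_def by blast
  have \<tau>T: "\<tau> n \<in> {-T..T}" for n
    using T(2)[of n] by auto
  have pm [measurable]: "p t \<in> borel_measurable borel" for t
    by (intro borel_measurable_continuous_onI jc_at p)
  have Ym [measurable]: "Y t \<in> borel_measurable borel" for t
    by (intro borel_measurable_continuous_onI jc_at jY)
  have A' [measurable]: "A \<in> sets borel" by (rule A)
  have "(\<lambda>n. LINT \<eta>|lborel. indicator A \<eta> *\<^sub>R (EY (Y (\<tau> n)) x \<eta> * p (\<tau> n) \<eta>))
      \<longlonglongrightarrow> (LINT \<eta>|lborel. indicator A \<eta> *\<^sub>R (EY (Y t) x \<eta> * p t \<eta>))"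
  proof (rule integral_dominated_convergence)
    show "(\<lambda>\<eta>. indicator A \<eta> *\<^sub>R (EY (Y t) x \<eta> * p t \<eta>)) \<in> borel_measurable lborel"
      "\<And>n. (\<lambda>\<eta>. indicator A \<eta> *\<^sub>R (EY (Y (\<tau> n)) x \<eta> * p (\<tau> n) \<eta>)) \<in> borel_measurable lborel"
      unfolding EY_def by measurable
    show "integrable lborel (\<lambda>\<eta>. K * (exp (M / B) * exp (- \<bar>x - \<eta>\<bar> / B)))"
      by (rule kernel.integrable_majorant[OF BM[OF \<tau>T[of 0]] pm K(2)[OF \<tau>T[of 0]]])
    have "(\<lambda>n. indicator A \<eta> *\<^sub>R (EY (Y (\<tau> n)) x \<eta> * p (\<tau> n) \<eta>)) \<longlonglongrightarrow> indicator A \<eta> *\<^sub>R (EY (Y t) x \<eta> * p t \<eta>)" for \<eta>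
    proof -
      have l: "(\<lambda>n. f (\<tau> n) z) \<longlonglongrightarrow> f t z" if "jc f" for f z
        using jc_time[OF that, of z] lim unfolding continuous_on_sequentially by (auto simp: o_def)
      show ?thesis
        unfolding EY_def by (intro tendsto_intros l jY p)
    qed
    then show "AE \<eta> in lborel. (\<lambda>n. indicator A \<eta> *\<^sub>R (EY (Y (\<tau> n)) x \<eta> * p (\<tau> n) \<eta>)) \<longlonglongrightarrow> indicator A \<eta> *\<^sub>R (EY (Y t) x \<eta> * p t \<eta>)"
      by simp
    have "norm (indicator A \<eta> *\<^sub>R (EY (Y (\<tau> n)) x \<eta> * p (\<tau> n) \<eta>)) \<le> K * (exp (M / B) * exp (- \<bar>x - \<eta>\<bar> / B))" for n \<eta>
      using kernel.EY_mult_le[OF BM[OF \<tau>T[of n]], of "p (\<tau> n)" \<eta> K x, OF K(2)[OF \<tau>T]] K(1)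
      by (auto simp: indicator_def)
    then show "AE \<eta> in lborel. norm (indicator A \<eta> *\<^sub>R (EY (Y (\<tau> n)) x \<eta> * p (\<tau> n) \<eta>)) \<le> K * (exp (M / B) * exp (- \<bar>x - \<eta>\<bar> / B))" for n
      by simp
  qed
  then show "((\<lambda>t. LINT \<eta>:A|lborel. EY (Y t) x \<eta> * p t \<eta>) \<circ> \<tau>) \<longlonglongrightarrow> (LINT \<eta>:A|lborel. EY (Y t) x \<eta> * p t \<eta>)"
    by (simp add: set_lebesgue_integral_def o_def)
qed

lemma jc_KL_KR:
  assumes Y: "kernel_family Y" and jY: "jc Y" and p: "jc p" "lbd p"
  shows "jc (\<lambda>t. KL (Y t) (p t))" "jc (\<lambda>t. KR (Y t) (p t))"
proof -
  have pm: "p t \<in> borel_measurable borel" for t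
    by (intro borel_measurable_continuous_onI jc_at p)
  show "jc (\<lambda>t. KL (Y t) (p t))" "jc (\<lambda>t. KR (Y t) (p t))"
    using lbd_KL_KR(3,4)[OF Y pm p(2)] continuous_kernel_integral[OF Y jY p]
    by (auto intro!: jc_of_llip simp: KL_def KR_def)
qed

lemma C1x_KL_KR:
  assumes Y: "kernel_family Y" and jg: "jc g" and Yg: "C1x Y g" and p: "jc p" "lbd p"
  shows "C1x (\<lambda>t. KL (Y t) (p t)) (\<lambda>t x. p t x - g t x * KL (Y t) (p t) x)"
    "C1x (\<lambda>t. KR (Y t) (p t)) (\<lambda>t x. g t x * KR (Y t) (p t) x - p t x)"
proof -
  note j = jc_KL_KR[OF Y C1xD(1)[OF Yg] p]
  have d: "(KL (Y t) (p t) has_real_derivative p t x - g t x * KL (Y t) (p t) x) (at x) \<and>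
    (KR (Y t) (p t) has_real_derivative g t x * KR (Y t) (p t) x - p t x) (at x)" for t x
  proof -
    define T where "T = \<bar>t\<bar> + 1"
    have T: "T > 0" "t \<in> {-T..T}" by (auto simp: T_def)
    obtain K where K: "K > 0" "\<And>t x. t \<in> {-T..T} \<Longrightarrow> \<bar>p t x\<bar> \<le> K"
      using lbd_pos[OF p(2) T(1)] by blast
    obtain B M where BM: "\<And>t. t \<in> {-T..T} \<Longrightarrow> kernel (Y t) B M"
      using Y T(1) unfolding kernel_family_def by blast
    have pm: "p t \<in> borel_measurable borel"
      by (intro borel_measurable_continuous_onI jc_at p)
    show ?thesis
      using kernel.KL_has_derivative[OF BM[OF T(2)] pm K(2)[OF T(2)] C1xD(3)[OF Yg] jc_at[OF p(1)]]
        kernel.KR_has_derivative[OF BM[OF T(2)] pm K(2)[OF T(2)] C1xD(3)[OF Yg] jc_at[OF p(1)]]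
      by blast
  qed
  show "C1x (\<lambda>t. KL (Y t) (p t)) (\<lambda>t x. p t x - g t x * KL (Y t) (p t) x)"
    "C1x (\<lambda>t. KR (Y t) (p t)) (\<lambda>t x. g t x * KR (Y t) (p t) x - p t x)"
    using d j jg p by (auto simp: C1x_def intro!: jc_intros)
qed

subsection \<open>The system in symmetric form\<close>

text \<open>For regular data \<open>gdens\<close> will be \<open>y\<^sub>\<xi>\<close> and \<open>hdens\<close> will be \<open>U\<^sub>\<xi>\<close>; every notion is applied
  to the exchanged system \<open>(V, U, Z, W, q)\<close> as well.\<close>

definition gdens :: "spacetime \<Rightarrow> spacetime \<Rightarrow> spacetime \<Rightarrow> spacetime" where
  "gdens W Z q t x = q t x * (cos (W t x / 2))\<^sup>2 * (cos (Z t x / 2))\<^sup>2"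

text \<open>Integration in space makes sense for measurable bounded states, so this potential is
  available before the characteristic \<open>y\<close> is known to be differentiable.\<close>

definition ypot :: "spacetime \<Rightarrow> spacetime \<Rightarrow> spacetime \<Rightarrow> spacetime" where
  "ypot W Z q t x = (LBINT s=ereal 0..ereal x. gdens W Z q t s)"

definition hdens :: "spacetime \<Rightarrow> spacetime \<Rightarrow> spacetime \<Rightarrow> spacetime" where
  "hdens W Z q t x = 1/2 * q t x * sin (W t x) * (cos (Z t x / 2))\<^sup>2"

definition afun :: "spacetime \<Rightarrow> spacetime \<Rightarrow> spacetime \<Rightarrow> spacetime \<Rightarrow> spacetime \<Rightarrow> spacetime" where
  "afun U V W Z q t x = P1 (U t) (V t) (W t) (Z t) (q t) x + dP2 (U t) (V t) (W t) (Z t) (q t) x"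

definition ffun :: "spacetime \<Rightarrow> spacetime \<Rightarrow> spacetime \<Rightarrow> spacetime \<Rightarrow> spacetime \<Rightarrow> spacetime" where
  "ffun U V W Z q t x = - dP1 (U t) (V t) (W t) (Z t) (q t) x - P2 (U t) (V t) (W t) (Z t) (q t) x"

text \<open>In terms of \<open>cfun\<close> and \<open>dfun\<close> the equations are \<open>W\<^sub>t = c + d cos W\<close> and
  \<open>q\<^sub>t = q (d sin W + d' sin Z)\<close>, where \<open>d'\<close> belongs to the exchanged system.\<close>

definition cfun :: "spacetime \<Rightarrow> spacetime \<Rightarrow> spacetime \<Rightarrow> spacetime \<Rightarrow> spacetime \<Rightarrow> spacetime" where
  "cfun U V W Z q t x = (U t x)\<^sup>2 * V t x - afun U V W Z q t x - V t x / 2"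

definition dfun :: "spacetime \<Rightarrow> spacetime \<Rightarrow> spacetime \<Rightarrow> spacetime \<Rightarrow> spacetime \<Rightarrow> spacetime" where
  "dfun U V W Z q t x = (U t x)\<^sup>2 * V t x - afun U V W Z q t x + V t x / 2"

text \<open>What is asked of the initial angles: the bounded first derivative starts the Gronwall
  estimate, the continuous second derivative enters the formula for the second derivative of the
  angle at later times.\<close>

definition C2_lipschitz :: "(real \<Rightarrow> real) \<Rightarrow> bool" where
  "C2_lipschitz f \<longleftrightarrow> (\<exists>f1 f2 C. (\<forall>x. (f has_real_derivative f1 x) (at x)) \<and>
     (\<forall>x. (f1 has_real_derivative f2 x) (at x)) \<and> continuous_on UNIV f2 \<and> (\<forall>x. \<bar>f1 x\<bar> \<le> C))"

lemma kerE_swap: "kerE Z W q = kerE W Z q"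
  by (intro ext) (simp add: kerE_def mult.assoc mult.left_commute mult.commute)

text \<open>Exchanging \<open>(U, W)\<close> with \<open>(V, Z)\<close> turns the
  \<open>s\<close>-densities into the \<open>p\<close>-densities and leaves the kernel alone, so it
  suffices to study \<open>U\<close>, \<open>W\<close> and the \<open>P\<close>-terms.\<close>

lemma state_swap:
  "S1 U V W Z q = P1 V U Z W q" "S2 U V W Z q = P2 V U Z W q"
  "dS1 U V W Z q = dP1 V U Z W q" "dS2 U V W Z q = dP2 V U Z W q"
proof -
  have "dens_s1 U V W Z q = dens_p1 V U Z W q" "dens_s2 U V W Z q = dens_p2 V U Z W q"
    by (intro ext; simp add: dens_s1_def dens_p1_def dens_s2_def dens_p2_def algebra_simps)+
  then show "S1 U V W Z q = P1 V U Z W q" "S2 U V W Z q = P2 V U Z W q"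
    "dS1 U V W Z q = dP1 V U Z W q" "dS2 U V W Z q = dP2 V U Z W q"
    by (intro ext; simp add: S1_def P1_def S2_def P2_def dS1_def dP1_def dS2_def dP2_def int_E_def int_dE_def
        kerE_swap[of Z W])+
qed

lemma half_angle: "sin x = 2 * sin (x / 2) * cos (x / 2)" "cos x = (cos (x / 2))\<^sup>2 - (sin (x / 2))\<^sup>2" for x :: real
  using sin_double[of "x / 2"] cos_double[of "x / 2"] by simp_all

text \<open>Half-angle formulas make the angle equations affine in the cosine, the form treated by
  \<open>C1x_ode\<close>, and the same coefficient \<open>dfun\<close> reappears in the equation for
  \<open>q\<close>.\<close>

lemma ode_system_symmetric:
  "ode_system U V W Z q \<longleftrightarrow> (\<forall>t x.
     ((\<lambda>\<tau>. U \<tau> x) has_real_derivative ffun U V W Z q t x) (at t) \<and>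
     ((\<lambda>\<tau>. V \<tau> x) has_real_derivative ffun V U Z W q t x) (at t) \<and>
     ((\<lambda>\<tau>. W \<tau> x) has_real_derivative cfun U V W Z q t x + dfun U V W Z q t x * cos (W t x)) (at t) \<and>
     ((\<lambda>\<tau>. Z \<tau> x) has_real_derivative cfun V U Z W q t x + dfun V U Z W q t x * cos (Z t x)) (at t) \<and>
     ((\<lambda>\<tau>. q \<tau> x) has_real_derivative
        q t x * (dfun U V W Z q t x * sin (W t x) + dfun V U Z W q t x * sin (Z t x))) (at t))"
proof -
  have sq: "(sin (x / 2))\<^sup>2 = (1 - cos x) / 2" "(cos (x / 2))\<^sup>2 = (1 + cos x) / 2" for x :: real
    using cos_double_sin[of "x / 2"] cos_double_cos[of "x / 2"] by simp_all
  have W: "2 * (U t x)\<^sup>2 * V t x * (cos (W t x / 2))\<^sup>2 - V t x * (sin (W t x / 2))\<^sup>2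
      - 2 * (P1 (U t) (V t) (W t) (Z t) (q t) x + dP2 (U t) (V t) (W t) (Z t) (q t) x) * (cos (W t x / 2))\<^sup>2
    = cfun U V W Z q t x + dfun U V W Z q t x * cos (W t x)" for U V W Z q :: spacetime and t x
    unfolding sq cfun_def dfun_def afun_def by (simp add: field_simps)
  have Z: "2 * U t x * (V t x)\<^sup>2 * (cos (Z t x / 2))\<^sup>2 - U t x * (sin (Z t x / 2))\<^sup>2
      - 2 * (P1 (V t) (U t) (Z t) (W t) (q t) x + dP2 (V t) (U t) (Z t) (W t) (q t) x) * (cos (Z t x / 2))\<^sup>2
    = cfun V U Z W q t x + dfun V U Z W q t x * cos (Z t x)" for t x
    unfolding sq cfun_def dfun_def afun_def by (simp add: field_simps)
  have Q: "q t x * ((U t x)\<^sup>2 * V t x + 1/2 * V t x - P1 (U t) (V t) (W t) (Z t) (q t) x - dP2 (U t) (V t) (W t) (Z t) (q t) x) * sin (W t x)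
     + q t x * (U t x * (V t x)\<^sup>2 + 1/2 * U t x - P1 (V t) (U t) (Z t) (W t) (q t) x - dP2 (V t) (U t) (Z t) (W t) (q t) x) * sin (Z t x)
     = q t x * (dfun U V W Z q t x * sin (W t x) + dfun V U Z W q t x * sin (Z t x))" for t x
    unfolding dfun_def afun_def by (simp add: algebra_simps)
  show ?thesis
    unfolding ode_system_def Let_def state_swap[of "U t" "V t" "W t" "Z t" "q t" for t] W Z Q ffun_def ..
qed

text \<open>Here \<open>s, c\<close> are the sine and cosine of \<open>W/2\<close>,
  \<open>s', c'\<close> those of \<open>Z/2\<close>, and \<open>a, b\<close> the two values of
  \<open>afun\<close>. The left side is the time derivative of \<open>gdens\<close> along the
  equations; the nonlocal terms \<open>a, b\<close> cancel and the formal \<open>(UV)_\<xi>\<close>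
  remains.\<close>

lemma gdens_algebra:
  fixes s c s' c' :: real
  assumes "s\<^sup>2 + c\<^sup>2 = 1" "s'\<^sup>2 + c'\<^sup>2 = 1"
  shows "q * ((u\<^sup>2 * v - a + v / 2) * (2 * s * c) + (v\<^sup>2 * u - b + u / 2) * (2 * s' * c')) * c\<^sup>2 * c'\<^sup>2
      - q * (s * c) * ((u\<^sup>2 * v - a - v / 2) + (u\<^sup>2 * v - a + v / 2) * (c\<^sup>2 - s\<^sup>2)) * c'\<^sup>2
      - q * c\<^sup>2 * (s' * c') * ((v\<^sup>2 * u - b - u / 2) + (v\<^sup>2 * u - b + u / 2) * (c'\<^sup>2 - s'\<^sup>2))
    = q * (s * c) * c'\<^sup>2 * v + u * (q * (s' * c') * c\<^sup>2)"
proof -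
  have 1: "(u\<^sup>2 * v - a - v / 2) + (u\<^sup>2 * v - a + v / 2) * (c\<^sup>2 - s\<^sup>2) = 2 * (u\<^sup>2 * v - a) * c\<^sup>2 - v * s\<^sup>2"
    using assms(1) by algebra
  have 2: "(v\<^sup>2 * u - b - u / 2) + (v\<^sup>2 * u - b + u / 2) * (c'\<^sup>2 - s'\<^sup>2) = 2 * (v\<^sup>2 * u - b) * c'\<^sup>2 - u * s'\<^sup>2"
    using assms(2) by algebra
  show ?thesis
    unfolding 1 2 using assms by algebra
qed

text \<open>The analogue for \<open>hdens\<close>, in the same notation. Now only \<open>b\<close>
  cancels, and the right side is the density of \<open>P1\<close> minus \<open>a\<close> times
  \<open>gdens\<close>, which is the \<open>\<xi>\<close>-derivative of \<open>U_t\<close>.\<close>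

lemma hdens_algebra:
  fixes s c s' c' :: real
  assumes "s\<^sup>2 + c\<^sup>2 = 1" "s'\<^sup>2 + c'\<^sup>2 = 1"
  shows "1/2 * (q * ((u\<^sup>2 * v - a + v / 2) * (2 * s * c) + (v\<^sup>2 * u - b + u / 2) * (2 * s' * c'))) * (2 * s * c) * c'\<^sup>2
      + 1/2 * q * ((c\<^sup>2 - s\<^sup>2) * ((u\<^sup>2 * v - a - v / 2) + (u\<^sup>2 * v - a + v / 2) * (c\<^sup>2 - s\<^sup>2))) * c'\<^sup>2
      - 1/2 * q * (2 * s * c) * (s' * c') * ((v\<^sup>2 * u - b - u / 2) + (v\<^sup>2 * u - b + u / 2) * (c'\<^sup>2 - s'\<^sup>2))
    = q * (u\<^sup>2 * v * c\<^sup>2 * c'\<^sup>2 + 1/4 * u * (2 * s * c) * (2 * s' * c') + 1/2 * v * s\<^sup>2 * c'\<^sup>2)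
      - a * (q * c\<^sup>2 * c'\<^sup>2)"
proof -
  have 1: "(u\<^sup>2 * v - a - v / 2) + (u\<^sup>2 * v - a + v / 2) * (c\<^sup>2 - s\<^sup>2) = 2 * (u\<^sup>2 * v - a) * c\<^sup>2 - v * s\<^sup>2"
    using assms(1) by algebra
  have 2: "(v\<^sup>2 * u - b - u / 2) + (v\<^sup>2 * u - b + u / 2) * (c'\<^sup>2 - s'\<^sup>2) = 2 * (v\<^sup>2 * u - b) * c'\<^sup>2 - u * s'\<^sup>2"
    using assms(2) by algebra
  show ?thesis
    unfolding 1 2 using assms by algebra
qed

section \<open>Kernel bounds for the potential of a density\<close>

lemma bounded_measurable_interval_integrable:
  fixes g :: "real \<Rightarrow> real" and a b :: real
  assumes "g \<in> borel_measurable borel" "\<And>x. \<bar>g x\<bar> \<le> C"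
  shows "set_integrable lborel {a..b} g" "interval_lebesgue_integrable lborel a b g"
proof -
  have *: "set_integrable lborel A g" if "A \<in> sets borel" "bounded A" for A
  proof -
    obtain c d where "A \<subseteq> {c..d}"
      using bounded_subset_cbox_symmetric[OF \<open>bounded A\<close>] by (metis box_real(2))
    then have "emeasure lborel A \<le> emeasure lborel {c..d}"
      by (intro emeasure_mono) auto
    then have "emeasure lborel A < \<infinity>"
      by (rule order.strict_trans1) (simp add: emeasure_lborel_Icc_eq)
    then show ?thesis
      unfolding set_integrable_def
      using that assms by (intro integrableI_bounded_set_indicator[where B=C]) auto
  qed
  show "set_integrable lborel {a..b} g"
    by (rule *) auto
  show "interval_lebesgue_integrable lborel a b g"
    unfolding interval_lebesgue_integrable_def by (auto intro!: * simp: einterval_eq_Icc)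
qed

lemma LBINT_primitive_diff:
  fixes g :: "real \<Rightarrow> real"
  assumes g: "g \<in> borel_measurable borel" "\<And>x. \<bar>g x\<bar> \<le> C"
  shows "(LBINT s=ereal 0..ereal b. g s) - (LBINT s=ereal 0..ereal a. g s) = (LBINT s=ereal a..ereal b. g s)"
proof -
  have "(LBINT s=ereal 0..ereal a. g s) + (LBINT s=ereal a..ereal b. g s) = (LBINT s=ereal 0..ereal b. g s)"
    by (rule interval_integral_sum)
      (auto simp: min_def max_def intro: bounded_measurable_interval_integrable[OF g])
  then show ?thesis by simp
qed

text \<open>\<open>w\<close> measures how far \<open>g\<close> may fall below \<open>1 / B\<close>.
  Its integral over the line bounds the loss on every interval, which is the constant
  \<open>M\<close> of the locale.\<close>

lemma kernel_of_density:
  fixes g w :: "real \<Rightarrow> real"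
  assumes g: "g \<in> borel_measurable borel" "\<And>x. 0 \<le> g x" "\<And>x. g x \<le> B" and B: "B > 0"
    and w: "integrable lborel w" "\<And>x. 0 \<le> w x" "(LINT x|lborel. w x) \<le> M"
    and low: "\<And>x. (1 - w x) / B \<le> g x"
  shows "kernel (\<lambda>x. LBINT s=ereal 0..ereal x. g s) B M"
proof
  show "B > 0" by fact
  fix a b :: real assume ab: "a \<le> b"
  have gB: "\<bar>g x\<bar> \<le> B" for x
    using g(2,3)[of x] by simp
  let ?Y = "\<lambda>x. LBINT s=ereal 0..ereal x. g s"
  have eq: "?Y b - ?Y a = (LINT s|lborel. indicator {a..b} s *\<^sub>R g s)"
    using LBINT_primitive_diff[OF g(1) gB] ab by (simp add: interval_integral_Icc set_lebesgue_integral_def)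
  have ig: "integrable lborel (\<lambda>s. indicator {a..b} s *\<^sub>R g s)"
    using bounded_measurable_interval_integrable(1)[OF g(1) gB] by (simp add: set_integrable_def)
  have i1: "integrable lborel (\<lambda>s. indicator {a..b} s *\<^sub>R c)" for c :: real
    using ab by (intro integrable_scaleR_left) (auto intro!: integrable_real_indicator)
  have iw: "integrable lborel (\<lambda>s. indicator {a..b} s *\<^sub>R w s)"
    using w(1) by (intro integrable_mult_indicator) auto
  have "0 \<le> (LINT s|lborel. indicator {a..b} s *\<^sub>R g s)"
    using g(2) by (intro Bochner_Integration.integral_nonneg) auto
  then show "?Y a \<le> ?Y b" using eq by simp
  have "(LINT s|lborel. indicator {a..b} s *\<^sub>R g s) \<le> (LINT s|lborel. indicator {a..b} s *\<^sub>R B)"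
    using g(3) by (intro integral_mono ig i1) (auto simp: indicator_def)
  then show "?Y b - ?Y a \<le> B * (b - a)"
    using eq ab by (simp add: mult.commute)
  have "(b - a - M) / B \<le> ((LINT s|lborel. indicator {a..b} s *\<^sub>R 1) - (LINT s|lborel. w s)) / B"
    using w(3) B ab by (intro divide_right_mono) auto
  also have "\<dots> = (LINT s|lborel. (indicator {a..b} s *\<^sub>R 1 - w s) / B)"
    using Bochner_Integration.integral_diff[OF i1[of 1] w(1)] by (simp only: integral_divide_zero)
  also have "\<dots> \<le> (LINT s|lborel. indicator {a..b} s *\<^sub>R g s)"
  proof (rule integral_mono[OF _ ig])
    show "integrable lborel (\<lambda>s. (indicator {a..b} s *\<^sub>R 1 - w s) / B)"
      using i1[of 1] w(1) by (intro integrable_divide Bochner_Integration.integrable_diff) auto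
    show "(indicator {a..b} s *\<^sub>R 1 - w s) / B \<le> indicator {a..b} s *\<^sub>R g s" for s
      using low[of s] w(2)[of s] B by (auto simp: indicator_def)
  qed
  finally show "(b - a - M) / B \<le> ?Y b - ?Y a"
    using eq by simp
qed

lemma gdens_lower_algebra:
  fixes w z :: real
  shows "1 - (w\<^sup>2 + z\<^sup>2) / 4 \<le> (cos (w / 2))\<^sup>2 * (cos (z / 2))\<^sup>2"
proof -
  have 1: "(sin (w / 2))\<^sup>2 \<le> w\<^sup>2 / 4" for w :: real
    using abs_sin_x_le_abs_x[of "w / 2"] abs_le_square_iff[of "sin (w / 2)" "w / 2"] by (simp add: power_divide)
  have 2: "(cos (w / 2))\<^sup>2 = 1 - (sin (w / 2))\<^sup>2" for w :: real
    by (simp add: cos_squared_eq)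
  have "(cos (w / 2))\<^sup>2 * (cos (z / 2))\<^sup>2 =
      1 - (sin (w / 2))\<^sup>2 - (sin (z / 2))\<^sup>2 + (sin (w / 2))\<^sup>2 * (sin (z / 2))\<^sup>2"
    unfolding 2 by (simp add: algebra_simps)
  moreover have "0 \<le> (sin (w / 2))\<^sup>2 * (sin (z / 2))\<^sup>2" by simp
  ultimately show ?thesis
    using 1[of w] 1[of z] unfolding add_divide_distrib by linarith
qed

subsection \<open>Solutions with regular data\<close>

text \<open>\<open>U0\<close> and \<open>V0\<close> say that the formulas for \<open>U_\<xi>\<close>
  and \<open>V_\<xi>\<close> hold at time 0; their validity at all other times is derived from the
  equations.\<close>

locale flow =
  fixes U V W Z q :: spacetime
  assumes ode: "ode_system U V W Z q" and cls: "solution_class U V W Z q"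
    and q0: "\<And>x. q 0 x = 1"
    and U0: "\<And>x. (U 0 has_real_derivative hdens W Z q 0 x) (at x)"
    and V0: "\<And>x. (V 0 has_real_derivative hdens Z W q 0 x) (at x)"
    and W0: "C2_lipschitz (W 0)" and Z0: "C2_lipschitz (Z 0)"
begin

lemma swap: "flow V U Z W q"
proof
  show "ode_system V U Z W q"
    using ode unfolding ode_system_symmetric by (simp add: add.commute)
  show "solution_class V U Z W q"
    using cls unfolding solution_class_def by (simp add: insert_commute)
qed (use q0 U0 V0 W0 Z0 in auto)

lemma der_U: "((\<lambda>\<tau>. U \<tau> x) has_real_derivative ffun U V W Z q t x) (at t)"
  and der_W: "((\<lambda>\<tau>. W \<tau> x) has_real_derivative cfun U V W Z q t x + dfun U V W Z q t x * cos (W t x)) (at t)"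
  and der_q: "((\<lambda>\<tau>. q \<tau> x) has_real_derivative
        q t x * (dfun U V W Z q t x * sin (W t x) + dfun V U Z W q t x * sin (Z t x))) (at t)"
  using ode unfolding ode_system_symmetric by blast+

lemma class_bounds:
  assumes "T > 0"
  obtains B where "B > 0"
    "\<And>t. t \<in> {-T..T} \<Longrightarrow> square_integrable (U t) \<and> square_integrable (W t) \<and> L2_norm (W t) \<le> B \<and> q t \<in> borel_measurable borel"
    "\<And>t x. t \<in> {-T..T} \<Longrightarrow> \<bar>U t x\<bar> \<le> B \<and> \<bar>W t x\<bar> \<le> B \<and> 1 / B \<le> q t x \<and> q t x \<le> B"
    "\<And>t. t \<in> {-T..T} \<Longrightarrow> square_integrable (Z t) \<and> L2_norm (Z t) \<le> B"
proof -
  obtain B where "B > 0" and *: "\<forall>t\<in>{-T..T}.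
     (\<forall>F\<in>{U, V, W, Z}. square_integrable (F t) \<and> L2_norm (F t) \<le> B \<and> (\<forall>\<xi>. \<bar>F t \<xi>\<bar> \<le> B)) \<and>
     q t \<in> borel_measurable borel \<and> (\<forall>\<xi>. 1 / B \<le> q t \<xi> \<and> q t \<xi> \<le> B)"
    using cls assms unfolding solution_class_def by blast
  then show ?thesis
    by (intro that[of B]) simp_all
qed

lemma meas: "U t \<in> borel_measurable borel" "W t \<in> borel_measurable borel" "q t \<in> borel_measurable borel"
  and W_square_integrable: "square_integrable (W t)"
  and q_pos: "q t x > 0"
proof -
  have T: "\<bar>t\<bar> + 1 > 0" "t \<in> {-(\<bar>t\<bar> + 1)..\<bar>t\<bar> + 1}" by auto
  obtain B where "B > 0"
    and B: "\<And>s. s \<in> {-(\<bar>t\<bar> + 1)..\<bar>t\<bar> + 1} \<Longrightarrow> square_integrable (U s) \<and> square_integrable (W s) \<and> L2_norm (W s) \<le> B \<and> q s \<in> borel_measurable borel"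
    "\<And>s x. s \<in> {-(\<bar>t\<bar> + 1)..\<bar>t\<bar> + 1} \<Longrightarrow> \<bar>U s x\<bar> \<le> B \<and> \<bar>W s x\<bar> \<le> B \<and> 1 / B \<le> q s x \<and> q s x \<le> B"
    using class_bounds[OF T(1)] by metis
  show "U t \<in> borel_measurable borel" "W t \<in> borel_measurable borel" "q t \<in> borel_measurable borel"
    "square_integrable (W t)"
    using B(1)[OF T(2)] by (auto simp: square_integrable_def)
  show "q t x > 0"
    using B(2)[OF T(2), of x] \<open>B > 0\<close> by (smt (verit) divide_pos_pos)
qed

lemma lbd_state: "lbd U" "lbd W" "lbd q"
proof -
  have "\<exists>B. \<forall>t\<in>{-T..T}. \<forall>x. \<bar>U t x\<bar> \<le> B \<and> \<bar>W t x\<bar> \<le> B \<and> \<bar>q t x\<bar> \<le> B" if T: "T > 0" for T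
  proof -
    obtain B where "\<And>t x. t \<in> {-T..T} \<Longrightarrow> \<bar>U t x\<bar> \<le> B \<and> \<bar>W t x\<bar> \<le> B \<and> 1 / B \<le> q t x \<and> q t x \<le> B"
      using class_bounds[OF T] by metis
    then show ?thesis
      using q_pos by (intro exI[of _ B]) (simp add: abs_of_pos)
  qed
  then show "lbd U" "lbd W" "lbd q"
    unfolding lbd_def by meson+
qed

lemmas lbd_states = lbd_state flow.lbd_state(1,2)[OF swap]
lemmas meas_states [measurable] = meas flow.meas(1,2)[OF swap]

abbreviation "Y \<equiv> ypot W Z q"
abbreviation "g \<equiv> gdens W Z q"

lemma g_meas [measurable]: "g t \<in> borel_measurable borel"
  unfolding gdens_def[abs_def] by measurable

lemma g_nonneg: "g t x \<ge> 0"
  using q_pos[of t x] by (simp add: gdens_def)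

lemma g_le_q: "g t x \<le> q t x"
proof -
  have "g t x = q t x * ((cos (W t x / 2))\<^sup>2 * (cos (Z t x / 2))\<^sup>2)"
    by (simp add: gdens_def)
  also have "\<dots> \<le> q t x * 1"
    using q_pos[of t x] by (intro mult_left_mono mult_le_one) (auto simp: abs_square_le_1)
  finally show ?thesis by simp
qed

lemma g_bound: "\<exists>C. \<forall>x. \<bar>g t x\<bar> \<le> C"
proof -
  have "\<bar>t\<bar> + 1 > 0" by simp
  from lbd_pos[OF lbd_state(3) this] obtain C where "\<forall>s\<in>{-(\<bar>t\<bar> + 1)..\<bar>t\<bar> + 1}. \<forall>x. \<bar>q s x\<bar> \<le> C"
    by blast
  then have "\<And>x. \<bar>q t x\<bar> \<le> C" by force
  then show ?thesis
    using g_nonneg[of t] g_le_q[of t] order_trans by (metis abs_ge_self abs_of_nonneg)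
qed

lemma kernel_Y: "kernel_family Y"
  unfolding kernel_family_def
proof (intro allI impI)
  fix T :: real assume T: "T > 0"
  obtain B where B: "B > 0"
    and b1: "\<And>t. t \<in> {-T..T} \<Longrightarrow> square_integrable (U t) \<and> square_integrable (W t) \<and> L2_norm (W t) \<le> B \<and> q t \<in> borel_measurable borel"
    and b2: "\<And>t x. t \<in> {-T..T} \<Longrightarrow> \<bar>U t x\<bar> \<le> B \<and> \<bar>W t x\<bar> \<le> B \<and> 1 / B \<le> q t x \<and> q t x \<le> B"
    and b3: "\<And>t. t \<in> {-T..T} \<Longrightarrow> square_integrable (Z t) \<and> L2_norm (Z t) \<le> B"
    using class_bounds[OF T] by metis
  \<comment> \<open>The loss density is \<open>(W^2 + Z^2) / 4\<close>: where both angles are small,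
    \<open>gdens\<close> is close to \<open>q\<close>. Each square integrates to at most
    \<open>B^2\<close>, hence \<open>B^2 / 2\<close>.\<close>
  have "kernel (Y t) B (B\<^sup>2 / 2)" if t: "t \<in> {-T..T}" for t
  proof -
    have iW: "integrable lborel (\<lambda>x. (W t x)\<^sup>2)" "(LINT x|lborel. (W t x)\<^sup>2) \<le> B\<^sup>2"
      and iZ: "integrable lborel (\<lambda>x. (Z t x)\<^sup>2)" "(LINT x|lborel. (Z t x)\<^sup>2) \<le> B\<^sup>2"
      using b1[OF t] b3[OF t] B by (auto simp: square_integrable_def L2_norm_def sqrt_le_D)
    have "kernel (\<lambda>x. LBINT s=ereal 0..ereal x. g t s) B (B\<^sup>2 / 2)"
    proof (rule kernel_of_density[where w = "\<lambda>x. ((W t x)\<^sup>2 + (Z t x)\<^sup>2) / 4"])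
      show "g t x \<le> B" for x
        using g_le_q[of t x] b2[OF t, of x] by linarith
      show "(LINT x|lborel. ((W t x)\<^sup>2 + (Z t x)\<^sup>2) / 4) \<le> B\<^sup>2 / 2"
        using iW iZ by simp
      show "(1 - ((W t x)\<^sup>2 + (Z t x)\<^sup>2) / 4) / B \<le> g t x" for x
      proof -
        have "(1 - ((W t x)\<^sup>2 + (Z t x)\<^sup>2) / 4) / B \<le> ((cos (W t x / 2))\<^sup>2 * (cos (Z t x / 2))\<^sup>2) / B"
          using B by (intro divide_right_mono gdens_lower_algebra) auto
        also have "\<dots> = 1 / B * ((cos (W t x / 2))\<^sup>2 * (cos (Z t x / 2))\<^sup>2)"
          by simp
        also have "\<dots> \<le> q t x * ((cos (W t x / 2))\<^sup>2 * (cos (Z t x / 2))\<^sup>2)"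
          using b2[OF t, of x] by (intro mult_right_mono) auto
        finally show ?thesis by (simp add: gdens_def)
      qed
    qed (use B iW iZ g_nonneg in auto)
    then show ?thesis
      by (simp add: ypot_def[abs_def])
  qed
  then show "\<exists>B M. \<forall>t\<in>{-T..T}. kernel (Y t) B M"
    by blast
qed

lemma kerE_eq: "kerE (W t) (Z t) (q t) \<xi> \<eta> = EY (Y t) \<xi> \<eta>"
proof -
  obtain C where C: "\<And>x. \<bar>g t x\<bar> \<le> C" using g_bound by blast
  have "(LBINT s=ereal \<eta>..ereal \<xi>. g t s) = Y t \<xi> - Y t \<eta>"
    unfolding ypot_def using LBINT_primitive_diff[OF g_meas C] by simp
  then show ?thesis
    by (simp add: kerE_def EY_def gdens_def[symmetric])
qed

abbreviation "p1 \<equiv> \<lambda>t. dens_p1 (U t) (V t) (W t) (Z t) (q t)"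
abbreviation "p2 \<equiv> \<lambda>t. dens_p2 (U t) (V t) (W t) (Z t) (q t)"

lemma p_meas [measurable]: "p1 t \<in> borel_measurable borel" "p2 t \<in> borel_measurable borel"
  unfolding dens_p1_def[abs_def] dens_p2_def[abs_def] by measurable

lemma lbd_p: "lbd p1" "lbd p2"
  unfolding dens_p1_def[abs_def] dens_p2_def[abs_def] by (intro lbd_intros lbd_states)+

abbreviation "P1f \<equiv> \<lambda>t. P1 (U t) (V t) (W t) (Z t) (q t)"
abbreviation "P2f \<equiv> \<lambda>t. P2 (U t) (V t) (W t) (Z t) (q t)"
abbreviation "dP1f \<equiv> \<lambda>t. dP1 (U t) (V t) (W t) (Z t) (q t)"
abbreviation "dP2f \<equiv> \<lambda>t. dP2 (U t) (V t) (W t) (Z t) (q t)"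

lemma int_E_eq:
  assumes "\<And>t. p t \<in> borel_measurable borel" "lbd p"
  shows "int_E (W t) (Z t) (q t) (p t) x = KL (Y t) (p t) x + KR (Y t) (p t) x"
    "int_dE (W t) (Z t) (q t) (p t) x = KR (Y t) (p t) x - KL (Y t) (p t) x"
proof -
  have T: "\<bar>t\<bar> + 1 > 0" "t \<in> {-(\<bar>t\<bar> + 1)..\<bar>t\<bar> + 1}" by auto
  obtain C where C: "\<forall>s\<in>{-(\<bar>t\<bar> + 1)..\<bar>t\<bar> + 1}. \<forall>x. \<bar>p s x\<bar> \<le> C"
    using assms(2)[unfolded lbd_def, rule_format, OF T(1)] by auto
  obtain B M where "kernel (Y t) B M"
    using kernel_Y[unfolded kernel_family_def, rule_format, OF T(1)] T(2) by blast
  then show "int_E (W t) (Z t) (q t) (p t) x = KL (Y t) (p t) x + KR (Y t) (p t) x"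
    unfolding int_E_def kerE_eq using C T(2) by (subst kernel.KL_plus_KR[OF _ assms(1)]) auto
  show "int_dE (W t) (Z t) (q t) (p t) x = KR (Y t) (p t) x - KL (Y t) (p t) x"
    unfolding int_dE_def kerE_eq KL_def KR_def ..
qed

lemma P_eq:
  "P1f = (\<lambda>t x. (KL (Y t) (p1 t) x + KR (Y t) (p1 t) x) / 2)"
  "P2f = (\<lambda>t x. (KL (Y t) (p2 t) x + KR (Y t) (p2 t) x) / 8)"
  "dP1f = (\<lambda>t x. (KR (Y t) (p1 t) x - KL (Y t) (p1 t) x) / 2)"
  "dP2f = (\<lambda>t x. (KR (Y t) (p2 t) x - KL (Y t) (p2 t) x) / 8)"
  unfolding P1_def[abs_def] P2_def[abs_def] dP1_def[abs_def] dP2_def[abs_def]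
  by (intro ext; simp add: int_E_eq[OF p_meas(1) lbd_p(1)] int_E_eq[OF p_meas(2) lbd_p(2)])+

lemma lbd_P: "lbd P1f" "lbd P2f" "lbd dP1f" "lbd dP2f"
  and llip_P: "llip P1f" "llip P2f" "llip dP1f" "llip dP2f"
  unfolding P_eq
  by (intro lbd_intros llip_intros lbd_KL_KR[OF kernel_Y p_meas(1) lbd_p(1)] lbd_KL_KR[OF kernel_Y p_meas(2) lbd_p(2)])+

end

section \<open>Lipschitz, \<open>C^1\<close> and \<open>C^2\<close> dependence on the space
  variable\<close>

lemma lipschitz_of_derivative_bound:
  fixes f :: "real \<Rightarrow> real"
  assumes "\<And>x. (f has_real_derivative f' x) (at x)" "\<And>x. \<bar>f' x\<bar> \<le> C"
  shows "\<bar>f x - f y\<bar> \<le> C * \<bar>x - y\<bar>"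
  by (rule abs_diff_le_of_derivative_bound[where a = "min x y" and b = "max x y", OF assms]) auto

lemma llip_of_llip_derivative:
  assumes der: "\<And>t x. ((\<lambda>\<tau>. f \<tau> x) has_real_derivative F t x) (at t)" and F: "llip F"
    and init: "\<And>x y. \<bar>f 0 x - f 0 y\<bar> \<le> L0 * \<bar>x - y\<bar>"
  shows "llip f"
proof (rule llip_gronwall[OF der _ init])
  fix T :: real assume "T > 0"
  from llip_pos[OF F this] obtain C where C: "C > 0" "\<And>t x y. t \<in> {-T..T} \<Longrightarrow> \<bar>F t x - F t y\<bar> \<le> C * \<bar>x - y\<bar>"
    by blast
  have "\<bar>F t x - F t y\<bar> \<le> C * (\<bar>f t x - f t y\<bar> + \<bar>x - y\<bar>)" if "t \<in> {-T..T}" for t x y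
    using C(2)[OF that, of x y] C(1) mult_left_mono[of "\<bar>x - y\<bar>" "\<bar>f t x - f t y\<bar> + \<bar>x - y\<bar>" C] by linarith
  then show "\<exists>L\<ge>0. \<forall>t\<in>{-T..T}. \<forall>x y. \<bar>F t x - F t y\<bar> \<le> L * (\<bar>f t x - f t y\<bar> + \<bar>x - y\<bar>)"
    using C(1) by (intro exI[of _ C]) auto
qed

text \<open>Serves the angles with \<open>\<phi>\<close> the cosine and \<open>q\<close> with
  \<open>\<phi>\<close> the identity; for the latter, \<open>\<phi>\<close> is bounded only along
  the solution, which is how the assumption is phrased.\<close>

lemma llip_of_ode:
  assumes der: "\<And>t x. ((\<lambda>\<tau>. f \<tau> x) has_real_derivative \<alpha> t x + \<beta> t x * \<phi> (f t x)) (at t)"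
    and \<alpha>: "llip \<alpha>" and \<beta>: "llip \<beta>" "lbd \<beta>" and \<phi>: "lbd (\<lambda>t x. \<phi> (f t x))" "\<And>a b. \<bar>\<phi> a - \<phi> b\<bar> \<le> \<bar>a - b\<bar>"
    and init: "\<And>x y. \<bar>f 0 x - f 0 y\<bar> \<le> L0 * \<bar>x - y\<bar>"
  shows "llip f"
proof (rule llip_gronwall[OF der _ init])
  fix T :: real assume T: "T > 0"
  obtain A where A: "A > 0" "\<And>t x y. t \<in> {-T..T} \<Longrightarrow> \<bar>\<alpha> t x - \<alpha> t y\<bar> \<le> A * \<bar>x - y\<bar>"
    using llip_pos[OF \<alpha> T] by blast
  obtain B where B: "B > 0" "\<And>t x y. t \<in> {-T..T} \<Longrightarrow> \<bar>\<beta> t x - \<beta> t y\<bar> \<le> B * \<bar>x - y\<bar>"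
    using llip_pos[OF \<beta>(1) T] by blast
  obtain D where D: "D > 0" "\<And>t x. t \<in> {-T..T} \<Longrightarrow> \<bar>\<beta> t x\<bar> \<le> D"
    using lbd_pos[OF \<beta>(2) T] by blast
  obtain E where E: "E > 0" "\<And>t x. t \<in> {-T..T} \<Longrightarrow> \<bar>\<phi> (f t x)\<bar> \<le> E"
    using lbd_pos[OF \<phi>(1) T] by blast
  define L where "L = A + B * E + D"
  have L: "A + B * E \<le> L" "D \<le> L" "L \<ge> 0" using A B D E by (auto simp: L_def)
  have "\<bar>\<alpha> t x + \<beta> t x * \<phi> (f t x) - (\<alpha> t y + \<beta> t y * \<phi> (f t y))\<bar> \<le> L * (\<bar>f t x - f t y\<bar> + \<bar>x - y\<bar>)"
    if t: "t \<in> {-T..T}" for t x y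
  proof -
    have "\<alpha> t x + \<beta> t x * \<phi> (f t x) - (\<alpha> t y + \<beta> t y * \<phi> (f t y)) =
      (\<alpha> t x - \<alpha> t y) + (\<beta> t x - \<beta> t y) * \<phi> (f t x) + \<beta> t y * (\<phi> (f t x) - \<phi> (f t y))"
      by (simp add: algebra_simps)
    also have "\<bar>\<dots>\<bar> \<le> \<bar>\<alpha> t x - \<alpha> t y\<bar> + \<bar>\<beta> t x - \<beta> t y\<bar> * \<bar>\<phi> (f t x)\<bar> + \<bar>\<beta> t y\<bar> * \<bar>\<phi> (f t x) - \<phi> (f t y)\<bar>"
      unfolding abs_mult[symmetric] by linarith
    also have "\<dots> \<le> A * \<bar>x - y\<bar> + (B * \<bar>x - y\<bar>) * E + D * \<bar>f t x - f t y\<bar>"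
      using A B D E t \<phi>(2) by (intro add_mono mult_mono) auto
    also have "\<dots> = (A + B * E) * \<bar>x - y\<bar> + D * \<bar>f t x - f t y\<bar>"
      by (simp add: algebra_simps)
    also have "\<dots> \<le> L * \<bar>x - y\<bar> + L * \<bar>f t x - f t y\<bar>"
      using L by (intro add_mono mult_right_mono) auto
    finally show ?thesis by (simp add: algebra_simps)
  qed
  then show "\<exists>L\<ge>0. \<forall>t\<in>{-T..T}. \<forall>x y. \<bar>\<alpha> t x + \<beta> t x * \<phi> (f t x) - (\<alpha> t y + \<beta> t y * \<phi> (f t y))\<bar> \<le> L * (\<bar>f t x - f t y\<bar> + \<bar>x - y\<bar>)"
    using L(3) by blast
qed

lemma C1x_cong: "C1x f f' \<Longrightarrow> (\<And>t x. f' t x = f'' t x) \<Longrightarrow> C1x f f''"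
  by (simp add: C1x_def jc_def)

lemma der_half:
  assumes "((\<lambda>\<tau>. F \<tau>) has_real_derivative D) (at t)"
  shows "((\<lambda>\<tau>. (cos (F \<tau> / 2))\<^sup>2) has_real_derivative - (sin (F t / 2) * cos (F t / 2)) * D) (at t)"
  using assms by (auto intro!: derivative_eq_intros)

text \<open>Both \<open>f\<close> and the candidate \<open>f'\<close> are recovered from time 0 by
  integrating their time derivatives, and space differentiation passes under that integral. Thus an
  explicit formula for a derivative has to be checked only at time 0 and through its
  evolution.\<close>

lemma C1x_of_time_derivative:
  assumes der: "\<And>t x. ((\<lambda>\<tau>. f \<tau> x) has_real_derivative F t x) (at t)" and F: "C1x F G"
    and der': "\<And>t x. ((\<lambda>\<tau>. f' \<tau> x) has_real_derivative G t x) (at t)"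
    and init: "\<And>x. (f 0 has_real_derivative f' 0 x) (at x)" "continuous_on UNIV (f' 0)"
  shows "C1x f f'"
proof -
  have "C1x (\<lambda>t x. f 0 x + prim (\<lambda>\<tau>. F \<tau> x) t) (\<lambda>t x. f' 0 x + prim (\<lambda>\<tau>. G \<tau> x) t)"
    by (intro C1x_add C1x_space C1x_prim_time F init)
  moreover have "f = (\<lambda>t x. f 0 x + prim (\<lambda>\<tau>. F \<tau> x) t)" "f' = (\<lambda>t x. f' 0 x + prim (\<lambda>\<tau>. G \<tau> x) t)"
    using eq_prim[OF der] eq_prim[OF der'] by blast+
  ultimately show ?thesis by simp
qed

text \<open>Hides the derivative: in the second differentiation only its existence and continuity
  matter, and its formula would be unwieldy.\<close>

definition D1 :: "(real \<Rightarrow> real \<Rightarrow> real) \<Rightarrow> bool" where "D1 f \<longleftrightarrow> (\<exists>f'. C1x f f')"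

lemma D1_intros:
  "D1 (\<lambda>t x. r)"
  "D1 f \<Longrightarrow> D1 f' \<Longrightarrow> D1 (\<lambda>t x. f t x + f' t x)"
  "D1 f \<Longrightarrow> D1 f' \<Longrightarrow> D1 (\<lambda>t x. f t x - f' t x)"
  "D1 f \<Longrightarrow> D1 (\<lambda>t x. - f t x)"
  "D1 f \<Longrightarrow> D1 f' \<Longrightarrow> D1 (\<lambda>t x. f t x * f' t x)"
  "D1 f \<Longrightarrow> D1 (\<lambda>t x. f t x ^ n)"
  "D1 f \<Longrightarrow> r \<noteq> 0 \<Longrightarrow> D1 (\<lambda>t x. f t x / r)"
  "D1 f \<Longrightarrow> D1 (\<lambda>t x. sin (f t x))"
  "D1 f \<Longrightarrow> D1 (\<lambda>t x. cos (f t x))"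
  "D1 f \<Longrightarrow> D1 (\<lambda>t x. exp (f t x))"
  "D1 f \<Longrightarrow> D1 (\<lambda>t x. prim (\<lambda>\<tau>. f \<tau> x) t)"
  unfolding D1_def using C1x_intros C1x_prim_time by meson+

lemma derivative_imp_continuous:
  assumes "\<And>t. (f has_real_derivative D t) (at t)"
  shows "continuous_on UNIV f"
  using DERIV_continuous_on assms by blast

context flow
begin

lemma lbd_afun: "lbd (afun U V W Z q)" and llip_afun: "llip (afun U V W Z q)"
  unfolding afun_def[abs_def] by (intro lbd_intros llip_intros lbd_P llip_P)+

lemma lbd_ffun: "lbd (ffun U V W Z q)" and llip_ffun: "llip (ffun U V W Z q)"
  unfolding ffun_def[abs_def] by (intro lbd_intros llip_intros lbd_P llip_P)+

lemma abs_hdens_0_le: "\<bar>hdens W Z q 0 x\<bar> \<le> 1"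
proof -
  have "\<bar>sin (W 0 x) * (cos (Z 0 x / 2))\<^sup>2\<bar> \<le> 1"
    unfolding abs_mult by (intro mult_le_one) (auto simp: abs_square_le_1)
  then show ?thesis
    by (simp add: hdens_def q0 abs_mult)
qed

lemma llip_U: "llip U"
  by (rule llip_of_llip_derivative[OF der_U llip_ffun])
    (rule lipschitz_of_derivative_bound[OF U0 abs_hdens_0_le])

lemma llip_UV: "llip U" "llip V"
  using llip_U flow.llip_U[OF swap] by auto

lemma lbd_cfun: "lbd (cfun U V W Z q)" "lbd (dfun U V W Z q)"
  and llip_cfun: "llip (cfun U V W Z q)" "llip (dfun U V W Z q)"
  unfolding cfun_def[abs_def] dfun_def[abs_def]
  by (intro lbd_intros llip_intros lbd_states llip_UV lbd_afun llip_afun)+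

lemma llip_W: "llip W"
proof -
  obtain f1 C where f1: "\<And>x. (W 0 has_real_derivative f1 x) (at x)" "\<And>x. \<bar>f1 x\<bar> \<le> C"
    using W0 unfolding C2_lipschitz_def by blast
  show ?thesis
    by (rule llip_of_ode[OF der_W llip_cfun(1,2) lbd_cfun(2) _ _ lipschitz_of_derivative_bound[OF f1]])
      (auto intro: lbd_intros abs_cos_diff_le)
qed

lemma llip_WZ: "llip W" "llip Z"
  using llip_W flow.llip_W[OF swap] by auto

abbreviation "mfun \<equiv> \<lambda>t x. dfun U V W Z q t x * sin (W t x) + dfun V U Z W q t x * sin (Z t x)"

lemma llip_q: "llip q"
proof (rule llip_of_ode[where \<alpha> = "\<lambda>t x. 0" and \<beta> = mfun and \<phi> = "\<lambda>x. x" and ?L0.0 = 0])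
  show "((\<lambda>\<tau>. q \<tau> x) has_real_derivative 0 + mfun t x * q t x) (at t)" for t x
    using der_q[of x t] by (simp add: mult.commute)
  show "llip mfun" "lbd mfun"
    by (intro llip_intros lbd_intros llip_cfun flow.llip_cfun[OF swap] lbd_cfun flow.lbd_cfun[OF swap] llip_WZ)+
qed (auto simp: q0 intro: lbd_states llip_const)

lemma jc_state: "jc U" "jc W" "jc q"
  using jc_of_llip[OF llip_U derivative_imp_continuous[OF der_U]]
    jc_of_llip[OF llip_W derivative_imp_continuous[OF der_W]]
    jc_of_llip[OF llip_q derivative_imp_continuous[OF der_q]] by blast+

lemmas jc_states = jc_state flow.jc_state(1,2)[OF swap]

lemma jc_g: "jc g"
  unfolding gdens_def[abs_def] by (intro jc_intros jc_states) simp_all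

lemma Y_eq_prim: "Y t = prim (g t)"
  by (intro ext) (simp add: ypot_def LBINT_eq_prim[OF jc_at[OF jc_g]])

lemma C1x_Y: "C1x Y g"
  using jc_prim_space[OF jc_g] prim_has_derivative[OF jc_at[OF jc_g]]
  by (simp add: C1x_def jc_g Y_eq_prim[abs_def])

lemma jc_p: "jc p1" "jc p2"
  unfolding dens_p1_def[abs_def] dens_p2_def[abs_def] by (intro jc_intros jc_states; simp)+

lemmas C1x_K = C1x_KL_KR[OF kernel_Y jc_g C1x_Y jc_p(1) lbd_p(1)] C1x_KL_KR[OF kernel_Y jc_g C1x_Y jc_p(2) lbd_p(2)]

text \<open>The first-order form of the Green function identity. The local sources of
  \<open>KL\<close> and \<open>KR\<close> cancel in their sum and double in their difference; with
  the prefactors 1/2 and 1/8 this leaves \<open>p1\<close> and \<open>p2 / 4\<close>.\<close>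

lemma C1x_P:
  "C1x P1f (\<lambda>t x. g t x * dP1f t x)"
  "C1x P2f (\<lambda>t x. g t x * dP2f t x)"
  "C1x dP1f (\<lambda>t x. g t x * P1f t x - p1 t x)"
  "C1x dP2f (\<lambda>t x. g t x * P2f t x - p2 t x / 4)"
  unfolding P_eq
     apply (rule C1x_cong[OF C1x_divide[OF C1x_add[OF C1x_K(1,2)]]]; simp add: P_eq[THEN fun_cong, THEN fun_cong] field_simps)
    apply (rule C1x_cong[OF C1x_divide[OF C1x_add[OF C1x_K(3,4)]]]; simp add: P_eq[THEN fun_cong, THEN fun_cong] field_simps)
   apply (rule C1x_cong[OF C1x_divide[OF C1x_diff[OF C1x_K(2,1)]]]; simp add: P_eq[THEN fun_cong, THEN fun_cong] field_simps)
  apply (rule C1x_cong[OF C1x_divide[OF C1x_diff[OF C1x_K(4,3)]]]; simp add: P_eq[THEN fun_cong, THEN fun_cong] field_simps)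
  done

lemma C1x_afun: "C1x (afun U V W Z q) (\<lambda>t x. g t x * dP1f t x + (g t x * P2f t x - p2 t x / 4))"
  unfolding afun_def[abs_def] by (intro C1x_add C1x_P)

lemma C1x_ffun: "C1x (ffun U V W Z q) (\<lambda>t x. p1 t x - afun U V W Z q t x * g t x)"
  unfolding ffun_def[abs_def]
  by (rule C1x_cong[OF C1x_diff[OF C1x_minus[OF C1x_P(3)] C1x_P(2)]]) (simp add: afun_def algebra_simps)

abbreviation "h \<equiv> hdens W Z q"
abbreviation "k \<equiv> hdens Z W q"

lemma der_Z: "((\<lambda>\<tau>. Z \<tau> x) has_real_derivative cfun V U Z W q t x + dfun V U Z W q t x * cos (Z t x)) (at t)"
  by (rule flow.der_W[OF swap])

text \<open>The right side is the space derivative of \<open>ffun\<close> found in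
  \<open>C1x_ffun\<close>; since \<open>h\<close> is the derivative of \<open>U\<close> at time 0,
  it therefore remains so.\<close>

lemma der_h: "((\<lambda>\<tau>. h \<tau> x) has_real_derivative p1 t x - afun U V W Z q t x * g t x) (at t)"
proof -
  let ?W' = "cfun U V W Z q t x + dfun U V W Z q t x * cos (W t x)"
  let ?Z' = "cfun V U Z W q t x + dfun V U Z W q t x * cos (Z t x)"
  let ?q' = "q t x * mfun t x"
  have "((\<lambda>\<tau>. 1/2 * q \<tau> x * sin (W \<tau> x) * (cos (Z \<tau> x / 2))\<^sup>2) has_real_derivative
    (1/2 * ?q' * sin (W t x) + cos (W t x) * ?W' * (1/2 * q t x)) * (cos (Z t x / 2))\<^sup>2
     + - (sin (Z t x / 2) * cos (Z t x / 2)) * ?Z' * (1/2 * q t x * sin (W t x))) (at t)"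
    by (intro DERIV_mult DERIV_cmult der_half DERIV_fun_sin der_W der_Z der_q)
  moreover have "(1/2 * ?q' * sin (W t x) + cos (W t x) * ?W' * (1/2 * q t x)) * (cos (Z t x / 2))\<^sup>2
     + - (sin (Z t x / 2) * cos (Z t x / 2)) * ?Z' * (1/2 * q t x * sin (W t x)) =
    p1 t x - afun U V W Z q t x * g t x"
    using hdens_algebra[of "sin (W t x / 2)" "cos (W t x / 2)" "sin (Z t x / 2)" "cos (Z t x / 2)"
        "q t x" "U t x" "V t x" "afun U V W Z q t x" "afun V U Z W q t x"]
    unfolding half_angle[of "W t x"] half_angle[of "Z t x"] cfun_def dfun_def dens_p1_def gdens_def
    by (simp add: algebra_simps)
  ultimately show ?thesis
    by (simp add: hdens_def[abs_def])
qed

text \<open>Once \<open>h\<close> and \<open>k\<close> are known to be the space derivatives of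
  \<open>U\<close> and \<open>V\<close>, the right side is that of \<open>U V\<close>, the speed of
  the characteristics; this identifies \<open>g\<close> with the derivative of the
  characteristic.\<close>

lemma der_g: "((\<lambda>\<tau>. g \<tau> x) has_real_derivative h t x * V t x + U t x * k t x) (at t)"
proof -
  let ?W' = "cfun U V W Z q t x + dfun U V W Z q t x * cos (W t x)"
  let ?Z' = "cfun V U Z W q t x + dfun V U Z W q t x * cos (Z t x)"
  let ?q' = "q t x * mfun t x"
  have "((\<lambda>\<tau>. q \<tau> x * (cos (W \<tau> x / 2))\<^sup>2 * (cos (Z \<tau> x / 2))\<^sup>2) has_real_derivative
    (?q' * (cos (W t x / 2))\<^sup>2 + - (sin (W t x / 2) * cos (W t x / 2)) * ?W' * q t x) * (cos (Z t x / 2))\<^sup>2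
     + - (sin (Z t x / 2) * cos (Z t x / 2)) * ?Z' * (q t x * (cos (W t x / 2))\<^sup>2)) (at t)"
    by (intro DERIV_mult der_half der_W der_Z der_q)
  moreover have "(?q' * (cos (W t x / 2))\<^sup>2 + - (sin (W t x / 2) * cos (W t x / 2)) * ?W' * q t x) * (cos (Z t x / 2))\<^sup>2
     + - (sin (Z t x / 2) * cos (Z t x / 2)) * ?Z' * (q t x * (cos (W t x / 2))\<^sup>2) =
    h t x * V t x + U t x * k t x"
    using gdens_algebra[of "sin (W t x / 2)" "cos (W t x / 2)" "sin (Z t x / 2)" "cos (Z t x / 2)"
        "q t x" "U t x" "V t x" "afun U V W Z q t x" "afun V U Z W q t x"]
    unfolding half_angle[of "W t x"] half_angle[of "Z t x"] cfun_def dfun_def hdens_def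
    by (simp add: algebra_simps)
  ultimately show ?thesis
    by (simp add: gdens_def[abs_def])
qed

lemma jc_h: "jc h"
  unfolding hdens_def[abs_def] by (intro jc_intros jc_states) simp_all

lemma C1x_U: "C1x U h"
  by (rule C1x_of_time_derivative[OF der_U C1x_ffun der_h U0 jc_at[OF jc_h]])

lemma C1x_V: "C1x V k"
  by (rule flow.C1x_U[OF swap])

lemma C1x_characteristic:
  assumes "\<And>x. (y0 has_real_derivative g 0 x) (at x)"
  shows "C1x (\<lambda>t x. y0 x + prim (\<lambda>\<tau>. U \<tau> x * V \<tau> x) t) g"
proof (rule C1x_of_time_derivative[OF _ C1x_mult[OF C1x_U C1x_V] der_g])
  show "((\<lambda>\<tau>. y0 x + prim (\<lambda>\<tau>. U \<tau> x * V \<tau> x) \<tau>) has_real_derivative U t x * V t x) (at t)" for t x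
    by (auto intro!: derivative_eq_intros prim_has_derivative continuous_intros jc_time[OF jc_states(1)] jc_time[OF jc_states(4)])
qed (use assms jc_at[OF jc_g] in auto)

text \<open>The implication is kept for a second pass: at this point \<open>h\<close>,
  \<open>k\<close>, \<open>g\<close> and \<open>p2\<close> are only known to be continuous, and they
  become \<open>C^1\<close> in space once \<open>W\<close>, \<open>Z\<close> and \<open>q\<close>
  are.\<close>

lemma C1x_cfun: "\<exists>c' d'. C1x (cfun U V W Z q) c' \<and> C1x (dfun U V W Z q) d' \<and>
    (D1 h \<and> D1 k \<and> D1 g \<and> D1 p2 \<longrightarrow> D1 c' \<and> D1 d')"
proof -
  have D1P: "D1 P1f" "D1 P2f" "D1 dP1f" "D1 dP2f" "D1 U" "D1 V"
    using C1x_P C1x_U C1x_V unfolding D1_def by blast+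
  have two: "(2::real) \<noteq> 0" by simp
  note c = C1x_diff[OF C1x_mult[OF C1x_power[OF C1x_U, of 2] C1x_V] C1x_afun]
  show ?thesis
    unfolding cfun_def[abs_def] dfun_def[abs_def]
    by (rule exI, rule exI, rule conjI, rule C1x_diff[OF c C1x_divide[OF C1x_V two]],
        rule conjI, rule C1x_add[OF c C1x_divide[OF C1x_V two]], intro impI conjI D1_intros D1P) auto
qed

lemma ex_W1:
  obtains W1 where "C1x W W1" "D1 h \<and> D1 k \<and> D1 g \<and> D1 p2 \<longrightarrow> D1 W1"
proof -
  obtain c' d' where cd: "C1x (cfun U V W Z q) c'" "C1x (dfun U V W Z q) d'"
    and D: "D1 h \<and> D1 k \<and> D1 g \<and> D1 p2 \<longrightarrow> D1 c' \<and> D1 d'"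
    using C1x_cfun by blast
  obtain w0 w1 where w: "\<And>x. (W 0 has_real_derivative w0 x) (at x)" "\<And>x. (w0 has_real_derivative w1 x) (at x)"
      "continuous_on UNIV w1"
    using W0 unfolding C2_lipschitz_def by blast
  have cw: "continuous_on UNIV w0"
    using DERIV_continuous_on w(2) by blast
  note W1 = C1x_ode[OF cd jc_state(2) der_W w(1) cw]
  have "D1 (cfun U V W Z q)" "D1 (dfun U V W Z q)" "D1 W" "D1 (\<lambda>t x. w0 x)"
    using cd W1 C1x_space[OF w(2,3)] unfolding D1_def by blast+
  then show ?thesis
    using D by (intro that[OF W1] impI D1_intros) auto
qed

lemma D1_W: "D1 W"
  using ex_W1 unfolding D1_def by metis

lemma D1_Z: "D1 Z"
  by (rule flow.D1_W[OF swap])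

lemma D1_dfun: "D1 (dfun U V W Z q)"
  using C1x_cfun unfolding D1_def by blast

text \<open>The equation for \<open>q\<close> is linear in \<open>q\<close> and \<open>q\<close>
  starts at 1, so \<open>q\<close> is the exponential of a time integral of \<open>mfun\<close>,
  which involves only quantities already differentiable.\<close>

lemma D1_q: "D1 q"
proof -
  have "D1 mfun"
    by (intro D1_intros D1_W D1_Z D1_dfun flow.D1_dfun[OF swap])
  then have "D1 (\<lambda>t x. exp (prim (\<lambda>\<tau>. mfun \<tau> x) t))"
    by (rule D1_intros(10)[OF D1_intros(11)])
  moreover
  have "q t x = exp (prim (\<lambda>\<tau>. mfun \<tau> x) t)" for t x
  proof -
    have "((\<lambda>\<tau>. ln (q \<tau> x)) has_real_derivative mfun s x) (at s)" for s
      using DERIV_chain2[OF DERIV_ln[OF q_pos[of s x]] der_q[of x s]] q_pos[of s x]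
      by (simp add: mult.assoc[symmetric])
    from eq_prim[OF this, of t] have "ln (q t x) = prim (\<lambda>\<tau>. mfun \<tau> x) t"
      by (simp add: q0)
    then show ?thesis
      using q_pos[of t x] by (metis exp_ln)
  qed
  then have "q = (\<lambda>t x. exp (prim (\<lambda>\<tau>. mfun \<tau> x) t))"
    by blast
  ultimately show ?thesis by simp
qed

text \<open>The second pass: \<open>h\<close>, \<open>k\<close>, \<open>g\<close> and
  \<open>p2\<close> are smooth expressions in \<open>W\<close>, \<open>Z\<close>, \<open>q\<close>,
  so the premise of \<open>ex_W1\<close> is now available.\<close>

theorem W_twice_differentiable:
  obtains W1 W2 where "C1x W W1" "C1x W1 W2"
proof -
  obtain W1 where W1: "C1x W W1" and imp: "D1 h \<and> D1 k \<and> D1 g \<and> D1 p2 \<longrightarrow> D1 W1"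
    by (rule ex_W1)
  have "D1 h \<and> D1 k \<and> D1 g \<and> D1 p2"
    unfolding hdens_def[abs_def] gdens_def[abs_def] dens_p2_def[abs_def]
    by (intro conjI D1_intros D1_W D1_Z D1_q) auto
  with imp have "D1 W1" by (rule mp)
  then obtain W2 where "C1x W1 W2"
    unfolding D1_def by blast
  with W1 show ?thesis by (rule that)
qed

end

subsection \<open>Decay at infinity\<close>

text \<open>Otherwise there are points \<open>x n\<close> escaping to infinity with
  \<open>\<bar>f (x n)\<bar> \<ge> e\<close>. The Lipschitz bound keeps
  \<open>\<bar>f\<bar> \<ge> e / 2\<close> on an interval of length
  \<open>\<delta> = e / (2 C)\<close> next to each, so \<open>f^2\<close> retains a fixed mass
  there, while dominated convergence with majorant \<open>f^2\<close> sends this mass to 0.\<close>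

lemma lipschitz_square_integrable_decay:
  fixes f :: "real \<Rightarrow> real"
  assumes f: "square_integrable f" and lip: "\<And>x y. \<bar>f x - f y\<bar> \<le> C * \<bar>x - y\<bar>" and C: "C > 0" and e: "e > 0"
  shows "\<exists>R. \<forall>x. R < \<bar>x\<bar> \<longrightarrow> \<bar>f x\<bar> < e"
proof (rule ccontr)
  assume "\<not> ?thesis"
  then have "\<forall>n::nat. \<exists>x. real n < \<bar>x\<bar> \<and> e \<le> \<bar>f x\<bar>"
    by (meson not_le)
  then obtain x where x: "\<And>n::nat. real n < \<bar>x n\<bar>" "\<And>n. e \<le> \<bar>f (x n)\<bar>"
    by metis
  define \<delta> where "\<delta> = e / (2 * C)"
  have \<delta>: "\<delta> > 0" using e C by (simp add: \<delta>_def)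
  have [measurable]: "f \<in> borel_measurable borel" and i: "integrable lborel (\<lambda>s. (f s)\<^sup>2)"
    using f by (auto simp: square_integrable_def)
  have "(\<lambda>n. LINT s|lborel. indicator {x n..x n + \<delta>} s * (f s)\<^sup>2) \<longlonglongrightarrow> integral\<^sup>L lborel (\<lambda>s::real. 0)"
  proof (rule integral_dominated_convergence[where w = "\<lambda>s. (f s)\<^sup>2"])
    show "integrable lborel (\<lambda>s. (f s)\<^sup>2)" by (rule i)
    have "eventually (\<lambda>n. indicator {x n..x n + \<delta>} s * (f s)\<^sup>2 = 0) sequentially" for s
    proof -
      obtain N :: nat where N: "\<bar>s\<bar> + \<delta> < real N"
        using reals_Archimedean2 by blast
      have "indicator {x n..x n + \<delta>} s * (f s)\<^sup>2 = 0" if "n \<ge> N" for n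
      proof -
        have "\<bar>s\<bar> + \<delta> < \<bar>x n\<bar>"
          using N x(1)[of n] that by linarith
        then show ?thesis
          by (auto simp: indicator_def)
      qed
      then show ?thesis
        by (auto simp: eventually_sequentially)
    qed
    then show "AE s in lborel. (\<lambda>n. indicator {x n..x n + \<delta>} s * (f s)\<^sup>2) \<longlonglongrightarrow> 0"
      by (intro AE_I2 tendsto_eventually)
    show "AE s in lborel. norm (indicator {x n..x n + \<delta>} s * (f s)\<^sup>2) \<le> (f s)\<^sup>2" for n
      by (intro AE_I2) (auto simp: indicator_def)
  qed auto
  moreover have "\<delta> * (e / 2)\<^sup>2 \<le> (LINT s|lborel. indicator {x n..x n + \<delta>} s * (f s)\<^sup>2)" for n
  proof -
    have "(LINT s|lborel. indicator {x n..x n + \<delta>} s * (e / 2)\<^sup>2) \<le>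
        (LINT s|lborel. indicator {x n..x n + \<delta>} s * (f s)\<^sup>2)"
    proof (rule integral_mono)
      show "integrable lborel (\<lambda>s. indicator {x n..x n + \<delta>} s * (e / 2)\<^sup>2)"
        using \<delta> by (intro integrable_mult_left) (auto intro!: integrable_real_indicator)
      show "integrable lborel (\<lambda>s. indicator {x n..x n + \<delta>} s * (f s)\<^sup>2)"
        using integrable_mult_indicator[OF _ i, of "{x n..x n + \<delta>}"] by simp
      fix s
      show "indicator {x n..x n + \<delta>} s * (e / 2)\<^sup>2 \<le> indicator {x n..x n + \<delta>} s * (f s)\<^sup>2"
      proof (cases "s \<in> {x n..x n + \<delta>}")
        case True
        then have "C * \<bar>s - x n\<bar> \<le> C * \<delta>"
          using C by (intro mult_left_mono) auto
        also have "\<dots> = e / 2"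
          using C by (simp add: \<delta>_def)
        finally have "e / 2 \<le> \<bar>f s\<bar>"
          using lip[of s "x n"] x(2)[of n] by linarith
        then have "(e / 2)\<^sup>2 \<le> \<bar>f s\<bar>\<^sup>2"
          using e by (intro power_mono) auto
        then show ?thesis by (simp add: indicator_def)
      qed simp
    qed
    then show ?thesis using \<delta> by simp
  qed
  ultimately have "\<delta> * (e / 2)\<^sup>2 \<le> 0"
    by (intro tendsto_lowerbound[where F = sequentially]) auto
  then show False
    using \<delta> e by (simp add: mult_le_0_iff)
qed

text \<open>Decay to \<open>e / 2\<close> at finitely many times suffices: within the spacing
  \<open>\<rho> = e / (2 L)\<close> the value changes by at most \<open>e / 2\<close>.\<close>

lemma uniform_decay:
  assumes sq: "\<And>t. square_integrable (f t)" and lip: "llip f" and T: "T > 0" and e: "e > 0"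
    and tl: "L > 0" "\<And>s t x. s \<in> {-T..T} \<Longrightarrow> t \<in> {-T..T} \<Longrightarrow> \<bar>f s x - f t x\<bar> \<le> L * \<bar>s - t\<bar>"
  shows "\<exists>R. \<forall>t\<in>{-T..T}. \<forall>x. R < \<bar>x\<bar> \<longrightarrow> \<bar>f t x\<bar> < e"
proof -
  obtain C where C: "C > 0" "\<And>t x y. t \<in> {-T..T} \<Longrightarrow> \<bar>f t x - f t y\<bar> \<le> C * \<bar>x - y\<bar>"
    using llip_pos[OF lip T] by blast
  have "\<exists>R. \<forall>x. R < \<bar>x\<bar> \<longrightarrow> \<bar>f t x\<bar> < e / 2" if "t \<in> {-T..T}" for t
    by (rule lipschitz_square_integrable_decay[OF sq C(2)[OF that] C(1)]) (use e in auto)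
  then obtain R where R: "\<And>t x. t \<in> {-T..T} \<Longrightarrow> R t < \<bar>x\<bar> \<Longrightarrow> \<bar>f t x\<bar> < e / 2"
    by metis
  define \<rho> where "\<rho> = e / (2 * L)"
  have \<rho>: "\<rho> > 0" using e tl(1) by (simp add: \<rho>_def)
  have "compact {-T..T}" by simp
  then obtain S where S: "S \<subseteq> {-T..T}" "finite S" "{-T..T} \<subseteq> (\<Union>s\<in>S. ball s \<rho>)"
    by (rule compactE_image[where C = "{-T..T}" and f = "\<lambda>s. ball s \<rho>"]) (use \<rho> in auto)
  have "\<bar>f t x\<bar> < e" if t: "t \<in> {-T..T}" and x: "Max (insert 0 (R ` S)) < \<bar>x\<bar>" for t x
  proof -
    obtain s where s: "s \<in> S" "\<bar>s - t\<bar> < \<rho>"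
      using S(3) t by (auto simp: dist_real_def)
    have "R s < \<bar>x\<bar>"
      using x s S(2) by (simp add: Max_less_iff)
    then have "\<bar>f s x\<bar> < e / 2"
      using R s S(1) by blast
    moreover have "L * \<bar>t - s\<bar> \<le> L * \<rho>"
      using s tl(1) by (intro mult_left_mono) auto
    then have "\<bar>f t x - f s x\<bar> \<le> e / 2"
      using tl(2)[OF t, of s x] s S(1) tl(1) by (auto simp: \<rho>_def)
    ultimately show ?thesis by linarith
  qed
  then show ?thesis by blast
qed

subsection \<open>Sublevel sets\<close>

lemma Icc_fmeasurable [simp, intro]: "{a..b::real} \<in> fmeasurable lborel"
  by (simp add: fmeasurable_def emeasure_lborel_Icc_eq)

text \<open>Values on \<open>X\<close> differ by less than \<open>2 \<epsilon>\<close>, so the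
  expansion confines \<open>X\<close> to distance \<open>2 \<epsilon> / c\<close> from any one of
  its points.\<close>

lemma measure_le_of_expanding:
  fixes f :: "real \<Rightarrow> real"
  assumes X: "X \<in> sets borel" and f: "\<And>x. x \<in> X \<Longrightarrow> \<bar>f x\<bar> < \<epsilon>"
    and c: "c > 0" "\<And>x y. x \<in> X \<Longrightarrow> y \<in> X \<Longrightarrow> c * \<bar>x - y\<bar> \<le> \<bar>f x - f y\<bar>" and \<epsilon>: "\<epsilon> > 0"
  shows "measure lborel X \<le> 4 * \<epsilon> / c"
proof (cases "X = {}")
  case False
  then obtain x0 where x0: "x0 \<in> X" by blast
  have "X \<subseteq> {x0 - 2 * \<epsilon> / c..x0 + 2 * \<epsilon> / c}"
  proof
    fix x assume x: "x \<in> X"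
    have "c * \<bar>x - x0\<bar> \<le> 2 * \<epsilon>"
      using c(2)[OF x x0] f[OF x] f[OF x0] by linarith
    then have "\<bar>x - x0\<bar> \<le> 2 * \<epsilon> / c"
      using c(1) by (simp add: field_simps)
    then show "x \<in> {x0 - 2 * \<epsilon> / c..x0 + 2 * \<epsilon> / c}"
      by (auto simp: abs_le_iff)
  qed
  then have "measure lborel X \<le> measure lborel {x0 - 2 * \<epsilon> / c..x0 + 2 * \<epsilon> / c}"
    by (intro measure_mono_fmeasurable) (use X in auto)
  also have "\<dots> = 4 * \<epsilon> / c"
    using c(1) \<epsilon> by (simp add: divide_nonneg_pos)
  finally show ?thesis .
qed (use c \<epsilon> in simp)

lemma sublevel_first_order:
  fixes f :: "real \<Rightarrow> real"
  assumes f: "\<And>x. (f has_real_derivative f1 x) (at x)" and c: "c > 0" "\<And>x. x \<in> {a..b} \<Longrightarrow> c \<le> \<bar>f1 x\<bar>"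
    and \<epsilon>: "\<epsilon> > 0"
  shows "measure lborel {x\<in>{a..b}. \<bar>f x\<bar> < \<epsilon>} \<le> 4 * \<epsilon> / c"
proof (rule measure_le_of_expanding[where f = f])
  have [measurable]: "f \<in> borel_measurable borel"
    by (intro borel_measurable_continuous_onI derivative_imp_continuous[OF f])
  show "{x\<in>{a..b}. \<bar>f x\<bar> < \<epsilon>} \<in> sets borel"
    by measurable
  have *: "c * \<bar>x - y\<bar> \<le> \<bar>f x - f y\<bar>" if "x < y" "x \<in> {a..b}" "y \<in> {a..b}" for x y
  proof -
    obtain z where z: "x < z" "z < y" "f y - f x = (y - x) * f1 z"
      using MVT2[OF \<open>x < y\<close>, of f f1] f by blast
    have "c * \<bar>y - x\<bar> \<le> \<bar>f1 z\<bar> * \<bar>y - x\<bar>"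
      using z that by (intro mult_right_mono c(2)) auto
    moreover have "\<bar>f x - f y\<bar> = \<bar>(y - x) * f1 z\<bar>"
      unfolding z(3)[symmetric] by (rule abs_minus_commute)
    ultimately show ?thesis
      by (simp add: abs_mult abs_minus_commute mult.commute)
  qed
  show "c * \<bar>x - y\<bar> \<le> \<bar>f x - f y\<bar>" if "x \<in> {x\<in>{a..b}. \<bar>f x\<bar> < \<epsilon>}" "y \<in> {x\<in>{a..b}. \<bar>f x\<bar> < \<epsilon>}" for x y
    using *[of x y] *[of y x] that by (cases x y rule: linorder_cases) (auto simp: abs_minus_commute)
qed (use c \<epsilon> in auto)

text \<open>Cut at slope \<open>\<delta> = sqrt \<epsilon>\<close>. The set
  \<open>\<bar>f1\<bar> < \<delta>\<close> is controlled by the first-order estimate for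
  \<open>f1\<close>. As \<open>f1\<close> is increasing, a slope of at least \<open>\<delta>\<close>
  persists to the right and one of at most \<open>- \<delta>\<close> to the left, so
  \<open>f\<close> expands at rate \<open>\<delta>\<close> on each remaining part, whose measure is
  at most \<open>4 \<epsilon> / \<delta> = 4 \<delta>\<close>.\<close>

lemma sublevel_second_order:
  fixes f :: "real \<Rightarrow> real"
  assumes f: "\<And>x. (f has_real_derivative f1 x) (at x)" and f1: "\<And>x. (f1 has_real_derivative f2 x) (at x)"
    and c: "c > 0" "\<And>x. x \<in> {a..b} \<Longrightarrow> c \<le> f2 x" and \<epsilon>: "\<epsilon> > 0"
  shows "measure lborel {x\<in>{a..b}. \<bar>f x\<bar> < \<epsilon>} \<le> (4 / c + 8) * sqrt \<epsilon>"
proof -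
  define \<delta> where "\<delta> = sqrt \<epsilon>"
  have \<delta>: "\<delta> > 0" "\<delta> * \<delta> = \<epsilon>" using \<epsilon> by (auto simp: \<delta>_def)
  have [measurable]: "f \<in> borel_measurable borel" "f1 \<in> borel_measurable borel"
    by (intro borel_measurable_continuous_onI derivative_imp_continuous[OF f] derivative_imp_continuous[OF f1])+
  have mono: "f1 x \<le> f1 y" if "x \<le> y" "x \<in> {a..b}" "y \<in> {a..b}" for x y
  proof (rule DERIV_nonneg_imp_nondecreasing[OF \<open>x \<le> y\<close>])
    fix z assume "x \<le> z" "z \<le> y"
    then show "\<exists>d. (f1 has_real_derivative d) (at z) \<and> 0 \<le> d"
      using f1[of z] c(1) c(2)[of z] that by fastforce
  qed
  define X1 where "X1 = {x\<in>{a..b}. \<bar>f1 x\<bar> < \<delta>}"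
  define X2 where "X2 = {x\<in>{a..b}. \<bar>f x\<bar> < \<epsilon> \<and> \<delta> \<le> f1 x}"
  define X3 where "X3 = {x\<in>{a..b}. \<bar>f x\<bar> < \<epsilon> \<and> f1 x \<le> - \<delta>}"
  have sets: "X1 \<in> sets borel" "X2 \<in> sets borel" "X3 \<in> sets borel"
    unfolding X1_def X2_def X3_def by measurable
  have *: "\<delta> * \<bar>x - y\<bar> \<le> \<bar>f x - f y\<bar>"
    if "x < y" "x \<in> {a..b}" "y \<in> {a..b}" "\<delta> \<le> f1 x \<or> f1 y \<le> - \<delta>" for x y
  proof -
    obtain z where z: "x < z" "z < y" "f y - f x = (y - x) * f1 z"
      using MVT2[OF \<open>x < y\<close>, of f f1] f by blast
    have "\<delta> \<le> \<bar>f1 z\<bar>"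
      using mono[of x z] mono[of z y] z that by auto
    then have "\<delta> * \<bar>y - x\<bar> \<le> \<bar>f1 z\<bar> * \<bar>y - x\<bar>"
      by (intro mult_right_mono) auto
    moreover have "\<bar>f x - f y\<bar> = \<bar>(y - x) * f1 z\<bar>"
      unfolding z(3)[symmetric] by (rule abs_minus_commute)
    ultimately show ?thesis
      by (simp add: abs_mult abs_minus_commute mult.commute)
  qed
  have "measure lborel X1 \<le> 4 * \<delta> / c"
    unfolding X1_def by (rule sublevel_first_order[OF f1 c(1) _ \<delta>(1)]) (use c in force)
  moreover have "measure lborel X2 \<le> 4 * \<epsilon> / \<delta>"
  proof (rule measure_le_of_expanding[where f = f, OF sets(2) _ \<delta>(1) _ \<epsilon>])
    show "\<delta> * \<bar>x - y\<bar> \<le> \<bar>f x - f y\<bar>" if "x \<in> X2" "y \<in> X2" for x y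
      using *[of x y] *[of y x] that unfolding X2_def
      by (cases x y rule: linorder_cases) (auto simp: abs_minus_commute)
  qed (auto simp: X2_def)
  moreover have "measure lborel X3 \<le> 4 * \<epsilon> / \<delta>"
  proof (rule measure_le_of_expanding[where f = f, OF sets(3) _ \<delta>(1) _ \<epsilon>])
    show "\<delta> * \<bar>x - y\<bar> \<le> \<bar>f x - f y\<bar>" if "x \<in> X3" "y \<in> X3" for x y
      using *[of x y] *[of y x] that unfolding X3_def
      by (cases x y rule: linorder_cases) (auto simp: abs_minus_commute)
  qed (auto simp: X3_def)
  moreover have fm: "X1 \<in> fmeasurable lborel" "X2 \<in> fmeasurable lborel" "X3 \<in> fmeasurable lborel"
    by (rule fmeasurableI2[of "{a..b}"]; use sets in \<open>auto simp: X1_def X2_def X3_def\<close>)+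
  have "measure lborel {x\<in>{a..b}. \<bar>f x\<bar> < \<epsilon>} \<le> measure lborel (X1 \<union> X2 \<union> X3)"
  proof (rule measure_mono_fmeasurable)
    show "{x\<in>{a..b}. \<bar>f x\<bar> < \<epsilon>} \<subseteq> X1 \<union> X2 \<union> X3"
      by (auto simp: X1_def X2_def X3_def)
    show "{x\<in>{a..b}. \<bar>f x\<bar> < \<epsilon>} \<in> sets lborel" by measurable
  qed (use fm in \<open>auto intro: fmeasurable.Un\<close>)
  moreover have "measure lborel (X1 \<union> X2 \<union> X3) \<le> measure lborel X1 + measure lborel X2 + measure lborel X3"
    using measure_Un_le[of "X1 \<union> X2" lborel X3] measure_Un_le[of X1 lborel X2] sets by simp
  ultimately have "measure lborel {x\<in>{a..b}. \<bar>f x\<bar> < \<epsilon>} \<le> 4 * \<delta> / c + 4 * \<epsilon> / \<delta> + 4 * \<epsilon> / \<delta>"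
    by linarith
  also have "4 * \<epsilon> / \<delta> = 4 * \<delta>"
    using \<delta> by (simp add: field_simps)
  finally show ?thesis
    by (simp add: \<delta>_def algebra_simps)
qed

lemma jc_pos_near:
  assumes "jc f" "f t0 x0 > 0"
  obtains r where "r > 0" "\<And>t x. \<bar>t - t0\<bar> < r \<Longrightarrow> x \<in> {x0 - r..x0 + r} \<Longrightarrow> f t x \<ge> f t0 x0 / 2"
proof -
  obtain d where d: "d > 0" "\<And>z. dist z (t0, x0) < d \<Longrightarrow> dist (f (fst z) (snd z)) (f t0 x0) < f t0 x0 / 2"
    using assms unfolding jc_def continuous_on_iff by (metis UNIV_I fst_conv half_gt_zero snd_conv)
  show ?thesis
  proof (rule that[of "d / 3"])
    fix t x assume *: "\<bar>t - t0\<bar> < d / 3" "x \<in> {x0 - d / 3..x0 + d / 3}"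
    have "dist (t, x) (t0, x0) \<le> dist t t0 + dist x x0"
      unfolding dist_Pair_Pair by (rule real_sqrt_sum_squares_triangle_ineq[THEN order_trans] | rule sqrt_sum_squares_le_sum; simp)+
    also have "\<bar>x - x0\<bar> \<le> d / 3"
      using *(2) unfolding atLeastAtMost_iff by linarith
    then have "dist t t0 + dist x x0 < d"
      using *(1) d(1) by (simp add: dist_real_def)
    finally have "\<bar>f t x - f t0 x0\<bar> < f t0 x0 / 2"
      using d(2)[of "(t, x)"] by (simp add: dist_real_def)
    then show "f t x \<ge> f t0 x0 / 2"
      by linarith
  qed (use d in simp)
qed

text \<open>One of \<open>\<phi>\<close>, \<open>\<phi>1\<close>, \<open>\<phi>2\<close> is nonzero
  at the point and, by joint continuity, stays away from zero at nearby times too; this makes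
  \<open>C\<close> independent of \<open>t\<close>. The restriction \<open>\<epsilon> < 1\<close>
  lets the linear bound near a simple zero be absorbed into \<open>sqrt \<epsilon>\<close>.\<close>

lemma sublevel_local:
  assumes 1: "C1x \<phi> \<phi>1" and 2: "C1x \<phi>1 \<phi>2" and nd: "\<phi> t0 x0 = 0 \<Longrightarrow> \<phi>1 t0 x0 = 0 \<Longrightarrow> \<phi>2 t0 x0 \<noteq> 0"
  shows "\<exists>r>0. \<exists>C>0. \<forall>t \<epsilon>. \<bar>t - t0\<bar> < r \<longrightarrow> 0 < \<epsilon> \<longrightarrow> \<epsilon> < 1 \<longrightarrow>
    measure lborel {x\<in>{x0 - r..x0 + r}. \<bar>\<phi> t x\<bar> < \<epsilon>} \<le> C * sqrt \<epsilon>"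
proof -
  note jcs = C1xD(1,2)[OF 1] C1xD(2)[OF 2]
  have pos: "\<exists>r>0. \<exists>m>0. \<forall>t x. \<bar>t - t0\<bar> < r \<longrightarrow> x \<in> {x0 - r..x0 + r} \<longrightarrow> m \<le> \<bar>f t x\<bar>"
    if f: "jc f" "f t0 x0 \<noteq> 0" for f
  proof -
    have "jc (\<lambda>t x. (f t x)\<^sup>2)" by (intro jc_intros f)
    then obtain r where r: "r > 0"
      "\<And>t x. \<bar>t - t0\<bar> < r \<Longrightarrow> x \<in> {x0 - r..x0 + r} \<Longrightarrow> (f t x)\<^sup>2 \<ge> (f t0 x0)\<^sup>2 / 2"
      by (rule jc_pos_near[of _ t0 x0]) (use f in auto)
    have "sqrt ((f t0 x0)\<^sup>2 / 2) \<le> \<bar>f t x\<bar>" if "\<bar>t - t0\<bar> < r" "x \<in> {x0 - r..x0 + r}" for t x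
      using real_sqrt_le_mono[OF r(2)[OF that]] by simp
    moreover have "sqrt ((f t0 x0)\<^sup>2 / 2) > 0" using f by simp
    ultimately show ?thesis using r(1) by blast
  qed
  consider "\<phi> t0 x0 \<noteq> 0" | "\<phi>1 t0 x0 \<noteq> 0" | "\<phi>2 t0 x0 > 0" | "- \<phi>2 t0 x0 > 0"
    using nd by linarith
  then show ?thesis
  proof cases
    case 1
    then obtain r m where r: "r > 0" "m > 0" "\<And>t x. \<bar>t - t0\<bar> < r \<Longrightarrow> x \<in> {x0 - r..x0 + r} \<Longrightarrow> m \<le> \<bar>\<phi> t x\<bar>"
      using pos[OF jcs(1)] by blast
    \<comment> \<open>For \<open>\<epsilon> \<le> m\<close> the sublevel set is empty; the constant
      is chosen so that at \<open>\<epsilon> = m\<close> the bound is the full length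
      \<open>2 r\<close>.\<close>
    have "measure lborel {x\<in>{x0 - r..x0 + r}. \<bar>\<phi> t x\<bar> < \<epsilon>} \<le> 2 * r / sqrt m * sqrt \<epsilon>"
      if t: "\<bar>t - t0\<bar> < r" and \<epsilon>: "0 < \<epsilon>" for t \<epsilon>
    proof (cases "\<epsilon> \<le> m")
      case True
      then have "{x\<in>{x0 - r..x0 + r}. \<bar>\<phi> t x\<bar> < \<epsilon>} = {}"
        using r(3)[OF t] by force
      then show ?thesis
        using r(1,2) \<epsilon> by (simp only: measure_empty) simp
    next
      case False
      have [measurable]: "\<phi> t \<in> borel_measurable borel"
        by (intro borel_measurable_continuous_onI jc_at jcs)
      have "measure lborel {x\<in>{x0 - r..x0 + r}. \<bar>\<phi> t x\<bar> < \<epsilon>} \<le> measure lborel {x0 - r..x0 + r}"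
        by (rule measure_mono_fmeasurable) auto
      also have "\<dots> = 2 * r / sqrt m * sqrt m"
        using r by simp
      also have "\<dots> \<le> 2 * r / sqrt m * sqrt \<epsilon>"
        using False r by (intro mult_left_mono) auto
      finally show ?thesis .
    qed
    then show ?thesis
      using r by (intro exI[of _ r] conjI exI[of _ "2 * r / sqrt m"]) auto
  next
    case 2
    then obtain r m where r: "r > 0" "m > 0" "\<And>t x. \<bar>t - t0\<bar> < r \<Longrightarrow> x \<in> {x0 - r..x0 + r} \<Longrightarrow> m \<le> \<bar>\<phi>1 t x\<bar>"
      using pos[OF jcs(2)] by blast
    have "measure lborel {x\<in>{x0 - r..x0 + r}. \<bar>\<phi> t x\<bar> < \<epsilon>} \<le> 4 / m * sqrt \<epsilon>"
      if t: "\<bar>t - t0\<bar> < r" and \<epsilon>: "0 < \<epsilon>" "\<epsilon> < 1" for t \<epsilon>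
    proof -
      have "measure lborel {x\<in>{x0 - r..x0 + r}. \<bar>\<phi> t x\<bar> < \<epsilon>} \<le> 4 * \<epsilon> / m"
        by (rule sublevel_first_order[OF C1xD(3)[OF \<open>C1x \<phi> \<phi>1\<close>] r(2) r(3)[OF t] \<epsilon>(1)])
      also have "\<dots> \<le> 4 * sqrt \<epsilon> / m"
      proof -
        have "sqrt \<epsilon> * sqrt \<epsilon> \<le> sqrt \<epsilon> * 1"
          using \<epsilon> by (intro mult_left_mono) auto
        then have "\<epsilon> \<le> sqrt \<epsilon>" using \<epsilon> by simp
        then show ?thesis using r by (intro divide_right_mono) auto
      qed
      finally show ?thesis by simp
    qed
    then show ?thesis
      using r by (intro exI[of _ r] conjI exI[of _ "4 / m"]) auto
  next
    case 3
    then obtain r where r: "r > 0"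
      "\<And>t x. \<bar>t - t0\<bar> < r \<Longrightarrow> x \<in> {x0 - r..x0 + r} \<Longrightarrow> \<phi>2 t x \<ge> \<phi>2 t0 x0 / 2"
      using jc_pos_near[of \<phi>2 t0 x0, OF jcs(3)] by blast
    have "measure lborel {x\<in>{x0 - r..x0 + r}. \<bar>\<phi> t x\<bar> < \<epsilon>} \<le> (4 / (\<phi>2 t0 x0 / 2) + 8) * sqrt \<epsilon>"
      if t: "\<bar>t - t0\<bar> < r" and \<epsilon>: "0 < \<epsilon>" for t \<epsilon>
      by (rule sublevel_second_order[OF C1xD(3)[OF \<open>C1x \<phi> \<phi>1\<close>] C1xD(3)[OF \<open>C1x \<phi>1 \<phi>2\<close>] _ r(2)[OF t] \<epsilon>])
        (use 3 in simp)
    then show ?thesis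
      using r 3 by (intro exI[of _ r] conjI exI[of _ "4 / (\<phi>2 t0 x0 / 2) + 8"]) (auto intro!: add_pos_pos divide_pos_pos)
  next
    case 4
    have m: "C1x (\<lambda>t x. - \<phi> t x) (\<lambda>t x. - \<phi>1 t x)" "C1x (\<lambda>t x. - \<phi>1 t x) (\<lambda>t x. - \<phi>2 t x)"
      using 1 2 by (intro C1x_intros; simp)+
    obtain r where r: "r > 0"
      "\<And>t x. \<bar>t - t0\<bar> < r \<Longrightarrow> x \<in> {x0 - r..x0 + r} \<Longrightarrow> - \<phi>2 t x \<ge> - \<phi>2 t0 x0 / 2"
      using jc_pos_near[of "\<lambda>t x. - \<phi>2 t x" t0 x0, OF C1xD(2)[OF m(2)] 4] by blast
    have "measure lborel {x\<in>{x0 - r..x0 + r}. \<bar>- \<phi> t x\<bar> < \<epsilon>} \<le> (4 / (- \<phi>2 t0 x0 / 2) + 8) * sqrt \<epsilon>"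
      if t: "\<bar>t - t0\<bar> < r" and \<epsilon>: "0 < \<epsilon>" for t \<epsilon>
      by (rule sublevel_second_order[OF C1xD(3)[OF m(1)] C1xD(3)[OF m(2)] _ r(2)[OF t] \<epsilon>])
        (use 4 in simp)
    moreover have "4 / (- \<phi>2 t0 x0 / 2) + 8 > 0"
      using 4 by (intro add_pos_pos divide_pos_pos) auto
    ultimately show ?thesis
      using r by (intro exI[of _ r] conjI exI[of _ "4 / (- \<phi>2 t0 x0 / 2) + 8"]) auto
  qed
qed

lemma sublevel_compact:
  assumes 1: "C1x \<phi> \<phi>1" and 2: "C1x \<phi>1 \<phi>2"
    and nd: "\<And>t x. t \<in> {-T..T} \<Longrightarrow> \<phi> t x = 0 \<Longrightarrow> \<phi>1 t x = 0 \<Longrightarrow> \<phi>2 t x \<noteq> 0"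
  shows "\<exists>C>0. \<forall>t\<in>{-T..T}. \<forall>\<epsilon>. 0 < \<epsilon> \<longrightarrow> \<epsilon> < 1 \<longrightarrow> measure lborel {x\<in>{-R..R}. \<bar>\<phi> t x\<bar> < \<epsilon>} \<le> C * sqrt \<epsilon>"
proof -
  define K where "K = {-T..T} \<times> {-R..R}"
  have "\<forall>p\<in>K. \<exists>r C. r > 0 \<and> C > 0 \<and> (\<forall>t \<epsilon>. \<bar>t - fst p\<bar> < r \<longrightarrow> 0 < \<epsilon> \<longrightarrow> \<epsilon> < 1 \<longrightarrow>
    measure lborel {x\<in>{snd p - r..snd p + r}. \<bar>\<phi> t x\<bar> < \<epsilon>} \<le> C * sqrt \<epsilon>)"
  proof
    fix p assume "p \<in> K"
    then have "fst p \<in> {-T..T}" by (auto simp: K_def)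
    from sublevel_local[OF 1 2 nd[OF this]]
    show "\<exists>r C. r > 0 \<and> C > 0 \<and> (\<forall>t \<epsilon>. \<bar>t - fst p\<bar> < r \<longrightarrow> 0 < \<epsilon> \<longrightarrow> \<epsilon> < 1 \<longrightarrow>
      measure lborel {x\<in>{snd p - r..snd p + r}. \<bar>\<phi> t x\<bar> < \<epsilon>} \<le> C * sqrt \<epsilon>)"
      by blast
  qed
  from bchoice[OF this] obtain r where "\<forall>p\<in>K. \<exists>C. r p > 0 \<and> C > 0 \<and> (\<forall>t \<epsilon>. \<bar>t - fst p\<bar> < r p \<longrightarrow> 0 < \<epsilon> \<longrightarrow> \<epsilon> < 1 \<longrightarrow>
    measure lborel {x\<in>{snd p - r p..snd p + r p}. \<bar>\<phi> t x\<bar> < \<epsilon>} \<le> C * sqrt \<epsilon>)"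
    by blast
  from bchoice[OF this] obtain C where rC: "\<And>p. p \<in> K \<Longrightarrow> r p > 0" "\<And>p. p \<in> K \<Longrightarrow> C p > (0::real)"
    "\<And>p t \<epsilon>. p \<in> K \<Longrightarrow> \<bar>t - fst p\<bar> < r p \<Longrightarrow> 0 < \<epsilon> \<Longrightarrow> \<epsilon> < 1 \<Longrightarrow>
      measure lborel {x\<in>{snd p - r p..snd p + r p}. \<bar>\<phi> t x\<bar> < \<epsilon>} \<le> C p * sqrt \<epsilon>"
    by blast
  have "compact K" unfolding K_def by (intro compact_Times) auto
  then obtain S where S: "S \<subseteq> K" "finite S" "K \<subseteq> (\<Union>p\<in>S. ball (fst p) (r p) \<times> ball (snd p) (r p))"
    by (rule compactE_image[where C = K and f = "\<lambda>p. ball (fst p) (r p) \<times> ball (snd p) (r p)"])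
      (use rC(1) in \<open>auto intro!: open_Times\<close>)
  \<comment> \<open>The summand 1 keeps the constant positive when \<open>S\<close> is empty, as
    happens for \<open>R < 0\<close>.\<close>
  have "measure lborel {x\<in>{-R..R}. \<bar>\<phi> t x\<bar> < \<epsilon>} \<le> (1 + (\<Sum>p\<in>S. C p)) * sqrt \<epsilon>"
    if t: "t \<in> {-T..T}" and \<epsilon>: "0 < \<epsilon>" "\<epsilon> < 1" for t \<epsilon>
  proof -
    have [measurable]: "\<phi> t \<in> borel_measurable borel"
      by (intro borel_measurable_continuous_onI jc_at C1xD(1)[OF 1])
    \<comment> \<open>At a given \<open>t\<close> only those centres whose time ball contains
      \<open>t\<close> offer an estimate, and they already cover the slice.\<close>
    define S' where "S' = {p\<in>S. \<bar>t - fst p\<bar> < r p}"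
    define X where "X p = {x\<in>{snd p - r p..snd p + r p}. \<bar>\<phi> t x\<bar> < \<epsilon>}" for p
    have X: "X p \<in> fmeasurable lborel" for p
      unfolding X_def by (rule fmeasurableI2[of "{snd p - r p..snd p + r p}"]) auto
    have sub: "{x\<in>{-R..R}. \<bar>\<phi> t x\<bar> < \<epsilon>} \<subseteq> (\<Union>p\<in>S'. X p)"
    proof
      fix x assume x: "x \<in> {x\<in>{-R..R}. \<bar>\<phi> t x\<bar> < \<epsilon>}"
      then have "(t, x) \<in> K" using t by (simp add: K_def)
      then obtain p where "p \<in> S" "\<bar>fst p - t\<bar> < r p" "\<bar>snd p - x\<bar> < r p"
        using S(3) by (force simp: dist_real_def)
      then have "p \<in> S'" "x \<in> X p" using x by (auto simp: S'_def X_def)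
      then show "x \<in> (\<Union>p\<in>S'. X p)" by blast
    qed
    have S': "finite S'" "S' \<subseteq> S" using S(2) by (auto simp: S'_def)
    have "measure lborel {x\<in>{-R..R}. \<bar>\<phi> t x\<bar> < \<epsilon>} \<le> measure lborel (\<Union>p\<in>S'. X p)"
      by (rule measure_mono_fmeasurable[OF sub]) (use X S' in \<open>auto intro!: fmeasurable.finite_UN\<close>)
    also have "\<dots> \<le> (\<Sum>p\<in>S'. measure lborel (X p))"
      using S' X by (intro measure_UNION_le) (auto simp: fmeasurable_def)
    also have "\<dots> \<le> (\<Sum>p\<in>S'. C p * sqrt \<epsilon>)"
      unfolding X_def using S(1) \<epsilon> by (intro sum_mono rC(3)) (auto simp: S'_def)
    also have "\<dots> \<le> (\<Sum>p\<in>S. C p * sqrt \<epsilon>)"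
      using S(1,2) S' rC(2) \<epsilon> by (intro sum_mono2) (auto intro!: mult_nonneg_nonneg less_imp_le)
    also have "\<dots> \<le> (1 + (\<Sum>p\<in>S. C p)) * sqrt \<epsilon>"
      using \<epsilon> by (simp add: sum_distrib_right[symmetric] distrib_right)
    finally show ?thesis .
  qed
  moreover have "1 + (\<Sum>p\<in>S. C p) > 0"
    using S(1) rC(2) by (intro add_pos_nonneg sum_nonneg) (auto intro: less_imp_le)
  ultimately show ?thesis by blast
qed

subsection \<open>From sublevel estimates to Hoelder continuity\<close>

text \<open>\<open>f b - f a\<close> is the integral of \<open>h\<close>. The bad set
  \<open>\<bar>\<phi>\<bar> < \<epsilon>\<close> contributes at most \<open>\<kappa>\<close> times
  its measure, and \<open>far\<close> confines it to the interval where \<open>near\<close> measures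
  it; the rest contributes at most the integral of \<open>g / \<epsilon>\<close>, that is, the
  increment of \<open>y\<close> over \<open>\<epsilon>\<close>.\<close>

lemma increment_bound:
  fixes f y h g \<phi> :: "real \<Rightarrow> real"
  assumes f: "\<And>x. (f has_real_derivative h x) (at x)" and h: "continuous_on UNIV h"
    and y: "\<And>x. (y has_real_derivative g x) (at x)" and g: "continuous_on UNIV g"
    and [measurable]: "\<phi> \<in> borel_measurable borel"
    and far: "\<And>x. R < \<bar>x\<bar> \<Longrightarrow> \<epsilon> \<le> \<bar>\<phi> x\<bar>" and near: "measure lborel {x\<in>{-R..R}. \<bar>\<phi> x\<bar> < \<epsilon>} \<le> m"
    and bound: "\<And>x. \<bar>h x\<bar> \<le> (if \<bar>\<phi> x\<bar> < \<epsilon> then \<kappa> else 0) + g x / \<epsilon>"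
    and \<kappa>: "\<kappa> \<ge> 0" and ab: "a \<le> b"
  shows "\<bar>f b - f a\<bar> \<le> \<kappa> * m + (y b - y a) / \<epsilon>"
proof -
  define S where "S = {x\<in>{-R..R}. \<bar>\<phi> x\<bar> < \<epsilon>}"
  have S: "S \<in> sets borel" unfolding S_def by measurable
  have eS: "emeasure lborel S < \<infinity>"
  proof -
    have "emeasure lborel S \<le> emeasure lborel {-R..R}"
      by (rule emeasure_mono) (auto simp: S_def)
    then show ?thesis
      by (rule order.strict_trans1) (simp add: emeasure_lborel_Icc_eq)
  qed
  have eq: "(LINT s|lborel. indicator {a..b} s * u s) = F b - F a"
    if "\<And>x. (F has_real_derivative u x) (at x)" "continuous_on UNIV u" for F u :: "real \<Rightarrow> real"
    using LBINT_eq_diff[OF that, of a b] ab by (simp add: interval_integral_Icc set_lebesgue_integral_def)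
  have int: "integrable lborel (\<lambda>s. indicator {a..b} s * u s)" if "continuous_on UNIV u" for u :: "real \<Rightarrow> real"
    using borel_integrable_compact[of "{a..b}" u] continuous_on_subset[OF that, of "{a..b}"]
    by simp
  have "continuous_on UNIV (\<lambda>s. g s * (1 / \<epsilon>))"
    by (intro continuous_intros g)
  from int[OF this] have ig: "integrable lborel (\<lambda>s. indicator {a..b} s * (g s / \<epsilon>))"
    by simp
  have iS: "integrable lborel (\<lambda>s. \<kappa> * indicator S s)"
    using S eS by (intro integrable_mult_right integrable_real_indicator) auto
  have "\<bar>f b - f a\<bar> = norm (LINT s|lborel. indicator {a..b} s * h s)"
    by (simp add: eq[OF f h])
  also have "\<dots> \<le> (LINT s|lborel. \<kappa> * indicator S s + indicator {a..b} s * (g s / \<epsilon>))"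
  proof (rule Bochner_Integration.integral_norm_bound_integral)
    show "integrable lborel (\<lambda>s. \<kappa> * indicator S s + indicator {a..b} s * (g s / \<epsilon>))"
      by (intro Bochner_Integration.integrable_add iS ig)
    show "norm (indicator {a..b} s * h s) \<le> \<kappa> * indicator S s + indicator {a..b} s * (g s / \<epsilon>)" for s
    proof (cases "s \<in> {a..b}")
      case True
      have "(if \<bar>\<phi> s\<bar> < \<epsilon> then \<kappa> else 0) \<le> \<kappa> * indicator S s"
      proof (cases "\<bar>\<phi> s\<bar> < \<epsilon>")
        case True
        then have "\<bar>s\<bar> \<le> R" using far[of s] by linarith
        then have "s \<in> S" using True by (auto simp: S_def abs_le_iff)
        then show ?thesis using \<kappa> by simp
      qed (use \<kappa> in simp)
      then show ?thesis
        using bound[of s] True by simp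
    qed (use \<kappa> in \<open>auto simp: indicator_def\<close>)
  qed (use int h in auto)
  also have "\<dots> = (LINT s|lborel. \<kappa> * indicator S s) + (LINT s|lborel. indicator {a..b} s * (g s / \<epsilon>))"
    by (intro Bochner_Integration.integral_add iS ig)
  also have "(LINT s|lborel. indicator {a..b} s * (g s / \<epsilon>)) = (LINT s|lborel. indicator {a..b} s * g s) / \<epsilon>"
    by (subst integral_divide_zero[symmetric]) simp
  also have "(LINT s|lborel. indicator {a..b} s * g s) = y b - y a"
    by (rule eq[OF y g])
  also have "(LINT s|lborel. \<kappa> * indicator S s) = \<kappa> * measure lborel S"
    using S eS by simp
  also have "\<kappa> * measure lborel S \<le> \<kappa> * m"
    using near \<kappa> by (intro mult_left_mono) (auto simp: S_def)
  finally show ?thesis by simp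
qed

text \<open>The choice \<open>\<epsilon> = A powr (2 / (2n + 3))\<close> balances the two terms.\<close>

lemma optimize_threshold:
  fixes n :: nat
  assumes K: "K \<ge> 0" and B: "B \<ge> 0"
  shows "\<exists>K'>0. \<forall>D A. A \<ge> 0 \<longrightarrow> \<bar>D\<bar> \<le> B \<longrightarrow>
    (\<forall>\<epsilon>. 0 < \<epsilon> \<longrightarrow> \<epsilon> < 1/2 \<longrightarrow> \<bar>D\<bar> \<le> K * \<epsilon> ^ n * sqrt \<epsilon> + A / \<epsilon>) \<longrightarrow>
    \<bar>D\<bar> \<le> K' * A powr ((2 * real n + 1) / (2 * real n + 3))"
proof -
  define \<theta> where "\<theta> = (2 * real n + 1) / (2 * real n + 3)"
  define \<sigma> where "\<sigma> = 2 / (2 * real n + 3)"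
  \<comment> \<open>The value of \<open>A\<close> at which the balancing \<open>\<epsilon>\<close>
    reaches the limit 1/2; from there on the a priori bound \<open>B\<close> is good enough.\<close>
  define A0 where "A0 = (1/2 :: real) powr (1 / \<sigma>)"
  have \<sigma>: "\<sigma> > 0" "1 - \<sigma> = \<theta>" "\<sigma> * real n + \<sigma> / 2 = \<theta>"
    by (auto simp: \<sigma>_def \<theta>_def field_simps)
  have \<theta>: "\<theta> > 0" by (auto simp: \<theta>_def intro!: divide_pos_pos)
  have A0: "A0 > 0" by (simp add: A0_def)
  show ?thesis
    unfolding \<theta>_def[symmetric]
  proof (rule exI[of _ "K + 1 + B / A0 powr \<theta>"], intro conjI allI impI)
    show "K + 1 + B / A0 powr \<theta> > 0"
      using K divide_nonneg_nonneg[OF B, of "A0 powr \<theta>"] by simp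
    fix D A :: real
    assume A: "A \<ge> 0" and DB: "\<bar>D\<bar> \<le> B"
      and D: "\<forall>\<epsilon>. 0 < \<epsilon> \<longrightarrow> \<epsilon> < 1/2 \<longrightarrow> \<bar>D\<bar> \<le> K * \<epsilon> ^ n * sqrt \<epsilon> + A / \<epsilon>"
    consider "A = 0" | "0 < A" "A < A0" | "A0 \<le> A" using A by linarith
    then show "\<bar>D\<bar> \<le> (K + 1 + B / A0 powr \<theta>) * A powr \<theta>"
    proof cases
      case 1
      \<comment> \<open>For \<open>A = 0\<close> nothing is to be balanced: letting
        \<open>\<epsilon>\<close> tend to 0 yields \<open>D = 0\<close>, in accordance with
        \<open>0 powr \<theta> = 0\<close>.\<close>
      have "((\<lambda>\<epsilon>. K * sqrt \<epsilon>) \<longlongrightarrow> K * sqrt 0) (at_right 0)"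
        by (intro tendsto_intros)
      moreover have "eventually (\<lambda>\<epsilon>::real. \<bar>D\<bar> \<le> K * sqrt \<epsilon>) (at_right 0)"
        unfolding eventually_at_right_field
      proof (intro exI[of _ "1/2"] conjI allI impI)
        fix \<epsilon> :: real assume \<epsilon>: "0 < \<epsilon>" "\<epsilon> < 1/2"
        have "K * (\<epsilon> ^ n * sqrt \<epsilon>) \<le> K * (1 * sqrt \<epsilon>)"
          using \<epsilon> K by (intro mult_left_mono mult_right_mono power_le_one) auto
        then show "\<bar>D\<bar> \<le> K * sqrt \<epsilon>"
          using D[rule_format, OF \<epsilon>] 1 by simp
      qed simp
      ultimately have "\<bar>D\<bar> \<le> K * sqrt 0"
        by (intro tendsto_lowerbound) auto
      then show ?thesis using 1 by simp
    next
      case 2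
      define \<epsilon> where "\<epsilon> = A powr \<sigma>"
      have "A powr \<sigma> < A0 powr \<sigma>"
        using 2 \<sigma> by (intro powr_less_mono2) auto
      also have "\<dots> = 1/2"
        using \<sigma> by (simp add: A0_def powr_powr)
      finally have \<epsilon>: "0 < \<epsilon>" "\<epsilon> < 1/2"
        using 2 by (auto simp: \<epsilon>_def)
      have "\<epsilon> ^ n = A powr (\<sigma> * real n)" "sqrt \<epsilon> = A powr (\<sigma> / 2)"
        using 2 by (simp_all add: \<epsilon>_def powr_half_sqrt[symmetric] powr_powr flip: powr_realpow)
      then have "K * \<epsilon> ^ n * sqrt \<epsilon> = K * A powr \<theta>"
        using \<sigma>(3) by (simp add: powr_add[symmetric])
      moreover have "A / \<epsilon> = A powr \<theta>"
        using 2 \<sigma>(2) by (simp add: \<epsilon>_def powr_diff flip: \<sigma>(2))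
      ultimately have "\<bar>D\<bar> \<le> K * A powr \<theta> + A powr \<theta>"
        using D[rule_format, OF \<epsilon>] by (simp only:)
      also have "\<dots> = (K + 1) * A powr \<theta>"
        by (simp add: algebra_simps)
      also have "\<dots> \<le> (K + 1 + B / A0 powr \<theta>) * A powr \<theta>"
        using B by (intro mult_right_mono) auto
      finally show ?thesis .
    next
      case 3
      have "\<bar>D\<bar> \<le> B / A0 powr \<theta> * A0 powr \<theta>"
        using DB A0 by simp
      also have "\<dots> \<le> B / A0 powr \<theta> * A powr \<theta>"
        using 3 A0 B \<theta> by (intro mult_left_mono powr_mono2) auto
      also have "\<dots> \<le> (K + 1 + B / A0 powr \<theta>) * A powr \<theta>"
        using K by (intro mult_right_mono) auto
      finally show ?thesis .
    qed
  qed
qed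

lemma powr_add_le:
  fixes a b \<theta> :: real
  assumes "a \<ge> 0" "b \<ge> 0" "0 < \<theta>" "\<theta> \<le> 1"
  shows "(a + b) powr \<theta> \<le> 2 * (a powr \<theta> + b powr \<theta>)"
proof -
  have "(a + b) powr \<theta> \<le> (2 * max a b) powr \<theta>"
    using assms by (intro powr_mono2) auto
  also have "\<dots> = 2 powr \<theta> * max a b powr \<theta>"
    using assms by (simp add: powr_mult)
  also have "\<dots> \<le> 2 powr 1 * (a powr \<theta> + b powr \<theta>)"
    using assms by (intro mult_mono powr_mono) (auto simp: max_def)
  finally show ?thesis by simp
qed

text \<open>From \<open>(t1, x1)\<close> follow the characteristic to time \<open>t2\<close>, then
  compare with \<open>(t2, x2)\<close> at that fixed time. The detour displaces the point by at most
  \<open>M * \<bar>t1 - t2\<bar>\<close>, which enters the spatial estimate with exponent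
  \<open>\<theta>\<close>.\<close>

lemma hoelder_of_characteristics:
  fixes u U y :: "real \<Rightarrow> real \<Rightarrow> real" and \<theta> T :: real
  assumes \<theta>: "0 < \<theta>" "\<theta> \<le> 1" and T: "T > 0"
    and u: "\<And>t x. u t (y t x) = U t x" and surj: "\<And>t x. \<exists>\<xi>. y t \<xi> = x"
    and K: "K > 0" "\<And>t a b. t \<in> {-T..T} \<Longrightarrow> \<bar>U t a - U t b\<bar> \<le> K * \<bar>y t a - y t b\<bar> powr \<theta>"
    and L: "L > 0" "\<And>s t x. s \<in> {-T..T} \<Longrightarrow> t \<in> {-T..T} \<Longrightarrow> \<bar>U s x - U t x\<bar> \<le> L * \<bar>s - t\<bar>"
    and M: "M > 0" "\<And>s t x. s \<in> {-T..T} \<Longrightarrow> t \<in> {-T..T} \<Longrightarrow> \<bar>y s x - y t x\<bar> \<le> M * \<bar>s - t\<bar>"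
  shows "\<exists>C>0. \<forall>t1\<in>{-T..T}. \<forall>t2\<in>{-T..T}. \<forall>x1 x2.
    \<bar>u t1 x1 - u t2 x2\<bar> \<le> C * (\<bar>t1 - t2\<bar> powr \<theta> + \<bar>x1 - x2\<bar> powr \<theta>)"
proof -
  \<comment> \<open>The factor \<open>(2 * T) powr (1 - \<theta>)\<close> turns the Lipschitz bound
    in time into a Hoelder bound, as \<open>\<bar>t1 - t2\<bar> \<le> 2 * T\<close>.\<close>
  define C where "C = L * (2 * T) powr (1 - \<theta>) + 2 * K * (1 + M powr \<theta>)"
  have "C > 0" using L K M T by (auto simp: C_def intro!: add_nonneg_pos mult_pos_pos add_pos_pos)
  moreover have "\<bar>u t1 x1 - u t2 x2\<bar> \<le> C * (\<bar>t1 - t2\<bar> powr \<theta> + \<bar>x1 - x2\<bar> powr \<theta>)"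
    if t: "t1 \<in> {-T..T}" "t2 \<in> {-T..T}" for t1 t2 x1 x2
  proof -
    obtain a b where ab: "y t1 a = x1" "y t2 b = x2" using surj by metis
    define \<tau> where "\<tau> = \<bar>t1 - t2\<bar>"
    define d where "d = \<bar>x1 - x2\<bar>"
    have \<tau>: "0 \<le> \<tau>" "\<tau> \<le> 2 * T" and d: "0 \<le> d" using t by (auto simp: \<tau>_def d_def abs_le_iff)
    have 1: "\<bar>U t1 a - U t2 a\<bar> \<le> L * (2 * T) powr (1 - \<theta>) * \<tau> powr \<theta>"
    proof -
      have "\<tau> = \<tau> powr (1 - \<theta>) * \<tau> powr \<theta>"
        using \<tau>(1) by (cases "\<tau> = 0") (auto simp flip: powr_add)
      also have "\<dots> \<le> (2 * T) powr (1 - \<theta>) * \<tau> powr \<theta>"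
        using \<tau> \<theta> by (intro mult_right_mono powr_mono2) auto
      finally have "L * \<tau> \<le> L * ((2 * T) powr (1 - \<theta>) * \<tau> powr \<theta>)"
        using L(1) by (intro mult_left_mono) auto
      then show ?thesis using L(2)[OF t, of a] by (simp add: \<tau>_def mult.assoc)
    qed
    have "\<bar>y t2 a - y t2 b\<bar> \<le> d + M * \<tau>"
      using M(2)[OF t(2,1), of a] ab by (simp add: d_def \<tau>_def abs_minus_commute[of t2])
    then have "\<bar>y t2 a - y t2 b\<bar> powr \<theta> \<le> (d + M * \<tau>) powr \<theta>"
      using \<theta> by (intro powr_mono2) auto
    also have "\<dots> \<le> 2 * (d powr \<theta> + (M * \<tau>) powr \<theta>)"
      using d \<tau> M(1) \<theta> by (intro powr_add_le) auto
    finally have "K * \<bar>y t2 a - y t2 b\<bar> powr \<theta> \<le> K * (2 * (d powr \<theta> + M powr \<theta> * \<tau> powr \<theta>))"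
      using K(1) M(1) \<tau> by (intro mult_left_mono) (auto simp: powr_mult)
    then have 2: "\<bar>U t2 a - U t2 b\<bar> \<le> 2 * K * (d powr \<theta> + M powr \<theta> * \<tau> powr \<theta>)"
      using K(2)[OF t(2), of a b] by (simp add: algebra_simps)
    have "u t1 x1 - u t2 x2 = (U t1 a - U t2 a) + (U t2 a - U t2 b)"
      using u[of t1 a] u[of t2 b] ab by simp
    then have "\<bar>u t1 x1 - u t2 x2\<bar> \<le> L * (2 * T) powr (1 - \<theta>) * \<tau> powr \<theta> + 2 * K * (d powr \<theta> + M powr \<theta> * \<tau> powr \<theta>)"
      using 1 2 by linarith
    also have "\<dots> \<le> C * \<tau> powr \<theta> + C * d powr \<theta>"
    proof -
      have "0 \<le> L * (2 * T) powr (1 - \<theta>) * d powr \<theta>" "0 \<le> 2 * K * \<tau> powr \<theta>" "0 \<le> 2 * K * M powr \<theta> * d powr \<theta>"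
        using L K M by auto
      then show ?thesis
        unfolding C_def by (simp add: algebra_simps)
    qed
    finally show ?thesis by (simp add: \<tau>_def d_def algebra_simps)
  qed
  ultimately show ?thesis by blast
qed

section \<open>Spatial Hoelder estimates along characteristics\<close>

context flow
begin

lemma cos_zero_imp_level_pi:
  assumes "cos (w / 2) = 0"
  shows "[w = pi] (rmod (2 * pi))"
proof -
  obtain i where i: "odd i" "w / 2 = of_int i * (pi / 2)"
    using assms cos_zero_iff_int by blast
  then obtain j where "i = 2 * j + 1" by (elim oddE)
  then have "w = pi + of_int j * (2 * pi)"
    using i(2) by (simp add: algebra_simps)
  then show ?thesis
    unfolding rcong_altdef by (metis rcong_altdef rcong_sym)
qed

text \<open>Decay of \<open>W\<close> keeps the cosine at least 1/2 far out, so compactness is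
  needed only on a rectangle. Where \<open>cos (W/2)\<close> vanishes the sine does not, so
  nondegeneracy of \<open>W\<close> carries over to \<open>cos (W/2)\<close>.\<close>

lemma cos_half_sublevel:
  assumes T: "T > 0" and nd: "nondegenerate_level T W"
  shows "\<exists>R C. C > 0 \<and> (\<forall>t\<in>{-T..T}. (\<forall>x. R < \<bar>x\<bar> \<longrightarrow> 1/2 \<le> \<bar>cos (W t x / 2)\<bar>) \<and>
    (\<forall>\<epsilon>. 0 < \<epsilon> \<longrightarrow> \<epsilon> < 1 \<longrightarrow> measure lborel {x\<in>{-R..R}. \<bar>cos (W t x / 2)\<bar> < \<epsilon>} \<le> C * sqrt \<epsilon>))"
proof -
  have Wt: "lbd (\<lambda>t x. cfun U V W Z q t x + dfun U V W Z q t x * cos (W t x))"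
    by (intro lbd_intros lbd_cfun)
  obtain L where L: "L > 0" "\<And>s t x. s \<in> {-T..T} \<Longrightarrow> t \<in> {-T..T} \<Longrightarrow> \<bar>W s x - W t x\<bar> \<le> L * \<bar>s - t\<bar>"
    using lipschitz_in_time[OF der_W Wt T] by metis
  obtain R where R: "\<And>t x. t \<in> {-T..T} \<Longrightarrow> R < \<bar>x\<bar> \<Longrightarrow> \<bar>W t x\<bar> < 1"
    using uniform_decay[OF W_square_integrable llip_W T zero_less_one L] by blast
  have far: "1/2 \<le> \<bar>cos (W t x / 2)\<bar>" if "t \<in> {-T..T}" "R < \<bar>x\<bar>" for t x
  proof -
    have "\<bar>sin (W t x / 4)\<bar> \<le> 1/2"
      using abs_sin_x_le_abs_x[of "W t x / 4"] R[OF that] by simp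
    then have "(sin (W t x / 4))\<^sup>2 \<le> (1/2)\<^sup>2"
      by (intro power2_le_iff_abs_le[THEN iffD2]) auto
    moreover have "cos (W t x / 2) = 1 - 2 * (sin (W t x / 4))\<^sup>2"
      using cos_double_sin[of "W t x / 4"] by simp
    ultimately show ?thesis by (simp add: power_divide)
  qed
  obtain W1 W2 where W: "C1x W W1" "C1x W1 W2"
    by (rule W_twice_differentiable)
  have two: "(2::real) \<noteq> 0" by simp
  note \<phi>1 = C1x_cos[OF C1x_divide[OF W(1) two]]
  note \<phi>2 = C1x_mult[OF C1x_minus[OF C1x_sin[OF C1x_divide[OF W(1) two]]] C1x_divide[OF W(2) two]]
  have dW: "deriv (W t) = W1 t" "deriv (W1 t) = W2 t" for t
    using DERIV_imp_deriv C1xD(3)[OF W(1)] C1xD(3)[OF W(2)] by blast+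
  have "\<exists>C>0. \<forall>t\<in>{-T..T}. \<forall>\<epsilon>. 0 < \<epsilon> \<longrightarrow> \<epsilon> < 1 \<longrightarrow> measure lborel {x\<in>{-R..R}. \<bar>cos (W t x / 2)\<bar> < \<epsilon>} \<le> C * sqrt \<epsilon>"
  proof (rule sublevel_compact[OF \<phi>1 \<phi>2])
    fix t x assume t: "t \<in> {-T..T}" and 0: "cos (W t x / 2) = 0" and 1: "- sin (W t x / 2) * (W1 t x / 2) = 0"
    have s: "sin (W t x / 2) \<noteq> 0"
      using 0 sin_zero_abs_cos_one[of "W t x / 2"] by auto
    have "(t, x) \<in> level_pi T W"
      using t cos_zero_imp_level_pi[OF 0] by (simp add: level_pi_def)
    then have "W1 t x \<noteq> 0 \<or> W2 t x \<noteq> 0"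
      using nd unfolding nondegenerate_level_def by (auto simp: dW)
    then show "- (cos (W t x / 2) * (W1 t x / 2)) * (W1 t x / 2) + - sin (W t x / 2) * (W2 t x / 2) \<noteq> 0"
      using s 0 1 by auto
  qed
  then obtain C where "C > 0" "\<forall>t\<in>{-T..T}. \<forall>\<epsilon>. 0 < \<epsilon> \<longrightarrow> \<epsilon> < 1 \<longrightarrow>
      measure lborel {x\<in>{-R..R}. \<bar>cos (W t x / 2)\<bar> < \<epsilon>} \<le> C * sqrt \<epsilon>"
    by blast
  then show ?thesis
    by - (rule exI[of _ R], rule exI[of _ C], use far in blast)
qed

lemma q_bound:
  assumes "T > 0"
  shows "\<exists>B>0. \<forall>t\<in>{-T..T}. \<forall>x. q t x \<le> B"
  using lbd_pos[OF lbd_state(3) assms] by (meson abs_le_D1)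

text \<open>\<open>n\<close> is the power of \<open>\<epsilon>\<close> gained by \<open>h\<close> on
  the bad set; the cases 1 and 3 produce 3/5 and 7/9. The range \<open>\<epsilon> < 1/2\<close>
  keeps the bad set inside \<open>{-R..R}\<close>.\<close>

lemma space_hoelder_aux:
  fixes n :: nat
  assumes T: "T > 0" and nd: "nondegenerate_level T W"
    and y: "C1x y g"
    and pt: "\<And>t x \<epsilon> B. t \<in> {-T..T} \<Longrightarrow> 0 < \<epsilon> \<Longrightarrow> q t x \<le> B \<Longrightarrow>
      \<bar>h t x\<bar> \<le> (if \<bar>cos (W t x / 2)\<bar> < \<epsilon> then B * \<epsilon> ^ n else 0) + g t x / \<epsilon>"
  shows "\<exists>K>0. \<forall>t\<in>{-T..T}. \<forall>a b. \<bar>U t a - U t b\<bar> \<le> K * \<bar>y t a - y t b\<bar> powr ((2 * real n + 1) / (2 * real n + 3))"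
proof -
  obtain R C where C: "C > 0"
    and far: "\<And>t x. t \<in> {-T..T} \<Longrightarrow> R < \<bar>x\<bar> \<Longrightarrow> 1/2 \<le> \<bar>cos (W t x / 2)\<bar>"
    and near: "\<And>t \<epsilon>. t \<in> {-T..T} \<Longrightarrow> 0 < \<epsilon> \<Longrightarrow> \<epsilon> < 1 \<Longrightarrow> measure lborel {x\<in>{-R..R}. \<bar>cos (W t x / 2)\<bar> < \<epsilon>} \<le> C * sqrt \<epsilon>"
    using cos_half_sublevel[OF T nd] by blast
  obtain B where B: "B > 0" "\<And>t x. t \<in> {-T..T} \<Longrightarrow> q t x \<le> B"
    using q_bound[OF T] by blast
  obtain D where D: "D > 0" "\<And>t x. t \<in> {-T..T} \<Longrightarrow> \<bar>U t x\<bar> \<le> D"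
    using lbd_pos[OF lbd_state(1) T] by blast
  have "B * C \<ge> 0" "2 * D \<ge> 0" using B C D by auto
  from optimize_threshold[OF this, of n] obtain K where K: "K > 0"
    "\<And>d A. A \<ge> 0 \<Longrightarrow> \<bar>d\<bar> \<le> 2 * D \<Longrightarrow>
    (\<And>\<epsilon>. 0 < \<epsilon> \<Longrightarrow> \<epsilon> < 1/2 \<Longrightarrow> \<bar>d\<bar> \<le> B * C * \<epsilon> ^ n * sqrt \<epsilon> + A / \<epsilon>) \<Longrightarrow>
    \<bar>d\<bar> \<le> K * A powr ((2 * real n + 1) / (2 * real n + 3))"
    by blast
  have main: "\<bar>U t b - U t a\<bar> \<le> K * \<bar>y t b - y t a\<bar> powr ((2 * real n + 1) / (2 * real n + 3))"
    if t: "t \<in> {-T..T}" and ab: "a \<le> b" for t a b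
  proof -
    have ymono: "y t a \<le> y t b"
      by (rule DERIV_nonneg_imp_nondecreasing[OF ab]) (use C1xD(3)[OF y] g_nonneg in blast)
    have "\<bar>U t b - U t a\<bar> \<le> K * (y t b - y t a) powr ((2 * real n + 1) / (2 * real n + 3))"
    proof (rule K(2))
      show "0 \<le> y t b - y t a" using ymono by simp
      show "\<bar>U t b - U t a\<bar> \<le> 2 * D"
        using D(2)[OF t, of a] D(2)[OF t, of b] by linarith
      fix \<epsilon> :: real assume \<epsilon>: "0 < \<epsilon>" "\<epsilon> < 1/2"
      have "\<bar>U t b - U t a\<bar> \<le> B * \<epsilon> ^ n * (C * sqrt \<epsilon>) + (y t b - y t a) / \<epsilon>"
      proof (rule increment_bound[where R = R and \<phi> = "\<lambda>x. cos (W t x / 2)"])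
        show "(U t has_real_derivative h t x) (at x)" "(y t has_real_derivative g t x) (at x)" for x
          using C1xD(3)[OF C1x_U] C1xD(3)[OF y] by auto
        show "continuous_on UNIV (h t)" "continuous_on UNIV (g t)"
          using jc_at jc_h jc_g by auto
        show "\<epsilon> \<le> \<bar>cos (W t x / 2)\<bar>" if "R < \<bar>x\<bar>" for x
          using far[OF t that] \<epsilon> by simp
        show "measure lborel {x\<in>{-R..R}. \<bar>cos (W t x / 2)\<bar> < \<epsilon>} \<le> C * sqrt \<epsilon>"
          using near[OF t] \<epsilon> by simp
        show "\<bar>h t x\<bar> \<le> (if \<bar>cos (W t x / 2)\<bar> < \<epsilon> then B * \<epsilon> ^ n else 0) + g t x / \<epsilon>" for x
          by (rule pt[OF t \<epsilon>(1) B(2)[OF t]])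
      qed (use B \<epsilon> ab in auto)
      then show "\<bar>U t b - U t a\<bar> \<le> B * C * \<epsilon> ^ n * sqrt \<epsilon> + (y t b - y t a) / \<epsilon>"
        by (simp add: mult_ac)
    qed
    then show ?thesis using ymono by simp
  qed
  have "\<bar>U t a - U t b\<bar> \<le> K * \<bar>y t a - y t b\<bar> powr ((2 * real n + 1) / (2 * real n + 3))"
    if t: "t \<in> {-T..T}" for t a b
    using main[OF t, of a b] main[OF t, of b a] by (cases "a \<le> b") (auto simp: abs_minus_commute)
  with K(1) show ?thesis by blast
qed

lemma abs_h_le: "\<bar>h t x\<bar> \<le> q t x * (\<bar>cos (W t x / 2)\<bar> * (cos (Z t x / 2))\<^sup>2)"
proof -
  have "\<bar>h t x\<bar> = q t x * (\<bar>sin (W t x / 2)\<bar> * (\<bar>cos (W t x / 2)\<bar> * (cos (Z t x / 2))\<^sup>2))"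
    using q_pos[of t x] unfolding hdens_def half_angle(1)[of "W t x"] by (simp add: abs_mult)
  also have "\<dots> \<le> q t x * (1 * (\<bar>cos (W t x / 2)\<bar> * (cos (Z t x / 2))\<^sup>2))"
    using q_pos[of t x] by (intro mult_left_mono mult_right_mono) auto
  finally show ?thesis by simp
qed

lemma space_hoelder_3_5:
  assumes T: "T > 0" and nd: "nondegenerate_level T W" and y: "C1x y g"
  shows "\<exists>K>0. \<forall>t\<in>{-T..T}. \<forall>a b. \<bar>U t a - U t b\<bar> \<le> K * \<bar>y t a - y t b\<bar> powr (3/5)"
proof -
  have "\<bar>h t x\<bar> \<le> (if \<bar>cos (W t x / 2)\<bar> < \<epsilon> then B * \<epsilon> ^ 1 else 0) + g t x / \<epsilon>"
    if \<epsilon>: "0 < \<epsilon>" and B: "q t x \<le> B" for t x \<epsilon> B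
  proof -
    define \<phi> where "\<phi> = \<bar>cos (W t x / 2)\<bar>"
    define \<psi> where "\<psi> = (cos (Z t x / 2))\<^sup>2"
    have \<psi>: "0 \<le> \<psi>" "\<psi> \<le> 1" by (auto simp: \<psi>_def abs_square_le_1)
    have \<phi>: "0 \<le> \<phi>" by (simp add: \<phi>_def)
    have g: "g t x = q t x * \<phi>\<^sup>2 * \<psi>" by (simp add: gdens_def \<phi>_def \<psi>_def)
    have h: "\<bar>h t x\<bar> \<le> q t x * (\<phi> * \<psi>)" using abs_h_le by (simp add: \<phi>_def \<psi>_def)
    have g0: "g t x / \<epsilon> \<ge> 0" using g_nonneg \<epsilon> by simp
    show ?thesis
    proof (cases "\<phi> < \<epsilon>")
      case True
      have "q t x * (\<phi> * \<psi>) \<le> B * (\<epsilon> * 1)"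
        using True \<phi> \<psi> B q_pos[of t x] by (intro mult_mono) auto
      then show ?thesis using h g0 True by (simp add: \<phi>_def[symmetric])
    next
      case False
      \<comment> \<open>Off the bad set \<open>\<epsilon>\<close> is exchanged for a factor
        \<open>\<phi>\<close>, which completes the bound for \<open>h\<close> to
        \<open>g\<close>.\<close>
      then have "\<epsilon> * (q t x * (\<phi> * \<psi>)) \<le> \<phi> * (q t x * (\<phi> * \<psi>))"
        using \<phi> \<psi> q_pos[of t x] by (intro mult_right_mono) auto
      then have "q t x * (\<phi> * \<psi>) \<le> g t x / \<epsilon>"
        using \<epsilon> unfolding g by (simp add: field_simps power2_eq_square)
      then show ?thesis using h False by (simp add: \<phi>_def[symmetric])
    qed
  qed
  from space_hoelder_aux[OF T nd y, of 1, OF this] show ?thesis by simp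
qed

lemma space_hoelder_7_9:
  assumes T: "T > 0" and nd: "nondegenerate_level T W" and y: "C1x y g" and UV: "U = V"
  shows "\<exists>K>0. \<forall>t\<in>{-T..T}. \<forall>a b. \<bar>U t a - U t b\<bar> \<le> K * \<bar>y t a - y t b\<bar> powr (7/9)"
proof -
  have "\<bar>h t x\<bar> \<le> (if \<bar>cos (W t x / 2)\<bar> < \<epsilon> then B * \<epsilon> ^ 3 else 0) + g t x / \<epsilon>"
    if \<epsilon>: "0 < \<epsilon>" and B: "q t x \<le> B" for t x \<epsilon> B
  proof -
    define c where "c = cos (W t x / 2)"
    define s where "s = sin (W t x / 2)"
    define c' where "c' = cos (Z t x / 2)"
    define s' where "s' = sin (Z t x / 2)"
    have sc: "s\<^sup>2 = 1 - c\<^sup>2" "s'\<^sup>2 = 1 - c'\<^sup>2" by (simp_all add: s_def c_def s'_def c'_def sin_squared_eq)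
    have h: "\<bar>h t x\<bar> \<le> q t x * (\<bar>c\<bar> * c'\<^sup>2)" using abs_h_le by (simp add: c_def c'_def)
    have g: "g t x = q t x * c\<^sup>2 * c'\<^sup>2" by (simp add: gdens_def c_def c'_def)
    have g0: "g t x / \<epsilon> \<ge> 0" using g_nonneg \<epsilon> by simp
    have B0: "B > 0" using q_pos[of t x] B by simp
    show ?thesis
    proof (cases "c = 0 \<or> c' = 0")
      case True
      then have "h t x = 0" using h by auto
      then show ?thesis using g0 B0 \<epsilon> by simp
    next
      case False
      have "h t x = k t x"
        using C1x_unique[OF C1x_U] C1x_V UV by metis
      then have "s * c * c'\<^sup>2 = s' * c' * c\<^sup>2"
        using q_pos[of t x] unfolding hdens_def half_angle(1)[of "W t x"] half_angle(1)[of "Z t x"]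
        by (simp add: s_def s'_def c_def c'_def)
      \<comment> \<open>The half angles of \<open>W\<close> and \<open>Z\<close> have equal
        tangents. The relation between the two angles is read off from \<open>h = k\<close>, since
        the hypothesis \<open>UV\<close> concerns \<open>U\<close> and \<open>V\<close>
        only.\<close>
      then have "s * c' = s' * c"
        using False by (simp add: power2_eq_square)
      then have "s\<^sup>2 * c'\<^sup>2 = s'\<^sup>2 * c\<^sup>2"
        by (metis power_mult_distrib)
      then have cc: "c'\<^sup>2 = c\<^sup>2"
        unfolding sc by (simp add: algebra_simps)
      then have h': "\<bar>h t x\<bar> \<le> q t x * \<bar>c\<bar> ^ 3"
        using h by (simp add: power2_eq_square power3_eq_cube)
      show ?thesis
      proof (cases "\<bar>c\<bar> < \<epsilon>")
        case True
        have "q t x * \<bar>c\<bar> ^ 3 \<le> B * \<epsilon> ^ 3"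
          using True B q_pos[of t x] B0 by (intro mult_mono power_mono) auto
        then show ?thesis using h' g0 True by (simp add: c_def[symmetric])
      next
        case False
        then have "\<epsilon> * (q t x * \<bar>c\<bar> ^ 3) \<le> \<bar>c\<bar> * (q t x * \<bar>c\<bar> ^ 3)"
          using q_pos[of t x] by (intro mult_right_mono) auto
        also have "\<dots> = g t x"
          unfolding g cc by (simp add: power2_eq_square power3_eq_cube)
        finally have "q t x * \<bar>c\<bar> ^ 3 \<le> g t x / \<epsilon>"
          using \<epsilon> by (simp add: field_simps)
        then show ?thesis using h' False by (simp add: c_def[symmetric])
      qed
    qed
  qed
  from space_hoelder_aux[OF T nd y, of 3, OF this] show ?thesis by simp
qed

end

subsection \<open>Initial data\<close>

lemma Ck_on_imp_continuous: "Ck_on m S f \<Longrightarrow> continuous_on S f"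
  by (cases m) (auto intro: has_derivative_continuous_on)

lemma Ck_on_Suc_deriv:
  fixes f :: "real \<Rightarrow> real"
  assumes "Ck_on (Suc m) UNIV f"
  shows "(f has_real_derivative deriv f x) (at x)" "Ck_on m UNIV (deriv f)"
proof -
  obtain D where D: "\<And>x. (f has_derivative (\<lambda>h. h * D x)) (at x)" "Ck_on m UNIV D"
  proof -
    from assms obtain D where "\<And>x. (f has_derivative (\<lambda>h. \<Sum>b\<in>Basis. (h \<bullet> b) *\<^sub>R D b x)) (at x)"
      "\<And>b. b \<in> Basis \<Longrightarrow> Ck_on m UNIV (D b)"
      by auto
    then show ?thesis by (intro that[of "D 1"]) auto
  qed
  then have d: "(f has_real_derivative D x) (at x)" for x
    by (simp add: has_field_derivative_def mult_commute_abs)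
  then have "deriv f = D"
    using DERIV_imp_deriv by blast
  then show "(f has_real_derivative deriv f x) (at x)" "Ck_on m UNIV (deriv f)"
    using d D(2) by auto
qed

lemma Ck_spaceD:
  assumes "f \<in> Ck_space k" "k \<ge> 3"
  shows
    "\<And>x. (f has_real_derivative deriv f x) (at x)"
    "\<And>x. (deriv f has_real_derivative deriv (deriv f) x) (at x)"
    "\<And>x. (deriv (deriv f) has_real_derivative deriv (deriv (deriv f)) x) (at x)"
    "continuous_on UNIV (deriv (deriv (deriv f)))"
    "\<exists>C. \<forall>x. \<bar>deriv (deriv f) x\<bar> \<le> C"
proof -
  obtain m where k: "k = Suc (Suc (Suc m))"
    using assms(2) by (metis add.commute le_Suc_ex numeral_3_eq_3 plus_nat.simps)
  have 1: "Ck_on (Suc (Suc (Suc m))) UNIV f"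
    using assms(1) k by (simp add: Ck_space_def del: Ck_on.simps)
  note 2 = Ck_on_Suc_deriv[OF 1]
  note 3 = Ck_on_Suc_deriv[OF 2(2)]
  note 4 = Ck_on_Suc_deriv[OF 3(2)]
  have "bounded (range ((deriv ^^ 2) f))"
    using assms by (simp add: Ck_space_def)
  then show "\<exists>C. \<forall>x. \<bar>deriv (deriv f) x\<bar> \<le> C"
    by (auto simp: bounded_iff numeral_2_eq_2)
  show "(f has_real_derivative deriv f x) (at x)"
    "(deriv f has_real_derivative deriv (deriv f) x) (at x)"
    "(deriv (deriv f) has_real_derivative deriv (deriv (deriv f)) x) (at x)"
    "continuous_on UNIV (deriv (deriv (deriv f)))" for x
    by (rule 2(1) 3(1) 4(1) Ck_on_imp_continuous[OF 4(2)])+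
qed

lemma y_init_swap: "y_init v0 u0 = y_init u0 v0"
  by (intro ext) (simp add: y_init_def mult.commute)

text \<open>Three derivatives, because the initial angle is built from \<open>deriv u0\<close> and
  must itself be twice continuously differentiable.\<close>

locale data =
  fixes u0 v0 :: "real \<Rightarrow> real" and k :: nat
  assumes u0: "u0 \<in> Ck_space k" and v0: "v0 \<in> Ck_space k" and k: "k \<ge> 3"
begin

lemma swap: "data v0 u0 k"
  by unfold_locales (use u0 v0 k in auto)

definition \<rho> :: "real \<Rightarrow> real" where "\<rho> x = (1 + (deriv u0 x)\<^sup>2) * (1 + (deriv v0 x)\<^sup>2)"

abbreviation "y0 \<equiv> y_init u0 v0"

lemma continuous_\<rho>: "continuous_on UNIV \<rho>"
proof -
  have "continuous_on UNIV (deriv u0)" "continuous_on UNIV (deriv v0)"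
    by (rule derivative_imp_continuous[OF Ck_spaceD(2)[OF u0 k]] derivative_imp_continuous[OF Ck_spaceD(2)[OF v0 k]])+
  then show ?thesis
    unfolding \<rho>_def by (intro continuous_intros)
qed

lemma \<rho>_ge_1: "\<rho> x \<ge> 1"
  unfolding \<rho>_def by (simp add: algebra_simps add_nonneg_nonneg)

text \<open>Since \<open>\<rho> \<ge> 1\<close>, the primitive of \<open>\<rho>\<close> is an
  expanding bijection of the line; hence \<open>y_init\<close> is its genuine inverse and is
  1-Lipschitz.\<close>

lemma prim_\<rho>_expanding:
  assumes "a \<le> b"
  shows "b - a \<le> prim \<rho> b - prim \<rho> a"
proof -
  have "prim \<rho> a - a \<le> prim \<rho> b - b"
  proof (rule DERIV_nonneg_imp_nondecreasing[OF assms])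
    fix x
    have "((\<lambda>x. prim \<rho> x - x) has_real_derivative \<rho> x - 1) (at x)"
      by (auto intro!: derivative_eq_intros prim_has_derivative[OF continuous_\<rho>])
    then show "\<exists>d. ((\<lambda>x. prim \<rho> x - x) has_real_derivative d) (at x) \<and> 0 \<le> d"
      using \<rho>_ge_1[of x] by (intro exI[of _ "\<rho> x - 1"]) auto
  qed
  then show ?thesis by simp
qed

lemma prim_\<rho>_expanding_abs: "\<bar>a - b\<bar> \<le> \<bar>prim \<rho> a - prim \<rho> b\<bar>"
proof (cases "a \<le> b")
  case True
  then show ?thesis using prim_\<rho>_expanding[OF True] by linarith
next
  case False
  then have "b \<le> a" by simp
  then show ?thesis using prim_\<rho>_expanding[of b a] by linarith
qed

lemma prim_\<rho>_surj: "\<exists>z. prim \<rho> z = \<xi>"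
proof -
  have 1: "\<bar>\<xi>\<bar> \<le> prim \<rho> \<bar>\<xi>\<bar>" "prim \<rho> (- \<bar>\<xi>\<bar>) \<le> - \<bar>\<xi>\<bar>"
    using prim_\<rho>_expanding[of 0 "\<bar>\<xi>\<bar>"] prim_\<rho>_expanding[of "- \<bar>\<xi>\<bar>" 0] by auto
  have "continuous_on {- \<bar>\<xi>\<bar>..\<bar>\<xi>\<bar>} (prim \<rho>)"
    using derivative_imp_continuous[OF prim_has_derivative[OF continuous_\<rho>]] continuous_on_subset by blast
  then show ?thesis
    using IVT'[of "prim \<rho>" "- \<bar>\<xi>\<bar>" \<xi> "\<bar>\<xi>\<bar>"] 1 by force
qed

lemma prim_\<rho>_y0: "prim \<rho> (y0 \<xi>) = \<xi>" and y0_prim_\<rho>: "y0 (prim \<rho> z) = z"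
proof -
  have inj: "a = b" if "prim \<rho> a = prim \<rho> b" for a b
    using prim_\<rho>_expanding_abs[of a b] that by linarith
  have y0: "y0 \<xi> = (THE z. prim \<rho> z = \<xi>)" for \<xi>
    unfolding y_init_def \<rho>_def[symmetric] using LBINT_eq_prim[OF continuous_\<rho>] by simp
  show *: "prim \<rho> (y0 \<xi>) = \<xi>" for \<xi>
  proof -
    obtain z where z: "prim \<rho> z = \<xi>"
      using prim_\<rho>_surj by blast
    have "y0 \<xi> = z"
      unfolding y0 by (rule the_equality[of "\<lambda>z. prim \<rho> z = \<xi>", OF z]) (rule inj, simp add: z)
    then show ?thesis by (simp only: z)
  qed
  show "y0 (prim \<rho> z) = z"
    by (rule inj) (rule *)
qed

lemma y0_has_derivative: "(y0 has_real_derivative inverse (\<rho> (y0 x))) (at x)"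
proof (rule DERIV_inverse_function[where f = "prim \<rho>" and a = "x - 1" and b = "x + 1"])
  show "(prim \<rho> has_real_derivative \<rho> (y0 x)) (at (y0 x))"
    by (rule prim_has_derivative[OF continuous_\<rho>])
  show "\<rho> (y0 x) \<noteq> 0" using \<rho>_ge_1[of "y0 x"] by simp
  have "\<bar>y0 a - y0 b\<bar> \<le> 1 * \<bar>a - b\<bar>" for a b
    using prim_\<rho>_expanding_abs[of "y0 a" "y0 b"] by (simp add: prim_\<rho>_y0)
  then have "1-lipschitz_on UNIV y0"
    by (auto simp: lipschitz_on_def dist_real_def)
  then show "isCont y0 x"
    using lipschitz_on_continuous_on continuous_on_eq_continuous_at[OF open_UNIV] by blast
qed (auto simp: prim_\<rho>_y0)

text \<open>The squared cosine of \<open>arctan p\<close> is \<open>1 / (1 + p^2)\<close>; this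
  identifies the derivative of \<open>y0\<close> with \<open>gdens\<close> at time 0.\<close>

lemma y0_derivative_trig:
  "inverse (\<rho> (y0 x)) = (cos (arctan (deriv u0 (y0 x))))\<^sup>2 * (cos (arctan (deriv v0 (y0 x))))\<^sup>2"
  by (simp add: \<rho>_def cos_arctan power_divide inverse_eq_divide)

lemma u0_y0_has_derivative:
  "((\<lambda>x. u0 (y0 x)) has_real_derivative 1/2 * sin (2 * arctan (deriv u0 (y0 x))) * (cos (arctan (deriv v0 (y0 x))))\<^sup>2) (at x)"
proof -
  have "1 + (deriv u0 (y0 x))\<^sup>2 \<noteq> 0"
    using zero_le_power2[of "deriv u0 (y0 x)"] by linarith
  then have "deriv u0 (y0 x) * inverse (\<rho> (y0 x)) = 1/2 * sin (2 * arctan (deriv u0 (y0 x))) * (cos (arctan (deriv v0 (y0 x))))\<^sup>2"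
    unfolding y0_derivative_trig sin_double
    by (simp add: sin_arctan cos_arctan power_divide)
  with DERIV_chain2[OF Ck_spaceD(1)[OF u0 k] y0_has_derivative, of x] show ?thesis by simp
qed

lemma C2_lipschitz_angle: "C2_lipschitz (\<lambda>x. 2 * arctan (deriv u0 (y0 x)))"
proof -
  note u = Ck_spaceD(2-4)[OF u0 k] and v = Ck_spaceD(2,3)[OF v0 k]
  obtain C where C: "\<And>x. \<bar>deriv (deriv u0) x\<bar> \<le> C"
    using Ck_spaceD(5)[OF u0 k] by blast
  define p where "p x = deriv u0 (y0 x)" for x
  define p2 where "p2 x = deriv (deriv u0) (y0 x)" for x
  define p3 where "p3 x = deriv (deriv (deriv u0)) (y0 x)" for x
  define r where "r x = deriv v0 (y0 x)" for x
  define r2 where "r2 x = deriv (deriv v0) (y0 x)" for x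
  define Y where "Y x = inverse (\<rho> (y0 x))" for x
  note y0' = y0_has_derivative[folded Y_def]
  have dp: "(p has_real_derivative p2 x * Y x) (at x)" for x
    unfolding p_def[abs_def] p2_def by (rule DERIV_chain2[OF u(1) y0'])
  have dp2: "(p2 has_real_derivative p3 x * Y x) (at x)" for x
    unfolding p2_def[abs_def] p3_def by (rule DERIV_chain2[OF u(2) y0'])
  have dr: "(r has_real_derivative r2 x * Y x) (at x)" for x
    unfolding r_def[abs_def] r2_def by (rule DERIV_chain2[OF v(1) y0'])
  have cy: "continuous_on UNIV y0"
    by (rule derivative_imp_continuous[OF y0'])
  have c: "continuous_on UNIV p" "continuous_on UNIV p2" "continuous_on UNIV p3" "continuous_on UNIV r" "continuous_on UNIV r2"
    using derivative_imp_continuous[OF dp] derivative_imp_continuous[OF dp2] derivative_imp_continuous[OF dr]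
      continuous_on_compose2[OF u(3) cy] continuous_on_compose2[OF derivative_imp_continuous[OF v(2)] cy]
    unfolding p3_def[abs_def] r2_def[abs_def] by auto
  have Y: "Y x = inverse ((1 + (p x)\<^sup>2) * (1 + (r x)\<^sup>2))" for x
    by (simp add: Y_def \<rho>_def p_def r_def)
  have nz: "1 + (p x)\<^sup>2 \<noteq> 0" "1 + (r x)\<^sup>2 \<noteq> 0" for x
    using zero_le_power2[of "p x"] zero_le_power2[of "r x"] by linarith+
  have cY: "continuous_on UNIV Y"
    unfolding Y[abs_def] using nz by (intro continuous_intros c) auto
  \<comment> \<open>One factor \<open>1 + p^2\<close> comes from the arctangent, the others from the
    derivative of \<open>y0\<close>. As \<open>D \<ge> 1\<close>, the first derivative
    \<open>2 * p2 / D\<close> of the angle is bounded like \<open>deriv (deriv u0)\<close>.\<close>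
  define D where "D x = (1 + (p x)\<^sup>2) * ((1 + (p x)\<^sup>2) * (1 + (r x)\<^sup>2))" for x
  define D' where "D' x = 2 * p x * (p2 x * Y x) * ((1 + (p x)\<^sup>2) * (1 + (r x)\<^sup>2)) +
    (1 + (p x)\<^sup>2) * (2 * p x * (p2 x * Y x) * (1 + (r x)\<^sup>2) + (1 + (p x)\<^sup>2) * (2 * r x * (r2 x * Y x)))" for x
  have dD: "(D has_real_derivative D' x) (at x)" for x
    unfolding D_def[abs_def] D'_def by (auto intro!: derivative_eq_intros dp dr simp: algebra_simps power2_eq_square power3_eq_cube)
  have D1: "D x \<ge> 1" for x
    unfolding D_def by (intro mult_ge1_I) auto
  show ?thesis
    unfolding C2_lipschitz_def
  proof (intro exI conjI allI)
    fix x
    have "((\<lambda>x. 2 * arctan (p x)) has_real_derivative 2 * (inverse (1 + (p x)\<^sup>2) * (p2 x * Y x))) (at x)"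
      by (auto intro!: derivative_eq_intros dp)
    moreover have "2 * (inverse (1 + (p x)\<^sup>2) * (p2 x * Y x)) = 2 * p2 x / D x"
      unfolding Y D_def by (simp add: divide_inverse)
    ultimately show "((\<lambda>x. 2 * arctan (deriv u0 (y0 x))) has_real_derivative 2 * p2 x / D x) (at x)"
      by (simp add: p_def[abs_def])
    show "((\<lambda>x. 2 * p2 x / D x) has_real_derivative (2 * (p3 x * Y x) * D x - 2 * p2 x * D' x) / (D x * D x)) (at x)"
      using D1[of x] by (auto intro!: derivative_eq_intros dp2 dD)
    have "\<bar>2 * p2 x / D x\<bar> \<le> \<bar>2 * p2 x\<bar> / 1"
      unfolding abs_divide using D1[of x] by (intro divide_left_mono) auto
    also have "\<dots> \<le> 2 * C"
      using C[of "y0 x"] by (simp add: p2_def)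
    finally show "\<bar>2 * p2 x / D x\<bar> \<le> 2 * C" .
  next
    have "D x \<noteq> 0" for x using D1[of x] by simp
    then show "continuous_on UNIV (\<lambda>x. (2 * (p3 x * Y x) * D x - 2 * p2 x * D' x) / (D x * D x))"
      unfolding D'_def by (intro continuous_intros c cY derivative_imp_continuous[OF dD]) auto
  qed
qed

end

section \<open>Hoelder continuity in space and time\<close>

lemma ode_solution_swap:
  assumes "ode_solution u0 v0 U V W Z q"
  shows "ode_solution v0 u0 V U Z W q"
proof -
  have "ode_system V U Z W q"
    using assms unfolding ode_solution_def ode_system_symmetric by (simp add: add.commute)
  moreover have "solution_class V U Z W q"
    using assms unfolding ode_solution_def solution_class_def by (simp add: insert_commute)
  ultimately show ?thesis
    using assms unfolding ode_solution_def by (simp add: y_init_swap)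
qed

context data
begin

lemma flow_of_ode_solution:
  assumes "ode_solution u0 v0 U V W Z q"
  shows "flow U V W Z q"
proof
  show "ode_system U V W Z q" "solution_class U V W Z q" "q 0 x = 1" for x
    using assms by (auto simp: ode_solution_def)
  have eq: "U 0 = (\<lambda>x. u0 (y0 x))" "V 0 = (\<lambda>x. v0 (y0 x))" "q 0 = (\<lambda>x. 1)"
    "W 0 = (\<lambda>x. 2 * arctan (deriv u0 (y0 x)))" "Z 0 = (\<lambda>x. 2 * arctan (deriv v0 (y0 x)))"
    using assms by (auto simp: ode_solution_def)
  show "(U 0 has_real_derivative hdens W Z q 0 x) (at x)" for x
    using u0_y0_has_derivative by (simp add: hdens_def eq)
  show "(V 0 has_real_derivative hdens Z W q 0 x) (at x)" for x
    using data.u0_y0_has_derivative[OF swap] by (simp add: hdens_def eq y_init_swap[of v0])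
  show "C2_lipschitz (W 0)" "C2_lipschitz (Z 0)"
    using C2_lipschitz_angle data.C2_lipschitz_angle[OF swap] by (simp_all add: eq y_init_swap[of v0])
qed

lemma hoelder:
  assumes sol: "ode_solution u0 v0 U V W Z q" and T: "T > 0" and nd: "nondegenerate_level T W"
    and y: "\<And>t x. y t x = y0 x + (LBINT \<tau>=ereal 0..ereal t. U \<tau> x * V \<tau> x)"
    and u: "\<And>t x. u t (y t x) = U t x"
    and \<theta>: "\<theta> = 3/5 \<or> \<theta> = 7/9 \<and> U = V"
  shows "\<exists>C>0. \<forall>t1\<in>{-T..T}. \<forall>t2\<in>{-T..T}. \<forall>x1 x2.
    \<bar>u t1 x1 - u t2 x2\<bar> \<le> C * (\<bar>t1 - t2\<bar> powr \<theta> + \<bar>x1 - x2\<bar> powr \<theta>)"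
proof -
  interpret flow U V W Z q by (rule flow_of_ode_solution[OF sol])
  have eq: "W 0 = (\<lambda>x. 2 * arctan (deriv u0 (y0 x)))" "Z 0 = (\<lambda>x. 2 * arctan (deriv v0 (y0 x)))"
    using sol by (auto simp: ode_solution_def)
  have cUV: "continuous_on UNIV (\<lambda>\<tau>. U \<tau> x * V \<tau> x)" for x
    by (intro continuous_intros jc_time jc_states)
  have yp: "y = (\<lambda>t x. y0 x + prim (\<lambda>\<tau>. U \<tau> x * V \<tau> x) t)"
    by (intro ext) (simp add: y LBINT_eq_prim[OF cUV])
  have "(y0 has_real_derivative gdens W Z q 0 x) (at x)" for x
    using y0_has_derivative[of x] unfolding y0_derivative_trig by (simp add: gdens_def q0 eq)
  then have y': "C1x y (gdens W Z q)"
    unfolding yp by (rule C1x_characteristic)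
  have yt: "((\<lambda>\<tau>. y \<tau> x) has_real_derivative U t x * V t x) (at t)" for t x
    unfolding yp by (auto intro!: derivative_eq_intros prim_has_derivative cUV)
  have lUV: "lbd (\<lambda>t x. U t x * V t x)"
    by (intro lbd_intros lbd_states)
  have y_0: "y 0 x = y0 x" for x
    by (simp add: yp)
  have surj: "\<exists>\<xi>. y t \<xi> = x" for t x
  proof -
    have "\<bar>t\<bar> + 1 > 0" by simp
    then obtain L where L: "L > 0"
      "\<And>s r x. s \<in> {-(\<bar>t\<bar> + 1)..\<bar>t\<bar> + 1} \<Longrightarrow> r \<in> {-(\<bar>t\<bar> + 1)..\<bar>t\<bar> + 1} \<Longrightarrow> \<bar>y s x - y r x\<bar> \<le> L * \<bar>s - r\<bar>"
      using lipschitz_in_time[OF yt lUV] by metis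
    \<comment> \<open>By time \<open>t\<close> a characteristic has moved at most \<open>N\<close>,
      so those issuing from \<open>x - N\<close> and \<open>x + N\<close> lie on the two sides of
      \<open>x\<close>, and the intermediate value theorem applies.\<close>
    define N where "N = L * \<bar>t\<bar>"
    have "t \<in> {-(\<bar>t\<bar> + 1)..\<bar>t\<bar> + 1}" "0 \<in> {-(\<bar>t\<bar> + 1)..\<bar>t\<bar> + 1}"
      by (auto simp: abs_if)
    from L(2)[OF this] have N: "\<bar>y t \<xi> - y0 \<xi>\<bar> \<le> N" for \<xi>
      by (simp add: y_0 N_def)
    have "N \<ge> 0" using L(1) by (simp add: N_def)
    then have "prim \<rho> (x - N) \<le> prim \<rho> (x + N)"
      using prim_\<rho>_expanding[of "x - N" "x + N"] by simp
    moreover have "y t (prim \<rho> (x - N)) \<le> x" "x \<le> y t (prim \<rho> (x + N))"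
      using N[of "prim \<rho> (x - N)"] N[of "prim \<rho> (x + N)"] by (auto simp: y0_prim_\<rho> abs_le_iff)
    moreover have "continuous_on S (y t)" for S
      using jc_at[OF C1xD(1)[OF y']] continuous_on_subset by blast
    ultimately show ?thesis
      using IVT'[of "y t"] by blast
  qed
  obtain K where K: "K > 0" "\<And>t a b. t \<in> {-T..T} \<Longrightarrow> \<bar>U t a - U t b\<bar> \<le> K * \<bar>y t a - y t b\<bar> powr \<theta>"
    using space_hoelder_3_5[OF T nd y'] space_hoelder_7_9[OF T nd y'] \<theta> by blast
  obtain L where L: "L > 0" "\<And>s t x. s \<in> {-T..T} \<Longrightarrow> t \<in> {-T..T} \<Longrightarrow> \<bar>U s x - U t x\<bar> \<le> L * \<bar>s - t\<bar>"
    using lipschitz_in_time[OF der_U lbd_ffun T] by metis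
  obtain M where M: "M > 0" "\<And>s t x. s \<in> {-T..T} \<Longrightarrow> t \<in> {-T..T} \<Longrightarrow> \<bar>y s x - y t x\<bar> \<le> M * \<bar>s - t\<bar>"
    using lipschitz_in_time[OF yt lUV T] by metis
  have "0 < \<theta>" "\<theta> \<le> 1" using \<theta> by auto
  from hoelder_of_characteristics[OF this T u surj K L M] show ?thesis .
qed

end

theorem corollary1p10:
  fixes k :: nat and T :: real and M :: "((real \<Rightarrow> real) \<times> (real \<Rightarrow> real)) set"
  assumes "k \<ge> 8" and "T > 0" and "generic_set k T M"
  shows "(\<forall>u0 v0 u v \<mu>. (u0, v0) \<in> M \<longrightarrow> global_conservative_solution u0 v0 u v \<mu> \<longrightarrow>
            (\<exists>C>0. \<forall>t1\<in>{-T..T}. \<forall>t2\<in>{-T..T}. \<forall>x1 x2.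
               \<bar>u t1 x1 - u t2 x2\<bar> \<le> C * (\<bar>t1 - t2\<bar> powr (3/5) + \<bar>x1 - x2\<bar> powr (3/5)) \<and>
               \<bar>v t1 x1 - v t2 x2\<bar> \<le> C * (\<bar>t1 - t2\<bar> powr (3/5) + \<bar>x1 - x2\<bar> powr (3/5))))
       \<and> (\<forall>u0 u \<mu>. (u0, u0) \<in> M \<longrightarrow> global_conservative_solution u0 u0 u u \<mu> \<longrightarrow>
            (\<exists>C>0. \<forall>t1\<in>{-T..T}. \<forall>t2\<in>{-T..T}. \<forall>x1 x2.
               \<bar>u t1 x1 - u t2 x2\<bar> \<le> C * (\<bar>t1 - t2\<bar> powr (7/9) + \<bar>x1 - x2\<bar> powr (7/9))))"
proof -
  have data: "data u0 v0 k" if "(u0, v0) \<in> M" for u0 v0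
    using that assms unfolding generic_set_def open_in_Upsilon_def Upsilon_def
    by unfold_locales auto
  have nd: "nondegenerate_level T W" "nondegenerate_level T Z"
    if "(u0, v0) \<in> M" "conservative_construction u0 v0 U V W Z q y u v \<mu>" for u0 v0 U V W Z q y u v \<mu>
    using that assms(3) unfolding generic_set_def generic_properties_def by blast+
  show ?thesis
  proof (intro conjI allI impI)
    fix u0 v0 u v \<mu> assume M: "(u0, v0) \<in> M" and "global_conservative_solution u0 v0 u v \<mu>"
    then obtain U V W Z q y where cc: "conservative_construction u0 v0 U V W Z q y u v \<mu>"
      unfolding global_conservative_solution_def by blast
    then have ode: "ode_solution u0 v0 U V W Z q"
      and y: "\<And>t x. y t x = y_init u0 v0 x + (LBINT \<tau>=ereal 0..ereal t. U \<tau> x * V \<tau> x)"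
      and uv: "\<And>t x. u t (y t x) = U t x" "\<And>t x. v t (y t x) = V t x"
      unfolding conservative_construction_def by blast+
    have y': "y t x = y_init v0 u0 x + (LBINT \<tau>=ereal 0..ereal t. V \<tau> x * U \<tau> x)" for t x
      using y by (simp add: y_init_swap mult.commute)
    interpret data u0 v0 k by (rule data[OF M])
    obtain C1 where C1: "C1 > 0" "\<And>t1 t2 x1 x2. t1 \<in> {-T..T} \<Longrightarrow> t2 \<in> {-T..T} \<Longrightarrow>
        \<bar>u t1 x1 - u t2 x2\<bar> \<le> C1 * (\<bar>t1 - t2\<bar> powr (3/5) + \<bar>x1 - x2\<bar> powr (3/5))"
      using hoelder[OF ode assms(2) nd(1)[OF M cc] y uv(1), of "3/5"] by blast
    \<comment> \<open>The estimate for \<open>v\<close> is the one for the first component of the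
      exchanged system; it draws on the nondegeneracy of \<open>Z\<close> in place of
      \<open>W\<close>.\<close>
    obtain C2 where C2: "C2 > 0" "\<And>t1 t2 x1 x2. t1 \<in> {-T..T} \<Longrightarrow> t2 \<in> {-T..T} \<Longrightarrow>
        \<bar>v t1 x1 - v t2 x2\<bar> \<le> C2 * (\<bar>t1 - t2\<bar> powr (3/5) + \<bar>x1 - x2\<bar> powr (3/5))"
      using data.hoelder[OF swap ode_solution_swap[OF ode] assms(2) nd(2)[OF M cc] y' uv(2), of "3/5"] by blast
    show "\<exists>C>0. \<forall>t1\<in>{-T..T}. \<forall>t2\<in>{-T..T}. \<forall>x1 x2.
               \<bar>u t1 x1 - u t2 x2\<bar> \<le> C * (\<bar>t1 - t2\<bar> powr (3/5) + \<bar>x1 - x2\<bar> powr (3/5)) \<and>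
               \<bar>v t1 x1 - v t2 x2\<bar> \<le> C * (\<bar>t1 - t2\<bar> powr (3/5) + \<bar>x1 - x2\<bar> powr (3/5))"
    proof (rule exI[of _ "C1 + C2"], intro conjI ballI allI)
      fix t1 t2 x1 x2 assume t: "t1 \<in> {-T..T}" "t2 \<in> {-T..T}"
      define N where "N = \<bar>t1 - t2\<bar> powr (3/5) + \<bar>x1 - x2\<bar> powr (3/5)"
      have "N \<ge> 0" by (simp add: N_def)
      then have "C1 * N \<le> (C1 + C2) * N" "C2 * N \<le> (C1 + C2) * N"
        using C1(1) C2(1) by (auto intro!: mult_right_mono)
      then show "\<bar>u t1 x1 - u t2 x2\<bar> \<le> (C1 + C2) * (\<bar>t1 - t2\<bar> powr (3/5) + \<bar>x1 - x2\<bar> powr (3/5))"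
        "\<bar>v t1 x1 - v t2 x2\<bar> \<le> (C1 + C2) * (\<bar>t1 - t2\<bar> powr (3/5) + \<bar>x1 - x2\<bar> powr (3/5))"
        using C1(2)[OF t, of x1 x2] C2(2)[OF t, of x1 x2] unfolding N_def[symmetric] by linarith+
    qed (use C1 C2 in simp)
  next
    fix u0 u \<mu> assume M: "(u0, u0) \<in> M" and "global_conservative_solution u0 u0 u u \<mu>"
    then obtain U V W Z q y where cc: "conservative_construction u0 u0 U V W Z q y u u \<mu>"
      unfolding global_conservative_solution_def by blast
    then have ode: "ode_solution u0 u0 U V W Z q"
      and y: "\<And>t x. y t x = y_init u0 u0 x + (LBINT \<tau>=ereal 0..ereal t. U \<tau> x * V \<tau> x)"
      and uv: "\<And>t x. u t (y t x) = U t x" "\<And>t x. u t (y t x) = V t x"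
      unfolding conservative_construction_def by blast+
    \<comment> \<open>The two components are the same function read along the same
      characteristics.\<close>
    have "U = V"
      using uv by (intro ext) metis
    then show "\<exists>C>0. \<forall>t1\<in>{-T..T}. \<forall>t2\<in>{-T..T}. \<forall>x1 x2.
               \<bar>u t1 x1 - u t2 x2\<bar> \<le> C * (\<bar>t1 - t2\<bar> powr (7/9) + \<bar>x1 - x2\<bar> powr (7/9))"
      using data.hoelder[OF data[OF M] ode assms(2) nd(1)[OF M cc] y uv(1)] by blast
  qed
qed

end
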